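(* Let $\mu,\nu$ be probability measures on $\mathbb{R}$ with $\mu\preceq_C\nu$ (convex order). Assume that $c(x,y)=h(y-x)$ for some differentiable function $h:\mathbb{R}\to\mathbb{R}$ whose derivative is strictly convex and that $c$ satisfies the sufficient integrability condition with respect to $\mu,\nu$. If $C_M(\mu,\nu)<\infty$, then the left-curtain coupling $\pi_{\mathrm{lc}}$ is the unique minimizer of $\pi\mapsto\iint c(x,y)\,d\pi(x,y)$ over $\Pi_M(\mu,\nu)$.
   Context: Convex order: two finite Borel measures $\mu,\nu$ on $\mathbb{R}$ with finite first moments satisfy $\mu\preceq_C\nu$ if $\int\varphi\,d\mu\le\int\varphi\,d\nu$ for every convex $\varphi:\mathbb{R}\to\mathbb{R}$. $\Pi_M(\mu,\nu)$ (martingale transport plans) is the set of Borel measures $\pi$ on $\mathbb{R}\times\mathbb{R}$ with first marginal $\mu$, second marginal $\nu$, whose disintegration $(\pi_x)_{x\in\mathbb{R}}$ into probability measures with respect to $\mu$ satisfies $\int y\,d\pi_x(y)=x$ for $\mu$-a.e. $x$. $C_M(\mu,\nu)=\inf\{\iint c\,d\pi:\pi\in\Pi_M(\mu,\nu)\}$. Sufficient integrability condition: $c(x,y)\ge a(x)+b(y)$ for all $x,y$, where $a$ is $\mu$-integrable and $b$ is $\nu$-integrable. A martingale transport plan $\pi$ is left-monotone if there is a Borel set $\Gamma\subseteq\mathbb{R}\times\mathbb{R}$ with $\pi(\Gamma)=1$ such that whenever $(x,y^-),(x,y^+),(x',y')\in\Gamma$, one cannot have both $x<x'$ and $y^-<y'<y^+$.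 The left-curtain coupling $\pi_{\mathrm{lc}}$ is the unique left-monotone element of $\Pi_M(\mu,\nu)$ (it exists and is unique whenever $\mu\preceq_C\nu$). *)

theory Defs
  imports "HOL-Probability.Probability"
begin

text \<open>
  The integral of a real function with values in the extended reals. It is meant for functions
  whose negative part is integrable, where it equals the Lebesgue integral if \<open>f\<close> is integrable
  and \<open>\<infinity>\<close> otherwise. (\<open>ennreal\<close> maps negative reals to \<open>0\<close>, so the two terms are the integrals
  of the positive and the negative part.)
\<close>
definition ext_integral :: "'a measure \<Rightarrow> ('a \<Rightarrow> real) \<Rightarrow> ereal" where
  "ext_integral M f =
     enn2ereal (\<integral>\<^sup>+ x. ennreal (f x) \<partial>M) - enn2ereal (\<integral>\<^sup>+ x. ennreal (- f x) \<partial>M)"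

definition finite_first_moment :: "real measure \<Rightarrow> bool" where
  "finite_first_moment \<mu> \<longleftrightarrow>
     finite_measure \<mu> \<and> sets \<mu> = sets borel \<and> integrable \<mu> (\<lambda>x. x)"

text \<open>
  A convex function lies above an affine one, so under the first-moment condition its negative
  part is integrable and the integrals below are well defined, possibly \<open>\<infinity>\<close>.
\<close>
definition convex_order :: "real measure \<Rightarrow> real measure \<Rightarrow> bool"  (infix "\<preceq>\<^sub>C" 50) where
  "\<mu> \<preceq>\<^sub>C \<nu> \<longleftrightarrow>
     finite_first_moment \<mu> \<and> finite_first_moment \<nu> \<and>
     (\<forall>\<phi> :: real \<Rightarrow> real. convex_on UNIV \<phi> \<longrightarrow> ext_integral \<mu> \<phi> \<le> ext_integral \<nu> \<phi>)"

definition transport_plans :: "real measure \<Rightarrow> real measure \<Rightarrow> (real \<times> real) measure set" where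
  "transport_plans \<mu> \<nu> =
     {\<pi>. sets \<pi> = sets borel \<and> distr \<pi> borel fst = \<mu> \<and> distr \<pi> borel snd = \<nu>}"

definition disintegration ::
  "(real \<times> real) measure \<Rightarrow> real measure \<Rightarrow> (real \<Rightarrow> real measure) \<Rightarrow> bool" where
  "disintegration \<pi> \<mu> \<kappa> \<longleftrightarrow>
     \<kappa> \<in> borel \<rightarrow>\<^sub>M prob_algebra borel \<and>
     (\<forall>C \<in> sets borel. emeasure \<pi> C = (\<integral>\<^sup>+ x. emeasure (\<kappa> x) (Pair x -` C) \<partial>\<mu>))"

text \<open>
  The disintegration is unique up to a \<open>\<mu>\<close>-null set, so it does not matter which one is chosen.
  Integrability is required explicitly because the Bochner integral of a non-integrable function
  is \<open>0\<close>.
\<close>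
definition martingale_plans :: "real measure \<Rightarrow> real measure \<Rightarrow> (real \<times> real) measure set" where
  "martingale_plans \<mu> \<nu> =
     {\<pi> \<in> transport_plans \<mu> \<nu>. \<exists>\<kappa>. disintegration \<pi> \<mu> \<kappa> \<and>
        (AE x in \<mu>. integrable (\<kappa> x) (\<lambda>y. y) \<and> (\<integral>y. y \<partial>\<kappa> x) = x)}"

definition transport_cost :: "(real \<Rightarrow> real \<Rightarrow> real) \<Rightarrow> (real \<times> real) measure \<Rightarrow> ereal" where
  "transport_cost c \<pi> = ext_integral \<pi> (\<lambda>(x, y). c x y)"

definition optimal_cost ::
  "(real \<Rightarrow> real \<Rightarrow> real) \<Rightarrow> real measure \<Rightarrow> real measure \<Rightarrow> ereal" where
  "optimal_cost c \<mu> \<nu> = (INF \<pi> \<in> martingale_plans \<mu> \<nu>. transport_cost c \<pi>)"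

definition minimizers ::
  "(real \<Rightarrow> real \<Rightarrow> real) \<Rightarrow> real measure \<Rightarrow> real measure \<Rightarrow> (real \<times> real) measure set" where
  "minimizers c \<mu> \<nu> =
     {\<pi> \<in> martingale_plans \<mu> \<nu>. \<forall>\<pi>' \<in> martingale_plans \<mu> \<nu>. transport_cost c \<pi> \<le> transport_cost c \<pi>'}"

definition sufficient_integrability ::
  "(real \<Rightarrow> real \<Rightarrow> real) \<Rightarrow> real measure \<Rightarrow> real measure \<Rightarrow> bool" where
  "sufficient_integrability c \<mu> \<nu> \<longleftrightarrow>
     (\<exists>a b. integrable \<mu> a \<and> integrable \<nu> b \<and> (\<forall>x y. c x y \<ge> a x + b y))"

definition left_monotone :: "(real \<times> real) measure \<Rightarrow> bool" where
  "left_monotone \<pi> \<longleftrightarrow>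
     (\<exists>\<Gamma> \<in> sets borel. emeasure \<pi> \<Gamma> = 1 \<and>
        (\<forall>x ym yp x' y'. (x, ym) \<in> \<Gamma> \<longrightarrow> (x, yp) \<in> \<Gamma> \<longrightarrow> (x', y') \<in> \<Gamma> \<longrightarrow>
           \<not> (x < x' \<and> ym < y' \<and> y' < yp)))"

definition left_curtain :: "real measure \<Rightarrow> real measure \<Rightarrow> (real \<times> real) measure" where
  "left_curtain \<mu> \<nu> = (THE \<pi>. \<pi> \<in> martingale_plans \<mu> \<nu> \<and> left_monotone \<pi>)"

definition strictly_convex :: "(real \<Rightarrow> real) \<Rightarrow> bool" where
  "strictly_convex f \<longleftrightarrow>
     (\<forall>x y t. x \<noteq> y \<longrightarrow> 0 < t \<longrightarrow> t < 1 \<longrightarrow>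
        f ((1 - t) * x + t * y) < (1 - t) * f x + t * f y)"

end

theory Submission
  imports Defs
begin

text \<open>
  Plans are represented by kernels. Existence of a minimizer: among almost optimal kernels one minimizes
  a strictly convex quadratic functional of the conditional distribution functions; the parallelogram law
  makes such a sequence Cauchy, so along a subsequence the fibres converge weakly almost everywhere, and
  Fatou's lemma gives lower semicontinuity of the cost.

  A minimizer is left-monotone: if fibres over \<open>x \<le> s\<close> spread across \<open>(p, q)\<close> while some \<open>x' > s\<close> send mass
  into \<open>(p, q)\<close>, one exchanges these masses, keeping both marginals and all barycentres. The cost
  decreases, since \<open>c(x, \<cdot>) - c(s, \<cdot>)\<close> is convex for \<open>x \<le> s\<close> and strictly concave for \<open>x > s\<close>.
  The cases \<open>(s, p, q)\<close> rational suffice.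

  A left-monotone plan minimizes \<open>\<integral>\<integral> 1(x \<le> s) (y - k)\<^sup>+ d\<pi>\<close> for all \<open>s\<close> and \<open>k\<close> simultaneously,
  by a maximum principle in \<open>k\<close>, and these numbers determine the plan. Hence it is unique.
\<close>


section \<open>Kernels and plans\<close>

text \<open>Three choices shape the argument. A weak limit of plans would have to be disintegrated
  anew; picking almost optimal kernels of nearly least L2 norm makes the fibres themselves converge,
  so the limit arrives as a kernel and its constraints can be checked on fibres. In the exchange,
  moving mass within a fibre must not shift its barycentre: the mass taken from the two outer pieces
  is weighted crosswise, each piece by the first moment of the other, and the mass taken from the
  middle is split over two outer laws in the proportion that preserves its position on average. As
  the second marginal is then unchanged, the function c(s, y) of y alone may be subtracted from the
  cost for free, and a chord over [p, q] controls what remains both inside and outside the interval.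
  Finally, the left-curtain coupling needs no construction of its own: some minimizer exists and is
  left-monotone, which gives existence, while the comparison of potentials gives uniqueness among
  all left-monotone plans.\<close>

lemma
  fixes f :: "'b \<Rightarrow> real"
  assumes K: "K \<in> M \<rightarrow>\<^sub>M subprob_algebra N" and ne: "space M \<noteq> {}"
    and f: "integrable (M \<bind> K) f"
  shows AE_integrable_bind: "AE x in M. integrable (K x) f"
    and integrable_integral_bind: "integrable M (\<lambda>x. \<integral>y. f y \<partial>K x)"
    and integral_bind_eq: "(\<integral>y. f y \<partial>(M \<bind> K)) = (\<integral>x. \<integral>y. f y \<partial>K x \<partial>M)"
proof -
  have [measurable_cong]: "sets (M \<bind> K) = sets N"
    by (rule sets_bind_measurable[OF K ne])
  have fN [measurable]: "f \<in> borel_measurable N"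
    using borel_measurable_integrable[OF f] by simp
  have setsK: "sets (K x) = sets N" if "x \<in> space M" for x
    using K that by (rule sets_kernel)
  note [measurable] = K
  \<comment> \<open>One statement for every g dominated by |f| serves the positive part, the
    negative part and the modulus. The finite integral of |f| over \<open>M \<bind> K\<close> makes
    almost every fibre integral finite, so \<open>enn2real\<close> loses nothing.\<close>
  have part: "integrable M (\<lambda>x. enn2real (\<integral>\<^sup>+ y. ennreal (g y) \<partial>K x)) \<and>
      (\<integral>\<^sup>+ y. ennreal (g y) \<partial>(M \<bind> K)) = ennreal (\<integral>x. enn2real (\<integral>\<^sup>+ y. ennreal (g y) \<partial>K x) \<partial>M) \<and>
      (AE x in M. (\<integral>\<^sup>+ y. ennreal (g y) \<partial>K x) < \<infinity>)"
    if g [measurable]: "g \<in> borel_measurable N" and le: "\<And>y. g y \<le> \<bar>f y\<bar>" for g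
  proof -
    have m: "(\<lambda>x. \<integral>\<^sup>+ y. ennreal (g y) \<partial>K x) \<in> borel_measurable M"
      by measurable
    have eq: "(\<integral>\<^sup>+ y. ennreal (g y) \<partial>(M \<bind> K)) = (\<integral>\<^sup>+ x. \<integral>\<^sup>+ y. ennreal (g y) \<partial>K x \<partial>M)"
      by (intro nn_integral_bind[OF _ K]) measurable
    have "(\<integral>\<^sup>+ y. ennreal (g y) \<partial>(M \<bind> K)) \<le> (\<integral>\<^sup>+ y. ennreal \<bar>f y\<bar> \<partial>(M \<bind> K))"
      by (intro nn_integral_mono ennreal_leI le)
    also have "\<dots> < \<infinity>"
      using f by (simp add: integrable_iff_bounded)
    finally have fin: "(\<integral>\<^sup>+ x. \<integral>\<^sup>+ y. ennreal (g y) \<partial>K x \<partial>M) < \<infinity>"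
      using eq by simp
    have ae: "AE x in M. (\<integral>\<^sup>+ y. ennreal (g y) \<partial>K x) \<noteq> \<infinity>"
      by (rule nn_integral_noteq_infinite[OF m]) (use fin in simp)
    have eq2: "(\<integral>\<^sup>+ x. ennreal (enn2real (\<integral>\<^sup>+ y. ennreal (g y) \<partial>K x)) \<partial>M) =
        (\<integral>\<^sup>+ x. \<integral>\<^sup>+ y. ennreal (g y) \<partial>K x \<partial>M)"
      using ae by (intro nn_integral_cong_AE) (auto simp: top.not_eq_extremum ennreal_enn2real_if)
    have int: "integrable M (\<lambda>x. enn2real (\<integral>\<^sup>+ y. ennreal (g y) \<partial>K x))"
      by (rule integrableI_nonneg) (use eq2 fin m in auto)
    show ?thesis
      using int eq eq2 ae nn_integral_eq_integral[OF int]
      by (auto simp: top.not_eq_extremum)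
  qed
  have p: "integrable M (\<lambda>x. enn2real (\<integral>\<^sup>+ y. ennreal (f y) \<partial>K x))"
    "(\<integral>\<^sup>+ y. ennreal (f y) \<partial>(M \<bind> K)) = ennreal (\<integral>x. enn2real (\<integral>\<^sup>+ y. ennreal (f y) \<partial>K x) \<partial>M)"
    using part[of f] by auto
  have n: "integrable M (\<lambda>x. enn2real (\<integral>\<^sup>+ y. ennreal (- f y) \<partial>K x))"
    "(\<integral>\<^sup>+ y. ennreal (- f y) \<partial>(M \<bind> K)) = ennreal (\<integral>x. enn2real (\<integral>\<^sup>+ y. ennreal (- f y) \<partial>K x) \<partial>M)"
    using part[of "\<lambda>y. - f y"] by auto
  have "AE x in M. (\<integral>\<^sup>+ y. ennreal \<bar>f y\<bar> \<partial>K x) < \<infinity>"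
    using part[of "\<lambda>y. \<bar>f y\<bar>"] by auto
  then show ae: "AE x in M. integrable (K x) f"
    using AE_space
  proof eventually_elim
    case (elim x)
    then have "f \<in> borel_measurable (K x)"
      using fN setsK measurable_cong_sets by blast
    with elim show ?case
      by (simp add: integrable_iff_bounded)
  qed
  have eq: "AE x in M. enn2real (\<integral>\<^sup>+ y. ennreal (f y) \<partial>K x) - enn2real (\<integral>\<^sup>+ y. ennreal (- f y) \<partial>K x) = (\<integral>y. f y \<partial>K x)"
    using ae by eventually_elim (simp add: real_lebesgue_integral_def)
  have mI: "(\<lambda>x. \<integral>y. f y \<partial>K x) \<in> borel_measurable M"
    by measurable
  show "integrable M (\<lambda>x. \<integral>y. f y \<partial>K x)"
    by (rule integrable_cong_AE_imp[OF Bochner_Integration.integrable_diff[OF p(1) n(1)] mI])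
      (use eq in auto)
  have "(\<integral>y. f y \<partial>(M \<bind> K)) = (\<integral>x. enn2real (\<integral>\<^sup>+ y. ennreal (f y) \<partial>K x) \<partial>M)
       - (\<integral>x. enn2real (\<integral>\<^sup>+ y. ennreal (- f y) \<partial>K x) \<partial>M)"
    by (simp add: real_lebesgue_integral_def[OF f] p n)
  also have "\<dots> = (\<integral>x. enn2real (\<integral>\<^sup>+ y. ennreal (f y) \<partial>K x) - enn2real (\<integral>\<^sup>+ y. ennreal (- f y) \<partial>K x) \<partial>M)"
    using p n by simp
  also have "\<dots> = (\<integral>x. \<integral>y. f y \<partial>K x \<partial>M)"
    using eq p n mI by (intro integral_cong_AE) auto
  finally show "(\<integral>y. f y \<partial>(M \<bind> K)) = (\<integral>x. \<integral>y. f y \<partial>K x \<partial>M)" .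
qed

lemma integrable_bindI:
  fixes f :: "'b \<Rightarrow> real"
  assumes K: "K \<in> M \<rightarrow>\<^sub>M subprob_algebra N" and ne: "space M \<noteq> {}"
    and f [measurable]: "f \<in> borel_measurable N"
    and fin: "(\<integral>\<^sup>+ x. \<integral>\<^sup>+ y. ennreal \<bar>f y\<bar> \<partial>K x \<partial>M) < \<infinity>"
  shows "integrable (M \<bind> K) f"
proof -
  have s: "sets (M \<bind> K) = sets N"
    by (rule sets_bind_measurable[OF K ne])
  have "f \<in> borel_measurable (M \<bind> K)"
    using f s measurable_cong_sets by blast
  moreover have "(\<integral>\<^sup>+ y. ennreal \<bar>f y\<bar> \<partial>(M \<bind> K)) < \<infinity>"
    using fin by (subst nn_integral_bind[OF _ K]) auto
  ultimately show ?thesis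
    by (simp add: integrable_iff_bounded)
qed

section \<open>Semidirect products and mixtures of measures\<close>

lemma borel_measurable_fst_borel [measurable]: "fst \<in> borel_measurable (borel :: (real \<times> real) measure)"
  and borel_measurable_snd_borel [measurable]: "snd \<in> borel_measurable (borel :: (real \<times> real) measure)"
  by (auto intro!: borel_measurable_continuous_onI continuous_intros)

text \<open>The joint law of a point x drawn from \<mu> and a point y then drawn from \<kappa> x.
  Its disintegration is \<kappa> by construction, so a plan can be altered one fibre at a
  time.\<close>

definition semidirect :: "real measure \<Rightarrow> (real \<Rightarrow> real measure) \<Rightarrow> (real \<times> real) measure" where
  "semidirect \<mu> \<kappa> = \<mu> \<bind> (\<lambda>x. distr (\<kappa> x) (borel \<Otimes>\<^sub>M borel) (Pair x))"

locale kernel =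
  fixes \<mu> :: "real measure" and \<kappa> :: "real \<Rightarrow> real measure"
  assumes prob_mu: "prob_space \<mu>" and sets_mu [measurable_cong]: "sets \<mu> = sets borel"
    and kernel [measurable]: "\<kappa> \<in> borel \<rightarrow>\<^sub>M prob_algebra borel"
begin

lemma space_mu [simp]: "space \<mu> = UNIV"
  using sets_eq_imp_space_eq[OF sets_mu] by simp

lemma prob_kernel: "prob_space (\<kappa> x)"
  using measurable_space[OF kernel, of x] by (simp add: space_prob_algebra)

lemma sets_kernel [measurable_cong, simp]: "sets (\<kappa> x) = sets borel"
  using measurable_space[OF kernel, of x] by (simp add: space_prob_algebra)

lemma space_kernel [simp]: "space (\<kappa> x) = UNIV"
  using sets_eq_imp_space_eq[OF sets_kernel] by simp

lemma kernel_subprob [measurable]: "\<kappa> \<in> borel \<rightarrow>\<^sub>M subprob_algebra borel"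
  using kernel by (rule measurable_prob_algebraD)

lemma measurable_Pair_kernel:
  "(\<lambda>x. distr (\<kappa> x) (borel \<Otimes>\<^sub>M borel) (Pair x)) \<in> \<mu> \<rightarrow>\<^sub>M prob_algebra (borel \<Otimes>\<^sub>M borel)"
  by (rule measurable_distr_prob_space2[where M=borel]) measurable

lemma measurable_Pair_kernel':
  "(\<lambda>x. distr (\<kappa> x) (borel \<Otimes>\<^sub>M borel) (Pair x)) \<in> \<mu> \<rightarrow>\<^sub>M subprob_algebra (borel \<Otimes>\<^sub>M borel)"
  by (rule measurable_prob_algebraD[OF measurable_Pair_kernel])

lemma sets_semidirect_pair: "sets (semidirect \<mu> \<kappa>) = sets (borel \<Otimes>\<^sub>M borel)"
  unfolding semidirect_def by (rule sets_bind_measurable[OF measurable_Pair_kernel']) simp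

lemma sets_semidirect [measurable_cong, simp]: "sets (semidirect \<mu> \<kappa>) = sets borel"
  by (simp only: sets_semidirect_pair borel_prod)

lemma space_semidirect [simp]: "space (semidirect \<mu> \<kappa>) = UNIV"
  using sets_eq_imp_space_eq[OF sets_semidirect] by simp

lemma prob_semidirect: "prob_space (semidirect \<mu> \<kappa>)"
  unfolding semidirect_def
  by (rule prob_space.prob_space_bind[OF prob_mu _ measurable_Pair_kernel'])
    (auto intro!: AE_I2 prob_space.prob_space_distr prob_kernel)

lemma nn_integral_semidirect:
  assumes f: "f \<in> borel_measurable borel"
  shows "(\<integral>\<^sup>+ z. f z \<partial>semidirect \<mu> \<kappa>) = (\<integral>\<^sup>+ x. \<integral>\<^sup>+ y. f (x, y) \<partial>\<kappa> x \<partial>\<mu>)"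
proof -
  have f [measurable]: "f \<in> borel_measurable (borel \<Otimes>\<^sub>M borel)"
    using f by (simp add: borel_prod)
  show ?thesis
    unfolding semidirect_def
    by (subst nn_integral_bind[OF _ measurable_Pair_kernel']) (simp_all add: nn_integral_distr)
qed

lemma emeasure_semidirect:
  assumes "A \<in> sets borel"
  shows "emeasure (semidirect \<mu> \<kappa>) A = (\<integral>\<^sup>+ x. emeasure (\<kappa> x) (Pair x -` A) \<partial>\<mu>)"
proof -
  have A [measurable]: "A \<in> sets (borel \<Otimes>\<^sub>M borel)"
    using assms by (simp only: borel_prod)
  have "emeasure (semidirect \<mu> \<kappa>) A = (\<integral>\<^sup>+ z. indicator A z \<partial>semidirect \<mu> \<kappa>)"
    using assms by simp
  also have "\<dots> = (\<integral>\<^sup>+ x. \<integral>\<^sup>+ y. indicator A (x, y) \<partial>\<kappa> x \<partial>\<mu>)"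
    using assms by (intro nn_integral_semidirect) simp
  also have "\<dots> = (\<integral>\<^sup>+ x. \<integral>\<^sup>+ y. indicator (Pair x -` A) y \<partial>\<kappa> x \<partial>\<mu>)"
    by (simp add: indicator_def)
  also have "\<dots> = (\<integral>\<^sup>+ x. emeasure (\<kappa> x) (Pair x -` A) \<partial>\<mu>)"
    using sets_Pair1[OF A] by (intro nn_integral_cong nn_integral_indicator) simp
  finally show ?thesis .
qed

lemma AE_semidirect:
  assumes "Measurable.pred borel P"
  shows "(AE z in semidirect \<mu> \<kappa>. P z) \<longleftrightarrow> (AE x in \<mu>. AE y in \<kappa> x. P (x, y))"
proof -
  have [measurable]: "Measurable.pred (borel \<Otimes>\<^sub>M borel) P"
    using assms by (simp add: borel_prod)
  show ?thesis
    unfolding semidirect_def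
    by (subst AE_bind[OF measurable_Pair_kernel']) (simp_all add: AE_distr_iff pred_def)
qed

lemma
  fixes f :: "real \<times> real \<Rightarrow> real"
  assumes f: "integrable (semidirect \<mu> \<kappa>) f"
  shows AE_integrable_semidirect: "AE x in \<mu>. integrable (\<kappa> x) (\<lambda>y. f (x, y))"
    and integrable_integral_semidirect: "integrable \<mu> (\<lambda>x. \<integral>y. f (x, y) \<partial>\<kappa> x)"
    and integral_semidirect: "(\<integral>z. f z \<partial>semidirect \<mu> \<kappa>) = (\<integral>x. \<integral>y. f (x, y) \<partial>\<kappa> x \<partial>\<mu>)"
proof -
  have fm [measurable]: "f \<in> borel_measurable (borel \<Otimes>\<^sub>M borel)"
    using borel_measurable_integrable[OF f] by (simp add: measurable_cong_sets[OF sets_semidirect_pair refl])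
  note * = f[unfolded semidirect_def]
  show "AE x in \<mu>. integrable (\<kappa> x) (\<lambda>y. f (x, y))"
    using AE_integrable_bind[OF measurable_Pair_kernel' _ *] by (simp add: integrable_distr_eq)
  show "integrable \<mu> (\<lambda>x. \<integral>y. f (x, y) \<partial>\<kappa> x)"
    using integrable_integral_bind[OF measurable_Pair_kernel' _ *] by (simp add: integral_distr)
  show "(\<integral>z. f z \<partial>semidirect \<mu> \<kappa>) = (\<integral>x. \<integral>y. f (x, y) \<partial>\<kappa> x \<partial>\<mu>)"
    using integral_bind_eq[OF measurable_Pair_kernel' _ *] by (simp add: integral_distr semidirect_def)
qed

lemma borel_measurable_kernel_nn_integral:
  assumes "(\<lambda>(x, y). f x y) \<in> borel_measurable borel"
  shows "(\<lambda>x. \<integral>\<^sup>+ y. f x y \<partial>\<kappa> x) \<in> borel_measurable borel"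
  using assms by (intro nn_integral_measurable_subprob_algebra2[where N=borel]) (auto simp: borel_prod)

lemma distr_fst_semidirect: "distr (semidirect \<mu> \<kappa>) borel fst = \<mu>"
proof (rule measure_eqI)
  fix A :: "real set" assume A: "A \<in> sets (distr (semidirect \<mu> \<kappa>) borel fst)"
  then have A [measurable]: "A \<in> sets borel" by simp
  have vi: "Pair x -` fst -` A = (if x \<in> A then UNIV else {})" for x :: real
    by auto
  have e: "emeasure (\<kappa> x) (Pair x -` fst -` A) = indicator A x" for x
    using prob_space.emeasure_space_1[OF prob_kernel[of x]] by (auto simp: vi indicator_def)
  have m: "fst -` A \<in> sets (borel :: (real \<times> real) measure)"
    using measurable_sets[OF borel_measurable_fst_borel A] by simp
  show "emeasure (distr (semidirect \<mu> \<kappa>) borel fst) A = emeasure \<mu> A"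
    by (simp add: emeasure_distr emeasure_semidirect[OF m] e)
qed (simp add: sets_mu)

lemma disintegration_semidirect: "disintegration (semidirect \<mu> \<kappa>) \<mu> \<kappa>"
  unfolding disintegration_def using kernel emeasure_semidirect by auto

end

lemma disintegrationD:
  assumes "prob_space \<mu>" "sets \<mu> = sets borel" "sets \<pi> = sets borel" "disintegration \<pi> \<mu> \<kappa>"
  shows "kernel \<mu> \<kappa>" "\<pi> = semidirect \<mu> \<kappa>"
proof -
  show k: "kernel \<mu> \<kappa>"
    using assms unfolding disintegration_def by (intro kernel.intro) blast+
  show "\<pi> = semidirect \<mu> \<kappa>"
    using assms(4) by (intro measure_eqI)
      (auto simp: assms(3) kernel.sets_semidirect[OF k] kernel.emeasure_semidirect[OF k] disintegration_def)
qed

text \<open>The convex combination with weight t on the second measure, encoded as a coin toss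
  followed by \<open>bind\<close>, so that the integration formulas come from those of
  \<open>bind\<close>.\<close>

definition mixture :: "real \<Rightarrow> real measure \<Rightarrow> real measure \<Rightarrow> real measure" where
  "mixture t M N = measure_pmf (bernoulli_pmf t) \<bind> (\<lambda>b. if b then N else M)"

context
  fixes t :: real and M N :: "real measure"
  assumes t: "0 \<le> t" "t \<le> 1"
    and M: "M \<in> space (prob_algebra borel)" and N: "N \<in> space (prob_algebra borel)"
begin

lemma mixture_kernel:
  "(\<lambda>b. if b then N else M) \<in> measure_pmf (bernoulli_pmf t) \<rightarrow>\<^sub>M prob_algebra borel"
  using M N by (auto simp: measurable_def)

lemma mixture_kernel':
  "(\<lambda>b. if b then N else M) \<in> measure_pmf (bernoulli_pmf t) \<rightarrow>\<^sub>M subprob_algebra borel"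
  by (rule measurable_prob_algebraD[OF mixture_kernel])

lemma sets_mixture: "sets (mixture t M N) = sets borel"
  unfolding mixture_def by (rule sets_bind_measurable[OF mixture_kernel']) simp

lemma nn_integral_mixture:
  assumes "f \<in> borel_measurable borel"
  shows "(\<integral>\<^sup>+ y. f y \<partial>mixture t M N) = ennreal (1 - t) * (\<integral>\<^sup>+ y. f y \<partial>M) + ennreal t * (\<integral>\<^sup>+ y. f y \<partial>N)"
  unfolding mixture_def using t
  by (subst nn_integral_bind[OF assms mixture_kernel']) (simp add: mult.commute add.commute)

lemma emeasure_mixture:
  assumes "A \<in> sets borel"
  shows "emeasure (mixture t M N) A = ennreal (1 - t) * emeasure M A + ennreal t * emeasure N A"
  using nn_integral_mixture[of "indicator A"] assms M N by (simp add: sets_mixture space_prob_algebra)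

lemma prob_space_mixture: "prob_space (mixture t M N)"
proof
  have s: "space (mixture t M N) = UNIV" "space M = UNIV" "space N = UNIV"
    using sets_eq_imp_space_eq[OF sets_mixture] sets_eq_imp_space_eq[of M borel] sets_eq_imp_space_eq[of N borel]
      M N by (auto simp: space_prob_algebra)
  have "emeasure M UNIV = 1" "emeasure N UNIV = 1"
    using M N prob_space.emeasure_space_1[of M] prob_space.emeasure_space_1[of N] s
    by (auto simp: space_prob_algebra)
  then show "emeasure (mixture t M N) (space (mixture t M N)) = 1"
    using t by (simp add: s emeasure_mixture flip: ennreal_plus)
qed

lemma
  fixes f :: "real \<Rightarrow> real"
  assumes f: "integrable M f" "integrable N f"
  shows integrable_mixture: "integrable (mixture t M N) f"
    and integral_mixture: "(\<integral>y. f y \<partial>mixture t M N) = (1 - t) * (\<integral>y. f y \<partial>M) + t * (\<integral>y. f y \<partial>N)"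
proof -
  have [measurable]: "f \<in> borel_measurable borel"
    using borel_measurable_integrable[OF f(1)] M by (simp add: space_prob_algebra cong: measurable_cong_sets)
  have "(\<integral>\<^sup>+ y. ennreal \<bar>f y\<bar> \<partial>mixture t M N) < \<infinity>"
    using f by (subst nn_integral_mixture) (auto simp: integrable_iff_bounded ennreal_mult_less_top)
  moreover have "f \<in> borel_measurable (mixture t M N)"
    by (simp cong: measurable_cong_sets add: sets_mixture)
  ultimately show i: "integrable (mixture t M N) f"
    by (simp add: integrable_iff_bounded)
  show "(\<integral>y. f y \<partial>mixture t M N) = (1 - t) * (\<integral>y. f y \<partial>M) + t * (\<integral>y. f y \<partial>N)"
    unfolding mixture_def using t
    by (subst integral_bind_eq[OF mixture_kernel' _ i[unfolded mixture_def]])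
      (auto simp: algebra_simps)
qed

end

lemma measurable_mixture:
  assumes t: "t \<in> borel_measurable L" "\<And>x. x \<in> space L \<Longrightarrow> 0 \<le> t x \<and> t x \<le> 1"
    and M [measurable]: "M \<in> L \<rightarrow>\<^sub>M prob_algebra borel" and N [measurable]: "N \<in> L \<rightarrow>\<^sub>M prob_algebra borel"
  shows "(\<lambda>x. mixture (t x) (M x) (N x)) \<in> L \<rightarrow>\<^sub>M prob_algebra borel"
proof (rule measurable_prob_algebraI)
  note [measurable] = t(1)
  note sp = measurable_space[OF M] measurable_space[OF N]
  show "prob_space (mixture (t x) (M x) (N x))" if "x \<in> space L" for x
    using that t sp by (intro prob_space_mixture) auto
  show "(\<lambda>x. mixture (t x) (M x) (N x)) \<in> L \<rightarrow>\<^sub>M subprob_algebra borel"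
  proof (rule measurable_subprob_algebra)
    fix x assume x: "x \<in> space L"
    show "subprob_space (mixture (t x) (M x) (N x))"
      using x t sp by (intro prob_space_imp_subprob_space prob_space_mixture) auto
    show "sets (mixture (t x) (M x) (N x)) = sets borel"
      using x t sp by (intro sets_mixture) auto
  next
    fix A :: "real set" assume A [measurable]: "A \<in> sets borel"
    have [measurable]: "M \<in> L \<rightarrow>\<^sub>M subprob_algebra borel" "N \<in> L \<rightarrow>\<^sub>M subprob_algebra borel"
      using M N by (auto intro: measurable_prob_algebraD)
    have "(\<lambda>x. ennreal (1 - t x) * emeasure (M x) A + ennreal (t x) * emeasure (N x) A) \<in> borel_measurable L"
      by measurable
    then show "(\<lambda>x. emeasure (mixture (t x) (M x) (N x)) A) \<in> borel_measurable L"
      by (rule measurable_cong[THEN iffD2, rotated]) (use t sp A in \<open>auto intro!: emeasure_mixture\<close>)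
  qed
qed

lemma nn_integral_lincomb:
  assumes "f \<in> borel_measurable M" "g \<in> borel_measurable M"
  shows "(\<integral>\<^sup>+ x. a * f x + b * g x \<partial>M) = a * (\<integral>\<^sup>+ x. f x \<partial>M) + b * (\<integral>\<^sup>+ x. g x \<partial>M)"
  using assms by (simp add: nn_integral_add nn_integral_cmult)

lemma ennreal_half_less_top: "inverse 2 < (top :: ennreal)"
  using ennreal_less_top[of "1/2"] by simp

lemma ennreal_half_add: "ennreal (1/2) * a + ennreal (1/2) * a = a"
proof -
  have "ennreal (1/2) + ennreal (1/2) = 1"
    by (subst ennreal_plus[symmetric]) auto
  then show ?thesis
    by (metis distrib_right mult_1)
qed

section \<open>Martingale kernels and their midpoints\<close>

definition martingale_kernels :: "real measure \<Rightarrow> real measure \<Rightarrow> (real \<Rightarrow> real measure) set" where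
  "martingale_kernels \<mu> \<nu> = {\<kappa>. kernel \<mu> \<kappa> \<and> distr (semidirect \<mu> \<kappa>) borel snd = \<nu> \<and>
     (AE x in \<mu>. integrable (\<kappa> x) (\<lambda>y. y) \<and> (\<integral>y. y \<partial>\<kappa> x) = x)}"

text \<open>The dictionary between plans and kernels: the existential over disintegrations becomes
  an image, and from here on only kernels are manipulated.\<close>

lemma martingale_plans_eq:
  assumes "prob_space \<mu>" "sets \<mu> = sets borel"
  shows "martingale_plans \<mu> \<nu> = semidirect \<mu> ` martingale_kernels \<mu> \<nu>"
proof (intro set_eqI iffI)
  fix \<pi> assume "\<pi> \<in> martingale_plans \<mu> \<nu>"
  then obtain \<kappa> where \<kappa>: "\<pi> \<in> transport_plans \<mu> \<nu>" "disintegration \<pi> \<mu> \<kappa>"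
    "AE x in \<mu>. integrable (\<kappa> x) (\<lambda>y. y) \<and> (\<integral>y. y \<partial>\<kappa> x) = x"
    by (auto simp: martingale_plans_def)
  from disintegrationD[OF assms _ \<kappa>(2)] \<kappa> have "kernel \<mu> \<kappa>" "\<pi> = semidirect \<mu> \<kappa>"
    by (auto simp: transport_plans_def)
  with \<kappa> show "\<pi> \<in> semidirect \<mu> ` martingale_kernels \<mu> \<nu>"
    by (auto simp: transport_plans_def martingale_kernels_def)
next
  fix \<pi> assume "\<pi> \<in> semidirect \<mu> ` martingale_kernels \<mu> \<nu>"
  then obtain \<kappa> where \<kappa>: "kernel \<mu> \<kappa>" "\<pi> = semidirect \<mu> \<kappa>" "distr (semidirect \<mu> \<kappa>) borel snd = \<nu>"
    "AE x in \<mu>. integrable (\<kappa> x) (\<lambda>y. y) \<and> (\<integral>y. y \<partial>\<kappa> x) = x"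
    by (auto simp: martingale_kernels_def)
  interpret kernel \<mu> \<kappa> by fact
  show "\<pi> \<in> martingale_plans \<mu> \<nu>"
    using \<kappa> distr_fst_semidirect disintegration_semidirect sets_semidirect
    by (auto simp: martingale_plans_def transport_plans_def)
qed

locale martingale_kernel = kernel \<mu> \<kappa> for \<mu> \<nu> \<kappa> +
  assumes snd_marginal: "distr (semidirect \<mu> \<kappa>) borel snd = \<nu>"
    and martingale: "AE x in \<mu>. integrable (\<kappa> x) (\<lambda>y. y) \<and> (\<integral>y. y \<partial>\<kappa> x) = x"

lemma martingale_kernels_iff: "\<kappa> \<in> martingale_kernels \<mu> \<nu> \<longleftrightarrow> martingale_kernel \<mu> \<nu> \<kappa>"
  by (auto simp: martingale_kernels_def martingale_kernel_def martingale_kernel_axioms_def)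

context martingale_kernel
begin

lemma nn_integral_snd:
  assumes [measurable]: "f \<in> borel_measurable borel"
  shows "(\<integral>\<^sup>+ z. f (snd z) \<partial>semidirect \<mu> \<kappa>) = (\<integral>\<^sup>+ y. f y \<partial>\<nu>)"
  by (subst snd_marginal[symmetric]) (simp add: nn_integral_distr)

lemma integrable_snd:
  fixes f :: "real \<Rightarrow> real"
  assumes "integrable \<nu> f"
  shows "integrable (semidirect \<mu> \<kappa>) (\<lambda>z. f (snd z))"
  using assms by (subst (asm) snd_marginal[symmetric]) (erule integrable_distr[rotated], simp)

lemma integrable_fst:
  fixes f :: "real \<Rightarrow> real"
  assumes "integrable \<mu> f"
  shows "integrable (semidirect \<mu> \<kappa>) (\<lambda>z. f (fst z))"
  using assms by (subst (asm) distr_fst_semidirect[symmetric]) (erule integrable_distr[rotated], simp)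

end

lemma distr_snd_eqI:
  assumes k: "kernel \<mu> \<kappa>" and s: "sets \<nu> = sets borel"
    and eq: "\<And>A. A \<in> sets borel \<Longrightarrow> (\<integral>\<^sup>+ x. emeasure (\<kappa> x) A \<partial>\<mu>) = emeasure \<nu> A"
  shows "distr (semidirect \<mu> \<kappa>) borel snd = \<nu>"
proof (rule measure_eqI)
  interpret kernel \<mu> \<kappa> by fact
  fix A :: "real set" assume "A \<in> sets (distr (semidirect \<mu> \<kappa>) borel snd)"
  then have A [measurable]: "A \<in> sets borel" by simp
  have m: "snd -` A \<in> sets (borel :: (real \<times> real) measure)"
    using measurable_sets[OF borel_measurable_snd_borel A] by simp
  have "Pair x -` snd -` A = A" for x :: real
    by auto
  then show "emeasure (distr (semidirect \<mu> \<kappa>) borel snd) A = emeasure \<nu> A"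
    by (simp add: emeasure_distr emeasure_semidirect[OF m] eq)
qed (simp add: s)

lemma (in martingale_kernel) nn_integral_kernel_snd:
  assumes [measurable]: "f \<in> borel_measurable borel"
  shows "(\<integral>\<^sup>+ x. \<integral>\<^sup>+ y. f y \<partial>\<kappa> x \<partial>\<mu>) = (\<integral>\<^sup>+ y. f y \<partial>\<nu>)"
  using nn_integral_semidirect[of "\<lambda>z. f (snd z)"] nn_integral_snd[OF assms] by simp

lemma (in martingale_kernel) emeasure_kernel_snd:
  assumes [measurable]: "A \<in> sets borel"
  shows "(\<integral>\<^sup>+ x. emeasure (\<kappa> x) A \<partial>\<mu>) = emeasure \<nu> A"
proof -
  have "sets \<nu> = sets borel" by (subst snd_marginal[symmetric]) simp
  then show ?thesis
    using nn_integral_kernel_snd[of "indicator A"] by simp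
qed

context
  fixes \<mu> \<nu> \<kappa>1 \<kappa>2
  assumes k1: "martingale_kernel \<mu> \<nu> \<kappa>1" and k2: "martingale_kernel \<mu> \<nu> \<kappa>2"
begin

interpretation k1: martingale_kernel \<mu> \<nu> \<kappa>1 by fact
interpretation k2: martingale_kernel \<mu> \<nu> \<kappa>2 by fact

lemma kernel_half_mixture: "kernel \<mu> (\<lambda>x. mixture (1/2) (\<kappa>1 x) (\<kappa>2 x))"
  by (intro kernel.intro k1.prob_mu k1.sets_mu measurable_mixture k1.kernel k2.kernel) auto

lemma in_prob_algebra_half: "\<kappa>1 x \<in> space (prob_algebra borel)" "\<kappa>2 x \<in> space (prob_algebra borel)"
  using measurable_space[OF k1.kernel, of x] measurable_space[OF k2.kernel, of x] by auto

text \<open>Both constraints, the second marginal and the barycentre of almost every fibre, are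
  affine in the kernel. Midpoints suffice because the parallelogram law asks for nothing
  else.\<close>

lemma martingale_kernel_half_mixture: "martingale_kernel \<mu> \<nu> (\<lambda>x. mixture (1/2) (\<kappa>1 x) (\<kappa>2 x))"
proof (intro martingale_kernel.intro martingale_kernel_axioms.intro kernel_half_mixture)
  note half = in_prob_algebra_half
  have s: "sets \<nu> = sets borel"
    by (subst k1.snd_marginal[symmetric]) simp
  show "distr (semidirect \<mu> (\<lambda>x. mixture (1/2) (\<kappa>1 x) (\<kappa>2 x))) borel snd = \<nu>"
  proof (rule distr_snd_eqI[OF kernel_half_mixture s])
    fix A :: "real set" assume A [measurable]: "A \<in> sets borel"
    have "(\<integral>\<^sup>+ x. emeasure (mixture (1/2) (\<kappa>1 x) (\<kappa>2 x)) A \<partial>\<mu>)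
        = (\<integral>\<^sup>+ x. ennreal (1/2) * emeasure (\<kappa>1 x) A + ennreal (1/2) * emeasure (\<kappa>2 x) A \<partial>\<mu>)"
      by (intro nn_integral_cong) (use half A in \<open>simp add: emeasure_mixture\<close>)
    also have "\<dots> = ennreal (1/2) * emeasure \<nu> A + ennreal (1/2) * emeasure \<nu> A"
      by (simp add: nn_integral_add nn_integral_cmult k1.emeasure_kernel_snd k2.emeasure_kernel_snd)
    also have "\<dots> = emeasure \<nu> A"
      by (rule ennreal_half_add)
    finally show "(\<integral>\<^sup>+ x. emeasure (mixture (1/2) (\<kappa>1 x) (\<kappa>2 x)) A \<partial>\<mu>) = emeasure \<nu> A" .
  qed
  show "AE x in \<mu>. integrable (mixture (1/2) (\<kappa>1 x) (\<kappa>2 x)) (\<lambda>y. y) \<and>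
      (\<integral>y. y \<partial>mixture (1/2) (\<kappa>1 x) (\<kappa>2 x)) = x"
    using k1.martingale k2.martingale
  proof eventually_elim
    case (elim x)
    then show ?case
      using integrable_mixture[of "1/2", OF _ _ half[of x], of "\<lambda>y. y"]
        integral_mixture[of "1/2", OF _ _ half[of x], of "\<lambda>y. y"]
      by (simp add: field_simps)
  qed
qed

text \<open>Integrals of a fixed function are affine in the kernel; applied to the cost, this keeps
  the midpoint of two almost optimal kernels almost optimal.\<close>

lemma
  fixes f :: "real \<times> real \<Rightarrow> real"
  assumes f1: "integrable (semidirect \<mu> \<kappa>1) f" and f2: "integrable (semidirect \<mu> \<kappa>2) f"
  shows integrable_half_mixture: "integrable (semidirect \<mu> (\<lambda>x. mixture (1/2) (\<kappa>1 x) (\<kappa>2 x))) f"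
    and integral_half_mixture: "(\<integral>z. f z \<partial>semidirect \<mu> (\<lambda>x. mixture (1/2) (\<kappa>1 x) (\<kappa>2 x))) =
      ((\<integral>z. f z \<partial>semidirect \<mu> \<kappa>1) + (\<integral>z. f z \<partial>semidirect \<mu> \<kappa>2)) / 2"
proof -
  interpret m: kernel \<mu> "\<lambda>x. mixture (1/2) (\<kappa>1 x) (\<kappa>2 x)" by (rule kernel_half_mixture)
  note half = in_prob_algebra_half
  have f [measurable]: "f \<in> borel_measurable borel"
    using borel_measurable_integrable[OF f1] by (simp cong: measurable_cong_sets)
  have f' [measurable]: "f \<in> borel_measurable (borel \<Otimes>\<^sub>M borel)"
    using f by (simp only: borel_prod)
  have fx: "(\<lambda>y. f (x, y)) \<in> borel_measurable borel" for x
    by measurable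
  have mk: "(\<lambda>x. \<integral>\<^sup>+ y. ennreal (norm (f (x, y))) \<partial>\<kappa>1 x) \<in> borel_measurable \<mu>"
    "(\<lambda>x. \<integral>\<^sup>+ y. ennreal (norm (f (x, y))) \<partial>\<kappa>2 x) \<in> borel_measurable \<mu>"
    using k1.borel_measurable_kernel_nn_integral[of "\<lambda>x y. ennreal (norm (f (x, y)))"]
      k2.borel_measurable_kernel_nn_integral[of "\<lambda>x y. ennreal (norm (f (x, y)))"] by simp_all
  have nn: "(\<integral>\<^sup>+ z. ennreal (norm (f z)) \<partial>semidirect \<mu> (\<lambda>x. mixture (1/2) (\<kappa>1 x) (\<kappa>2 x)))
     = ennreal (1/2) * (\<integral>\<^sup>+ z. ennreal (norm (f z)) \<partial>semidirect \<mu> \<kappa>1) + ennreal (1/2) * (\<integral>\<^sup>+ z. ennreal (norm (f z)) \<partial>semidirect \<mu> \<kappa>2)"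
  proof -
    have "(\<integral>\<^sup>+ z. ennreal (norm (f z)) \<partial>semidirect \<mu> (\<lambda>x. mixture (1/2) (\<kappa>1 x) (\<kappa>2 x)))
      = (\<integral>\<^sup>+ x. \<integral>\<^sup>+ y. ennreal (norm (f (x, y))) \<partial>mixture (1/2) (\<kappa>1 x) (\<kappa>2 x) \<partial>\<mu>)"
      by (intro m.nn_integral_semidirect) measurable
    also have "\<dots> = (\<integral>\<^sup>+ x. ennreal (1/2) * (\<integral>\<^sup>+ y. ennreal (norm (f (x, y))) \<partial>\<kappa>1 x) + ennreal (1/2) * (\<integral>\<^sup>+ y. ennreal (norm (f (x, y))) \<partial>\<kappa>2 x) \<partial>\<mu>)"
      using fx by (intro nn_integral_cong) (use half in \<open>simp add: nn_integral_mixture\<close>)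
    also have "\<dots> = ennreal (1/2) * (\<integral>\<^sup>+ x. \<integral>\<^sup>+ y. ennreal (norm (f (x, y))) \<partial>\<kappa>1 x \<partial>\<mu>) + ennreal (1/2) * (\<integral>\<^sup>+ x. \<integral>\<^sup>+ y. ennreal (norm (f (x, y))) \<partial>\<kappa>2 x \<partial>\<mu>)"
      by (rule nn_integral_lincomb[OF mk])
    also have "\<dots> = ennreal (1/2) * (\<integral>\<^sup>+ z. ennreal (norm (f z)) \<partial>semidirect \<mu> \<kappa>1) + ennreal (1/2) * (\<integral>\<^sup>+ z. ennreal (norm (f z)) \<partial>semidirect \<mu> \<kappa>2)"
      by (simp add: k1.nn_integral_semidirect k2.nn_integral_semidirect)
    finally show ?thesis .
  qed
  show i: "integrable (semidirect \<mu> (\<lambda>x. mixture (1/2) (\<kappa>1 x) (\<kappa>2 x))) f"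
    using f1 f2 unfolding integrable_iff_bounded nn
    by (auto simp: ennreal_mult_less_top ennreal_half_less_top cong: measurable_cong_sets)
  have "(\<integral>z. f z \<partial>semidirect \<mu> (\<lambda>x. mixture (1/2) (\<kappa>1 x) (\<kappa>2 x))) = (\<integral>x. \<integral>y. f (x, y) \<partial>mixture (1/2) (\<kappa>1 x) (\<kappa>2 x) \<partial>\<mu>)"
    by (rule m.integral_semidirect[OF i])
  also have "\<dots> = (\<integral>x. ((\<integral>y. f (x, y) \<partial>\<kappa>1 x) + (\<integral>y. f (x, y) \<partial>\<kappa>2 x)) / 2 \<partial>\<mu>)"
  proof (rule integral_cong_AE)
    show "(\<lambda>x. \<integral>y. f (x, y) \<partial>mixture (1/2) (\<kappa>1 x) (\<kappa>2 x)) \<in> borel_measurable \<mu>"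
      using m.integrable_integral_semidirect[OF i] by auto
    show "(\<lambda>x. ((\<integral>y. f (x, y) \<partial>\<kappa>1 x) + (\<integral>y. f (x, y) \<partial>\<kappa>2 x)) / 2) \<in> borel_measurable \<mu>"
      using k1.integrable_integral_semidirect[OF f1] k2.integrable_integral_semidirect[OF f2] by auto
    show "AE x in \<mu>. (\<integral>y. f (x, y) \<partial>mixture (1/2) (\<kappa>1 x) (\<kappa>2 x)) = ((\<integral>y. f (x, y) \<partial>\<kappa>1 x) + (\<integral>y. f (x, y) \<partial>\<kappa>2 x)) / 2"
      using k1.AE_integrable_semidirect[OF f1] k2.AE_integrable_semidirect[OF f2]
    proof eventually_elim
      case (elim x)
      then show ?case
        using integral_mixture[of "1/2", OF _ _ half[of x], of "\<lambda>y. f (x, y)"] by (simp add: field_simps)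
    qed
  qed
  also have "\<dots> = ((\<integral>z. f z \<partial>semidirect \<mu> \<kappa>1) + (\<integral>z. f z \<partial>semidirect \<mu> \<kappa>2)) / 2"
    by (simp add: k1.integral_semidirect[OF f1] k2.integral_semidirect[OF f2]
      k1.integrable_integral_semidirect[OF f1] k2.integrable_integral_semidirect[OF f2])
  finally show "(\<integral>z. f z \<partial>semidirect \<mu> (\<lambda>x. mixture (1/2) (\<kappa>1 x) (\<kappa>2 x))) =
      ((\<integral>z. f z \<partial>semidirect \<mu> \<kappa>1) + (\<integral>z. f z \<partial>semidirect \<mu> \<kappa>2)) / 2" .
qed

end

section \<open>Limits of kernels\<close>

definition rat_enum :: "nat \<Rightarrow> real" where
  "rat_enum n = real_of_rat (from_nat n)"

lemma rat_enum_dense: "a < b \<Longrightarrow> \<exists>i. a < rat_enum i \<and> rat_enum i < b"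
proof -
  assume "a < b"
  then obtain q where q: "a < real_of_rat q" "real_of_rat q < b"
    using of_rat_dense by blast
  then have "a < rat_enum (to_nat q) \<and> rat_enum (to_nat q) < b"
    by (simp add: rat_enum_def)
  then show ?thesis by blast
qed

lemma rat_enum_of_nat: "\<exists>i. rat_enum i = of_nat k" "\<exists>i. rat_enum i = - of_nat k"
  by (auto simp: rat_enum_def intro: exI[of _ "to_nat (rat_of_nat k)"] exI[of _ "to_nat (- rat_of_nat k)"])
    (metis from_nat_to_nat of_rat_minus of_rat_of_nat_eq)

text \<open>The right-continuous extension used in Helly's selection theorem. Only indices strictly
  to the right of t count, which gives right continuity even where the values g i jump.\<close>

definition right_limit :: "(nat \<Rightarrow> real) \<Rightarrow> real \<Rightarrow> real" where
  "right_limit g t = (INF i\<in>{i. t < rat_enum i}. g i)"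

text \<open>The assumptions \<open>small\<close> and \<open>large\<close> play the part of
  tightness: no mass escapes to infinity, so the limit is again a probability distribution.\<close>

locale cdf_limit =
  fixes M :: "nat \<Rightarrow> real measure" and g :: "nat \<Rightarrow> real"
  assumes M: "\<And>n. real_distribution (M n)"
    and lim: "\<And>i. (\<lambda>n. cdf (M n) (rat_enum i)) \<longlonglongrightarrow> g i"
    and small: "\<And>e. 0 < e \<Longrightarrow> \<exists>i. g i < e"
    and large: "\<And>e. 0 < e \<Longrightarrow> \<exists>i. 1 - e < g i"
begin

lemma cdf_mono: "s \<le> t \<Longrightarrow> cdf (M n) s \<le> cdf (M n) t"
  using M real_distribution.finite_borel_measure_M finite_borel_measure.cdf_nondecreasing by blast

lemma g_mono: "rat_enum i \<le> rat_enum j \<Longrightarrow> g i \<le> g j"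
  by (rule LIMSEQ_le[OF lim lim]) (auto intro: cdf_mono)

lemma g_nonneg: "0 \<le> g i"
  by (rule LIMSEQ_le_const[OF lim]) (auto simp: cdf_def)

lemma g_le_1: "g i \<le> 1"
  by (rule LIMSEQ_le_const2[OF lim]) (auto simp: real_distribution.cdf_bounded_prob M)

lemma bdd: "bdd_below (g ` A)"
  by (rule bdd_belowI[of _ 0]) (auto simp: g_nonneg)

lemma ne: "{i. t < rat_enum i} \<noteq> {}"
  using rat_enum_dense[of t "t + 1"] by auto

lemma right_limit_le: "t < rat_enum i \<Longrightarrow> right_limit g t \<le> g i"
  unfolding right_limit_def by (rule cINF_lower[OF bdd]) simp

lemma right_limit_less: "right_limit g t < a \<Longrightarrow> \<exists>i. t < rat_enum i \<and> g i < a"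
  unfolding right_limit_def by (subst (asm) cINF_less_iff[OF ne bdd]) auto

lemma right_limit_greatest: "(\<And>i. t < rat_enum i \<Longrightarrow> a \<le> g i) \<Longrightarrow> a \<le> right_limit g t"
  unfolding right_limit_def by (rule cINF_greatest[OF ne]) auto

lemma right_limit_ge: "rat_enum i \<le> t \<Longrightarrow> g i \<le> right_limit g t"
  by (rule right_limit_greatest) (auto intro: g_mono)

lemma right_limit_mono: "s \<le> t \<Longrightarrow> right_limit g s \<le> right_limit g t"
  by (rule right_limit_greatest) (auto intro: right_limit_le)

lemma right_limit_right_cont: "continuous (at_right a) (right_limit g)"
  unfolding continuous_within
proof (rule order_tendstoI)
  fix b assume "b < right_limit g a"
  then show "\<forall>\<^sub>F t in at_right a. b < right_limit g t"
    using right_limit_mono by (auto simp: eventually_at_right_field intro!: exI[of _ "a + 1"] intro: less_le_trans)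
next
  fix b assume "right_limit g a < b"
  then obtain i where "a < rat_enum i" "g i < b"
    using right_limit_less by blast
  then show "\<forall>\<^sub>F t in at_right a. right_limit g t < b"
    using right_limit_le by (auto simp: eventually_at_right_field intro!: exI[of _ "rat_enum i"] intro: le_less_trans)
qed

lemma right_limit_at_bot: "(right_limit g \<longlongrightarrow> 0) at_bot"
proof (rule order_tendstoI)
  fix b :: real assume "b < 0"
  moreover have "0 \<le> right_limit g t" for t
    by (rule right_limit_greatest) (rule g_nonneg)
  ultimately show "\<forall>\<^sub>F t in at_bot. b < right_limit g t"
    by (auto intro!: always_eventually intro: less_le_trans)
next
  fix b :: real assume "0 < b"
  then obtain i where "g i < b"
    using small by blast
  then show "\<forall>\<^sub>F t in at_bot. right_limit g t < b"
    using right_limit_le by (auto simp: eventually_at_bot_dense intro!: exI[of _ "rat_enum i"] intro: le_less_trans)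
qed

lemma right_limit_at_top: "(right_limit g \<longlongrightarrow> 1) at_top"
proof (rule order_tendstoI)
  fix b :: real assume "1 < b"
  moreover have "right_limit g t \<le> 1" for t
    using rat_enum_dense[of t "t + 1"] right_limit_le g_le_1 by (auto intro: order_trans)
  ultimately show "\<forall>\<^sub>F t in at_top. right_limit g t < b"
    by (auto intro!: always_eventually intro: le_less_trans)
next
  fix b :: real assume "b < 1"
  then obtain i where "b < g i"
    using large[of "1 - b"] by auto
  then show "\<forall>\<^sub>F t in at_top. b < right_limit g t"
    using right_limit_ge by (auto simp: eventually_at_top_linorder intro!: exI[of _ "rat_enum i"] intro: less_le_trans)
qed

lemma real_distribution_limit: "real_distribution (interval_measure (right_limit g))"
  by (intro real_distribution_interval_measure right_limit_mono right_limit_right_cont right_limit_at_bot right_limit_at_top)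

lemma cdf_limit: "cdf (interval_measure (right_limit g)) = right_limit g"
  by (intro cdf_interval_measure right_limit_mono right_limit_right_cont right_limit_at_bot)

text \<open>Rational points close to t on either side squeeze \<open>cdf (M n) t\<close>, since
  distribution functions are monotone and converge at the rationals.\<close>

lemma weak_conv_limit: "weak_conv_m M (interval_measure (right_limit g))"
  unfolding weak_conv_m_def weak_conv_def cdf_limit
proof (intro allI impI order_tendstoI)
  \<comment> \<open>The lower bound needs continuity from the left, since
    \<open>right_limit g t\<close> may exceed every g i with \<open>rat_enum i\<close> below t. The
    upper bound further down holds at every t.\<close>
  fix t b assume c: "isCont (right_limit g) t" and b: "b < right_limit g t"
  have "(right_limit g \<longlongrightarrow> right_limit g t) (at_left t)"
    using c by (simp add: continuous_at filterlim_at_split)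
  from order_tendstoD(1)[OF this b] obtain s where "s < t" "\<And>u. s < u \<Longrightarrow> u < t \<Longrightarrow> b < right_limit g u"
    by (auto simp: eventually_at_left_field)
  then obtain u where u: "u < t" "b < right_limit g u"
    using dense by blast
  obtain i where i: "u < rat_enum i" "rat_enum i < t"
    using rat_enum_dense[OF u(1)] by blast
  then have "b < g i"
    using right_limit_le[of u i] u by auto
  from order_tendstoD(1)[OF lim this] show "\<forall>\<^sub>F n in sequentially. b < cdf (M n) t"
    by (rule eventually_mono) (use cdf_mono[OF less_imp_le[OF i(2)]] in \<open>blast intro: less_le_trans\<close>)
next
  fix t b assume "right_limit g t < b"
  then obtain i where i: "t < rat_enum i" "g i < b"
    using right_limit_less by blast
  from order_tendstoD(2)[OF lim i(2)] show "\<forall>\<^sub>F n in sequentially. cdf (M n) t < b"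
    by (rule eventually_mono) (use cdf_mono[OF less_imp_le[OF i(1)]] in \<open>blast intro: le_less_trans\<close>)
qed

end

lemma AE_ex_less:
  fixes f :: "nat \<Rightarrow> 'a \<Rightarrow> real"
  assumes M: "finite_measure M" and [measurable]: "\<And>k. f k \<in> borel_measurable M"
    and f: "\<And>k. AE x in M. 0 \<le> f k x" "\<And>k. integrable M (f k)"
    and lim: "(\<lambda>k. \<integral>x. f k x \<partial>M) \<longlonglongrightarrow> 0"
  shows "AE x in M. \<forall>e>0. \<exists>k. f k x < e"
proof -
  interpret finite_measure M by fact
  have "AE x in M. \<exists>k. f k x < inverse (real (Suc m))" for m
  proof -
    let ?e = "inverse (real (Suc m))"
    let ?B = "{x \<in> space M. \<forall>k. ?e \<le> f k x}"
    have B [measurable]: "?B \<in> sets M" by measurable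
    have "measure M ?B \<le> (\<integral>x. f k x \<partial>M) / ?e" for k
    proof -
      have "measure M ?B \<le> measure M {x \<in> space M. ?e \<le> f k x}"
        by (intro finite_measure_mono) auto
      also have "\<dots> \<le> (\<integral>x. f k x \<partial>M) / ?e"
        by (rule integral_Markov_inequality_measure[where A="{}"]) (use f in auto)
      finally show ?thesis .
    qed
    moreover have "(\<lambda>k. (\<integral>x. f k x \<partial>M) / ?e) \<longlonglongrightarrow> 0"
      using tendsto_divide[OF lim tendsto_const, of ?e] by simp
    ultimately have "measure M ?B \<le> 0"
      using LIMSEQ_le_const by blast
    then have "measure M ?B = 0"
      by (intro antisym measure_nonneg)
    then have "?B \<in> null_sets M"
      using B by (auto simp: null_sets_def emeasure_eq_measure)
    then show ?thesis
      by (rule AE_I') (auto simp: not_less)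
  qed
  then have "AE x in M. \<forall>m. \<exists>k. f k x < inverse (real (Suc m))"
    by (subst AE_all_countable) auto
  then show ?thesis
  proof eventually_elim
    case (elim x)
    show ?case
    proof (intro allI impI)
      fix e :: real assume "0 < e"
      then obtain m where "inverse (real (Suc m)) < e"
        using reals_Archimedean by blast
      with elim show "\<exists>k. f k x < e"
        by (meson less_trans)
    qed
  qed
qed

section \<open>Almost sure weak limits of martingale kernels\<close>

lemma (in kernel) real_distribution_kernel: "real_distribution (\<kappa> x)"
  using prob_kernel sets_kernel by (auto simp: real_distribution_def real_distribution_axioms_def)

lemma (in kernel) cdf_measurable: "(\<lambda>x. cdf (\<kappa> x) t) \<in> borel_measurable borel"
  unfolding cdf_def2 by measurable

lemma (in martingale_kernel) sets_nu: "sets \<nu> = sets borel"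
  by (subst snd_marginal[symmetric]) simp

lemma (in martingale_kernel) real_distribution_nu: "real_distribution \<nu>"
proof -
  interpret prob_space "semidirect \<mu> \<kappa>" by (rule prob_semidirect)
  show ?thesis
    by (subst snd_marginal[symmetric]) (rule real_distribution_distr, simp)
qed

lemma (in martingale_kernel) integral_cdf: "(\<integral>x. cdf (\<kappa> x) t \<partial>\<mu>) = cdf \<nu> t"
  and integrable_cdf: "integrable \<mu> (\<lambda>x. cdf (\<kappa> x) t)"
proof -
  interpret nu: real_distribution \<nu> by (rule real_distribution_nu)
  interpret mu: prob_space \<mu> by (rule prob_mu)
  have e: "emeasure (\<kappa> x) {..t} = ennreal (cdf (\<kappa> x) t)" for x
    by (metis cdf_def2 finite_measure.emeasure_eq_measure prob_kernel prob_space_def)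
  have b: "0 \<le> cdf (\<kappa> x) t" "cdf (\<kappa> x) t \<le> 1" for x
    using real_distribution.cdf_bounded_prob[OF real_distribution_kernel] by (auto simp: cdf_def)
  show i: "integrable \<mu> (\<lambda>x. cdf (\<kappa> x) t)"
    using cdf_measurable b by (intro mu.integrable_const_bound[of _ 1]) auto
  have "ennreal (\<integral>x. cdf (\<kappa> x) t \<partial>\<mu>) = (\<integral>\<^sup>+x. ennreal (cdf (\<kappa> x) t) \<partial>\<mu>)"
    using b by (intro nn_integral_eq_integral[symmetric] i) auto
  also have "\<dots> = emeasure \<nu> {..t}"
    using emeasure_kernel_snd[of "{..t}"] by (simp add: e)
  also have "\<dots> = ennreal (cdf \<nu> t)"
    by (simp add: nu.emeasure_eq_measure cdf_def)
  finally show "(\<integral>x. cdf (\<kappa> x) t \<partial>\<mu>) = cdf \<nu> t"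
    using b by (subst (asm) ennreal_inj) (auto simp: cdf_def)
qed

text \<open>For x < y the function \<open>cts_step x y\<close> lies between the indicators of the
  half-lines up to x and up to y. Hence one distribution function at x is at most the other at y,
  and letting y decrease to x with right continuity yields both inequalities.\<close>

lemma real_distribution_eqI:
  assumes M: "real_distribution M" and N: "real_distribution N"
    and eq: "\<And>a b. a < b \<Longrightarrow> (\<integral>x. cts_step a b x \<partial>M) = (\<integral>x. cts_step a b x \<partial>N)"
  shows "M = N"
proof -
  have le: "cdf M x \<le> cdf N x" if "real_distribution M" "real_distribution N"
    and e: "\<And>a b. a < b \<Longrightarrow> (\<integral>x. cts_step a b x \<partial>M) = (\<integral>x. cts_step a b x \<partial>N)" for M N x
  proof -
    interpret M: real_distribution M by fact
    interpret N: real_distribution N by fact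
    have "cdf M x \<le> cdf N y" if "x < y" for y
      using M.cdf_cts_step(1)[OF that] N.cdf_cts_step(2)[OF that] e[OF that] by simp
    then have "\<forall>\<^sub>F y in at_right x. cdf M x \<le> cdf N y"
      by (auto simp: eventually_at_right_field intro!: exI[of _ "x + 1"])
    moreover have "(cdf N \<longlongrightarrow> cdf N x) (at_right x)"
      using N.cdf_is_right_cont by (simp add: continuous_within)
    ultimately show ?thesis
      by (intro tendsto_lowerbound[of "cdf N" _ "at_right x"]) auto
  qed
  have "cdf M = cdf N"
    using le[OF M N] le[OF N M] eq by (intro ext antisym) auto
  then show ?thesis
    using cdf_unique M N by blast
qed

lemma continuous_cts_step: "a < b \<Longrightarrow> isCont (cts_step a b) x"
  by (rule isUCont_isCont[OF cts_step_uniformly_continuous])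

locale kernel_limit =
  fixes \<mu> \<nu> :: "real measure" and \<kappa> :: "nat \<Rightarrow> real \<Rightarrow> real measure"
  assumes k: "\<And>n. martingale_kernel \<mu> \<nu> (\<kappa> n)"
    and conv: "AE x in \<mu>. \<forall>i. convergent (\<lambda>n. cdf (\<kappa> n x) (rat_enum i))"
    and integrable_nu: "integrable \<nu> (\<lambda>y. y)" and integrable_mu: "integrable \<mu> (\<lambda>x. x)"
begin

sublocale k: martingale_kernel \<mu> \<nu> "\<kappa> n" for n
  by (rule k)

sublocale mu: prob_space \<mu>
  by (rule k.prob_mu)

sublocale nu: real_distribution \<nu>
  by (rule k.real_distribution_nu)

text \<open>Where the sequence diverges, \<open>lim\<close> is an arbitrary number; clamping to
  [0, 1] makes the bounds hold at every x, without an exceptional set.\<close>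

definition G :: "nat \<Rightarrow> real \<Rightarrow> real" where
  "G i x = max 0 (min 1 (lim (\<lambda>n. cdf (\<kappa> n x) (rat_enum i))))"

text \<open>Convergence together with tightness of the single fibre. The thresholds are reciprocals
  of naturals so that the condition is countable and hence measurable.\<close>

definition good :: "real \<Rightarrow> bool" where
  "good x \<longleftrightarrow> (\<forall>i. convergent (\<lambda>n. cdf (\<kappa> n x) (rat_enum i))) \<and>
     (\<forall>m. \<exists>i. G i x < inverse (real (Suc m))) \<and> (\<forall>m. \<exists>i. 1 - G i x < inverse (real (Suc m)))"

text \<open>On the exceptional set any fixed probability measure would do; a Dirac mass makes the
  limit a kernel defined everywhere.\<close>

definition limit_kernel :: "real \<Rightarrow> real measure" where
  "limit_kernel x = (if good x then interval_measure (right_limit (\<lambda>i. G i x)) else return borel 0)"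

lemma G_measurable [measurable]: "G i \<in> borel_measurable borel"
proof -
  have [measurable]: "(\<lambda>x. cdf (\<kappa> n x) t) \<in> borel_measurable borel" for n t
    by (rule k.cdf_measurable)
  show ?thesis
    unfolding G_def by measurable
qed

lemma good_measurable [measurable]: "Measurable.pred borel good"
proof -
  have [measurable]: "(\<lambda>x. cdf (\<kappa> n x) t) \<in> borel_measurable borel" for n t
    by (rule k.cdf_measurable)
  show ?thesis
    unfolding good_def Cauchy_convergent_iff[symmetric] by measurable
qed

lemma cdf_kernel_le: "0 \<le> cdf (\<kappa> n x) t" "cdf (\<kappa> n x) t \<le> 1"
  using real_distribution.cdf_bounded_prob[OF k.real_distribution_kernel] by (auto simp: cdf_def)

lemma G_lim:
  assumes "convergent (\<lambda>n. cdf (\<kappa> n x) (rat_enum i))"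
  shows "(\<lambda>n. cdf (\<kappa> n x) (rat_enum i)) \<longlonglongrightarrow> G i x"
proof -
  have l: "(\<lambda>n. cdf (\<kappa> n x) (rat_enum i)) \<longlonglongrightarrow> lim (\<lambda>n. cdf (\<kappa> n x) (rat_enum i))"
    using assms by (simp add: convergent_LIMSEQ_iff)
  have "0 \<le> lim (\<lambda>n. cdf (\<kappa> n x) (rat_enum i))"
    by (rule LIMSEQ_le_const[OF l]) (auto simp: cdf_kernel_le)
  moreover have "lim (\<lambda>n. cdf (\<kappa> n x) (rat_enum i)) \<le> 1"
    by (rule LIMSEQ_le_const2[OF l]) (auto simp: cdf_kernel_le)
  ultimately show ?thesis
    using l by (simp add: G_def)
qed

lemma cdf_limit_good:
  assumes "good x"
  shows "cdf_limit (\<lambda>n. \<kappa> n x) (\<lambda>i. G i x)"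
proof (rule cdf_limit.intro)
  show "real_distribution (\<kappa> n x)" for n
    by (rule k.real_distribution_kernel)
  show "(\<lambda>n. cdf (\<kappa> n x) (rat_enum i)) \<longlonglongrightarrow> G i x" for i
    using assms by (intro G_lim) (auto simp: good_def)
  have ex: "\<exists>m. inverse (real (Suc m)) < e" if "0 < e" for e :: real
    using that reals_Archimedean by blast
  show "\<exists>i. G i x < e" if "0 < e" for e
    using ex[OF that] assms unfolding good_def by (meson less_trans)
  show "\<exists>i. 1 - e < G i x" if "0 < e" for e
  proof -
    obtain m i where "inverse (real (Suc m)) < e" "1 - G i x < inverse (real (Suc m))"
      using ex[OF \<open>0 < e\<close>] assms unfolding good_def by blast
    then show ?thesis
      by (intro exI[of _ i]) linarith
  qed
qed

lemma integral_G: "(\<integral>x. G i x \<partial>\<mu>) = cdf \<nu> (rat_enum i)"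
proof -
  have "(\<lambda>n. \<integral>x. cdf (\<kappa> n x) (rat_enum i) \<partial>\<mu>) \<longlonglongrightarrow> (\<integral>x. G i x \<partial>\<mu>)"
  proof (rule integral_dominated_convergence[where w="\<lambda>_. 1"])
    show "AE x in \<mu>. (\<lambda>n. cdf (\<kappa> n x) (rat_enum i)) \<longlonglongrightarrow> G i x"
      using conv by eventually_elim (auto intro: G_lim)
  qed (use k.integrable_cdf cdf_kernel_le in \<open>auto intro: borel_measurable_integrable simp: measurable_cong_sets[OF k.sets_mu refl]\<close>)
  then have "(\<lambda>n. cdf \<nu> (rat_enum i)) \<longlonglongrightarrow> (\<integral>x. G i x \<partial>\<mu>)"
    by (simp add: k.integral_cdf)
  then show ?thesis
    by (simp add: LIMSEQ_const_iff)
qed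

lemma G_bounds: "0 \<le> G i x" "G i x \<le> 1"
  by (auto simp: G_def)

lemma integrable_G: "integrable \<mu> (G i)"
  using G_bounds by (intro mu.integrable_const_bound[of _ 1]) (auto simp: measurable_cong_sets[OF k.sets_mu refl])

text \<open>Tightness of the fibres is inherited from \<nu>: by \<open>integral_G\<close> the
  \<mu>-average of G at -k is the distribution function of \<nu> there, which tends to 0, and the
  average of 1 - G at k tends to 0 likewise. \<open>AE_ex_less\<close> turns these averages into
  statements about almost every fibre.\<close>

lemma AE_good: "AE x in \<mu>. good x"
proof -
  obtain a b where a: "\<And>k. rat_enum (a k) = real k" and b: "\<And>k. rat_enum (b k) = - real k"
    using rat_enum_of_nat by metis
  have "AE x in \<mu>. \<forall>e>0. \<exists>k. G (b k) x < e"
    by (rule AE_ex_less) (use G_bounds integrable_G nu.cdf_lim_neg_infty mu.finite_measure_axioms in \<open>auto simp: integral_G b measurable_cong_sets[OF k.sets_mu refl]\<close>)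
  moreover have "AE x in \<mu>. \<forall>e>0. \<exists>k. 1 - G (a k) x < e"
  proof (rule AE_ex_less)
    have "(\<lambda>k. 1 - cdf \<nu> (real k)) \<longlonglongrightarrow> 1 - 1"
      by (intro tendsto_intros nu.cdf_lim_infty_prob)
    then show "(\<lambda>k. \<integral>x. 1 - G (a k) x \<partial>\<mu>) \<longlonglongrightarrow> 0"
      using integrable_G by (simp add: integral_G a mu.prob_space[simplified])
  qed (use G_bounds integrable_G mu.finite_measure_axioms in \<open>auto simp: measurable_cong_sets[OF k.sets_mu refl]\<close>)
  ultimately show ?thesis
    using conv
  proof eventually_elim
    case (elim x)
    have "0 < inverse (real (Suc m))" for m by simp
    with elim show ?case
      unfolding good_def by meson
  qed
qed

lemma limit_kernel_prob: "prob_space (limit_kernel x)" and limit_kernel_sets: "sets (limit_kernel x) = sets borel"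
  using cdf_limit.real_distribution_limit[OF cdf_limit_good, of x]
  by (auto simp: limit_kernel_def real_distribution_def real_distribution_axioms_def intro: prob_space_return)

text \<open>Half-lines form an intersection-stable generator, so only distribution functions need to
  be checked; there \<open>right_limit\<close> is an infimum of countably many measurable
  functions.\<close>

lemma limit_kernel_measurable: "limit_kernel \<in> borel \<rightarrow>\<^sub>M prob_algebra borel"
proof (rule measurable_prob_algebra_generated)
  show "sets borel = sigma_sets UNIV (range (\<lambda>t::real. {..t}))"
    by (simp add: borel_eq_atMost)
  show "Int_stable (range (\<lambda>t::real. {..t}))"
    by (auto simp: Int_stable_def)
  fix A assume "A \<in> range (\<lambda>t::real. {..t})"
  then obtain t where A: "A = {..t}" by auto
  have "emeasure (limit_kernel x) A = (if good x then ennreal (right_limit (\<lambda>i. G i x) t) else indicator A 0)" for x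
  proof (cases "good x")
    case True
    interpret cdf_limit "\<lambda>n. \<kappa> n x" "\<lambda>i. G i x"
      using True by (rule cdf_limit_good)
    show ?thesis
      using True A by (simp add: limit_kernel_def emeasure_interval_measure_Iic right_limit_mono right_limit_right_cont right_limit_at_bot)
  qed (simp add: limit_kernel_def A)
  moreover have "(\<lambda>x. if good x then ennreal (right_limit (\<lambda>i. G i x) t) else indicator A (0::real)) \<in> borel_measurable borel"
    unfolding right_limit_def by measurable
  ultimately show "(\<lambda>x. emeasure (limit_kernel x) A) \<in> borel_measurable borel"
    by simp
qed (auto simp: limit_kernel_prob limit_kernel_sets)

sublocale limit: kernel \<mu> limit_kernel
  by (intro kernel.intro k.prob_mu k.sets_mu limit_kernel_measurable)

lemma AE_weak_conv: "AE x in \<mu>. weak_conv_m (\<lambda>n. \<kappa> n x) (limit_kernel x)"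
  using AE_good
proof eventually_elim
  case (elim x)
  then show ?case
    using cdf_limit.weak_conv_limit[OF cdf_limit_good] by (simp add: limit_kernel_def)
qed

lemma AE_integral_lim:
  fixes f :: "real \<Rightarrow> real \<Rightarrow> real"
  assumes "\<And>x y. isCont (f x) y" "\<And>x y. norm (f x y) \<le> B x"
  shows "AE x in \<mu>. (\<lambda>n. \<integral>y. f x y \<partial>\<kappa> n x) \<longlonglongrightarrow> (\<integral>y. f x y \<partial>limit_kernel x)"
  using AE_weak_conv
proof eventually_elim
  case (elim x)
  show ?case
    by (rule weak_conv_imp_integral_bdd_continuous_conv[OF k.real_distribution_kernel limit.real_distribution_kernel elim, where B="B x"])
      (use assms in auto)
qed

lemma borel_measurable_integral_kernel:
  fixes f :: "real \<Rightarrow> real"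
  assumes [measurable]: "f \<in> borel_measurable borel"
  shows "(\<lambda>x. \<integral>y. f y \<partial>\<kappa> n x) \<in> borel_measurable borel" "(\<lambda>x. \<integral>y. f y \<partial>limit_kernel x) \<in> borel_measurable borel"
  by (rule measurable_compose[OF k.kernel_subprob integral_measurable_subprob_algebra[OF assms]]
    measurable_compose[OF limit.kernel_subprob integral_measurable_subprob_algebra[OF assms]])+

lemma norm_integral_kernel_le:
  fixes f :: "real \<Rightarrow> real"
  assumes "f \<in> borel_measurable borel" "\<And>y. norm (f y) \<le> B" "0 \<le> B" "real_distribution M"
  shows "\<bar>\<integral>y. f y \<partial>M\<bar> \<le> B"
proof -
  interpret real_distribution M by fact
  have "\<bar>\<integral>y. f y \<partial>M\<bar> \<le> (\<integral>y. \<bar>f y\<bar> \<partial>M)"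
    by (rule integral_abs_bound)
  also have "\<dots> \<le> B"
    using assms by (intro integral_le_const integrable_const_bound[of _ B]) auto
  finally show ?thesis .
qed

text \<open>For a bounded continuous test function, fibre integrals converge almost everywhere and
  dominated convergence applies over \<mu>; the averages along the sequence all equal the integral
  against \<nu>.\<close>

lemma snd_marginal_limit: "distr (semidirect \<mu> limit_kernel) borel snd = \<nu>"
proof (rule real_distribution_eqI)
  interpret S: prob_space "semidirect \<mu> limit_kernel" by (rule limit.prob_semidirect)
  interpret Sn: prob_space "semidirect \<mu> (\<kappa> n)" for n by (rule k.prob_semidirect)
  show "real_distribution (distr (semidirect \<mu> limit_kernel) borel snd)"
    by (rule S.real_distribution_distr) simp
  show "real_distribution \<nu>"
    by (rule nu.real_distribution_axioms)
  fix a b :: real assume ab: "a < b"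
  let ?f = "cts_step a b"
  have cont: "isCont ?f y" for y
    using ab by (rule continuous_cts_step)
  have b: "norm (?f y) \<le> 1" for y
    using ab by (auto simp: cts_step_def)
  have m [measurable]: "?f \<in> borel_measurable borel"
    using cont by (intro borel_measurable_continuous_onI) (auto simp: continuous_at_imp_continuous_on)
  have iS: "integrable (semidirect \<mu> limit_kernel) (\<lambda>z. ?f (snd z))"
    using b by (intro S.integrable_const_bound[of _ 1]) auto
  have iSn: "integrable (semidirect \<mu> (\<kappa> n)) (\<lambda>z. ?f (snd z))" for n
    using b by (intro Sn.integrable_const_bound[of _ 1]) auto
  have "(\<lambda>n. \<integral>x. \<integral>y. ?f y \<partial>\<kappa> n x \<partial>\<mu>) \<longlonglongrightarrow> (\<integral>x. \<integral>y. ?f y \<partial>limit_kernel x \<partial>\<mu>)"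
  proof (rule integral_dominated_convergence[where w="\<lambda>_. 1"])
    show "AE x in \<mu>. (\<lambda>n. \<integral>y. ?f y \<partial>\<kappa> n x) \<longlonglongrightarrow> (\<integral>y. ?f y \<partial>limit_kernel x)"
      by (rule AE_integral_lim) (use cont b in auto)
    show "AE x in \<mu>. norm (\<integral>y. ?f y \<partial>\<kappa> n x) \<le> 1" for n
      using norm_integral_kernel_le[OF m b _ k.real_distribution_kernel] by auto
  qed (use borel_measurable_integral_kernel[OF m] in \<open>auto simp: measurable_cong_sets[OF k.sets_mu refl]\<close>)
  moreover have "(\<integral>x. \<integral>y. ?f y \<partial>\<kappa> n x \<partial>\<mu>) = (\<integral>y. ?f y \<partial>\<nu>)" for n
  proof -
    have "(\<integral>y. ?f y \<partial>\<nu>) = (\<integral>z. ?f (snd z) \<partial>semidirect \<mu> (\<kappa> n))"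
      by (subst k.snd_marginal[of n, symmetric]) (simp add: integral_distr)
    then show ?thesis
      using k.integral_semidirect[OF iSn, of n] by simp
  qed
  ultimately have "(\<integral>x. \<integral>y. ?f y \<partial>limit_kernel x \<partial>\<mu>) = (\<integral>y. ?f y \<partial>\<nu>)"
    by (simp add: LIMSEQ_const_iff)
  moreover have "(\<integral>y. ?f y \<partial>distr (semidirect \<mu> limit_kernel) borel snd) = (\<integral>z. ?f (snd z) \<partial>semidirect \<mu> limit_kernel)"
    by (rule integral_distr) (simp_all add: m)
  ultimately show "(\<integral>y. ?f y \<partial>distr (semidirect \<mu> limit_kernel) borel snd) = (\<integral>y. ?f y \<partial>\<nu>)"
    using limit.integral_semidirect[OF iS] by simp
qed

end

section \<open>Barycentres of the limit by truncation\<close>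

lemma (in kernel) integral_snd:
  fixes f :: "real \<Rightarrow> real"
  assumes \<nu>: "distr (semidirect \<mu> \<kappa>) borel snd = \<nu>" and f: "integrable \<nu> f"
  shows "(\<integral>x. \<integral>y. f y \<partial>\<kappa> x \<partial>\<mu>) = (\<integral>y. f y \<partial>\<nu>)"
    and "AE x in \<mu>. integrable (\<kappa> x) f"
    and "integrable \<mu> (\<lambda>x. \<integral>y. f y \<partial>\<kappa> x)"
proof -
  have [measurable]: "f \<in> borel_measurable borel"
    using f \<nu> by (auto dest: borel_measurable_integrable)
  have i: "integrable (semidirect \<mu> \<kappa>) (\<lambda>z. f (snd z))"
    using f by (subst (asm) \<nu>[symmetric]) (erule integrable_distr[rotated], simp)
  show "(\<integral>x. \<integral>y. f y \<partial>\<kappa> x \<partial>\<mu>) = (\<integral>y. f y \<partial>\<nu>)"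
    using integral_semidirect[OF i] by (simp add: \<nu>[symmetric] integral_distr)
  show "AE x in \<mu>. integrable (\<kappa> x) f" "integrable \<mu> (\<lambda>x. \<integral>y. f y \<partial>\<kappa> x)"
    using AE_integrable_semidirect[OF i] integrable_integral_semidirect[OF i] by simp_all
qed

lemma (in kernel) integral_abs_diff_le:
  fixes f g :: "real \<Rightarrow> real"
  assumes \<nu>: "distr (semidirect \<mu> \<kappa>) borel snd = \<nu>" and f: "integrable \<nu> f" and g: "integrable \<nu> g"
  shows "(\<integral>x. \<bar>(\<integral>y. f y \<partial>\<kappa> x) - (\<integral>y. g y \<partial>\<kappa> x)\<bar> \<partial>\<mu>) \<le> (\<integral>y. \<bar>f y - g y\<bar> \<partial>\<nu>)"
proof -
  have d: "integrable \<nu> (\<lambda>y. \<bar>f y - g y\<bar>)"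
    using f g by auto
  have "(\<integral>x. \<bar>(\<integral>y. f y \<partial>\<kappa> x) - (\<integral>y. g y \<partial>\<kappa> x)\<bar> \<partial>\<mu>) \<le> (\<integral>x. \<integral>y. \<bar>f y - g y\<bar> \<partial>\<kappa> x \<partial>\<mu>)"
  proof (rule integral_mono_AE)
    show "AE x in \<mu>. \<bar>(\<integral>y. f y \<partial>\<kappa> x) - (\<integral>y. g y \<partial>\<kappa> x)\<bar> \<le> (\<integral>y. \<bar>f y - g y\<bar> \<partial>\<kappa> x)"
      using integral_snd(2)[OF \<nu> f] integral_snd(2)[OF \<nu> g]
    proof eventually_elim
      case (elim x)
      then show ?case
        using integral_abs_bound[of "\<kappa> x" "\<lambda>y. f y - g y"] by simp
    qed
  qed (use integral_snd(3)[OF \<nu> f] integral_snd(3)[OF \<nu> g] integral_snd(3)[OF \<nu> d] in auto)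
  also have "\<dots> = (\<integral>y. \<bar>f y - g y\<bar> \<partial>\<nu>)"
    by (rule integral_snd(1)[OF \<nu> d])
  finally show ?thesis .
qed

definition clamp_real :: "real \<Rightarrow> real \<Rightarrow> real" where
  "clamp_real m y = max (- m) (min m y)"

lemma clamp_real_bounds: "0 \<le> m \<Longrightarrow> \<bar>clamp_real m y\<bar> \<le> m" "0 \<le> m \<Longrightarrow> \<bar>y - clamp_real m y\<bar> \<le> \<bar>y\<bar>"
  "\<bar>y\<bar> \<le> m \<Longrightarrow> clamp_real m y = y"
  by (auto simp: clamp_real_def)

lemma clamp_real_continuous: "isCont (clamp_real m) y"
  unfolding clamp_real_def by (intro continuous_intros)

lemma clamp_real_measurable [measurable]: "clamp_real m \<in> borel_measurable borel"
  unfolding clamp_real_def by measurable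

context kernel_limit
begin

lemma integrable_clamp: "0 \<le> m \<Longrightarrow> integrable \<nu> (clamp_real m)"
  by (intro nu.integrable_const_bound[of _ m]) (auto simp: clamp_real_bounds)

lemma truncation_error_tendsto: "(\<lambda>m. \<integral>y. \<bar>y - clamp_real (real m) y\<bar> \<partial>\<nu>) \<longlonglongrightarrow> 0"
proof -
  have "(\<lambda>m. \<integral>y. \<bar>y - clamp_real (real m) y\<bar> \<partial>\<nu>) \<longlonglongrightarrow> (\<integral>y. 0 \<partial>\<nu>)"
  proof (rule integral_dominated_convergence[where w="\<lambda>y. \<bar>y\<bar>"])
    show "AE y in \<nu>. (\<lambda>m. \<bar>y - clamp_real (real m) y\<bar>) \<longlonglongrightarrow> 0"
    proof (rule AE_I2)
      fix y :: real
      obtain m0 where "\<bar>y\<bar> \<le> real m0"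
        using real_arch_simple by blast
      then have "\<forall>\<^sub>F m in sequentially. \<bar>y - clamp_real (real m) y\<bar> = 0"
        by (intro eventually_sequentiallyI[of m0]) (auto simp: clamp_real_bounds)
      then show "(\<lambda>m. \<bar>y - clamp_real (real m) y\<bar>) \<longlonglongrightarrow> 0"
        by (rule tendsto_eventually)
    qed
    show "integrable \<nu> (\<lambda>y. \<bar>y\<bar>)"
      using integrable_nu by (rule integrable_abs)
    show "AE y in \<nu>. norm \<bar>y - clamp_real (real m) y\<bar> \<le> \<bar>y\<bar>" for m
      by (rule AE_I2) (use clamp_real_bounds(2)[of "real m"] in simp)
  qed simp_all
  then show ?thesis by simp
qed

text \<open>Weak convergence says nothing about the unbounded function y, so y is truncated at m.
  Each \<open>\<kappa> n\<close> has barycentre x in almost every fibre, and averaging over \<mu>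
  bounds the truncation error by an integral against \<nu>; this bound is the same for all n and
  survives the limit.\<close>

lemma limit_clamp_error:
  assumes m: "0 \<le> m"
  shows "(\<integral>x. \<bar>(\<integral>y. clamp_real m y \<partial>limit_kernel x) - x\<bar> \<partial>\<mu>) \<le> (\<integral>y. \<bar>y - clamp_real m y\<bar> \<partial>\<nu>)"
proof (rule LIMSEQ_le_const2)
  note mc = borel_measurable_integral_kernel[OF clamp_real_measurable[of m]]
  have [measurable]: "(\<lambda>x. x) \<in> borel_measurable \<mu>"
    by (simp add: measurable_cong_sets[OF k.sets_mu refl])
  have [measurable]: "(\<lambda>x. \<integral>y. clamp_real m y \<partial>\<kappa> n x) \<in> borel_measurable \<mu>"
    "(\<lambda>x. \<integral>y. clamp_real m y \<partial>limit_kernel x) \<in> borel_measurable \<mu>" for n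
    using mc by (simp_all add: measurable_cong_sets[OF k.sets_mu refl])
  show "(\<lambda>n. \<integral>x. \<bar>(\<integral>y. clamp_real m y \<partial>\<kappa> n x) - x\<bar> \<partial>\<mu>) \<longlonglongrightarrow> (\<integral>x. \<bar>(\<integral>y. clamp_real m y \<partial>limit_kernel x) - x\<bar> \<partial>\<mu>)"
  proof (rule integral_dominated_convergence[where w="\<lambda>x. m + \<bar>x\<bar>"])
    have "AE x in \<mu>. (\<lambda>n. \<integral>y. clamp_real m y \<partial>\<kappa> n x) \<longlonglongrightarrow> (\<integral>y. clamp_real m y \<partial>limit_kernel x)"
      by (rule AE_integral_lim[where B="\<lambda>_. m"]) (use m in \<open>auto simp: clamp_real_continuous clamp_real_bounds\<close>)
    then show "AE x in \<mu>. (\<lambda>n. \<bar>(\<integral>y. clamp_real m y \<partial>\<kappa> n x) - x\<bar>) \<longlonglongrightarrow> \<bar>(\<integral>y. clamp_real m y \<partial>limit_kernel x) - x\<bar>"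
      by eventually_elim (intro tendsto_intros)
    show "AE x in \<mu>. norm \<bar>(\<integral>y. clamp_real m y \<partial>\<kappa> n x) - x\<bar> \<le> m + \<bar>x\<bar>" for n
    proof (rule AE_I2)
      fix x
      have "\<bar>\<integral>y. clamp_real m y \<partial>\<kappa> n x\<bar> \<le> m"
        by (rule norm_integral_kernel_le[OF _ _ m k.real_distribution_kernel]) (use m in \<open>auto simp: clamp_real_bounds\<close>)
      then show "norm \<bar>(\<integral>y. clamp_real m y \<partial>\<kappa> n x) - x\<bar> \<le> m + \<bar>x\<bar>"
        by simp
    qed
    show "integrable \<mu> (\<lambda>x. m + \<bar>x\<bar>)"
      using integrable_mu by (intro Bochner_Integration.integrable_add integrable_abs mu.integrable_const)
  qed measurable
  have "(\<integral>x. \<bar>(\<integral>y. clamp_real m y \<partial>\<kappa> n x) - x\<bar> \<partial>\<mu>) \<le> (\<integral>y. \<bar>y - clamp_real m y\<bar> \<partial>\<nu>)" for n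
  proof -
    have "(\<integral>x. \<bar>(\<integral>y. clamp_real m y \<partial>\<kappa> n x) - x\<bar> \<partial>\<mu>) = (\<integral>x. \<bar>(\<integral>y. y \<partial>\<kappa> n x) - (\<integral>y. clamp_real m y \<partial>\<kappa> n x)\<bar> \<partial>\<mu>)"
    proof (rule integral_cong_AE)
      show "(\<lambda>x. \<bar>(\<integral>y. y \<partial>\<kappa> n x) - (\<integral>y. clamp_real m y \<partial>\<kappa> n x)\<bar>) \<in> borel_measurable \<mu>"
        using k.integral_snd(3)[OF k.snd_marginal integrable_nu] by measurable
      show "AE x in \<mu>. \<bar>(\<integral>y. clamp_real m y \<partial>\<kappa> n x) - x\<bar> = \<bar>(\<integral>y. y \<partial>\<kappa> n x) - (\<integral>y. clamp_real m y \<partial>\<kappa> n x)\<bar>"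
        using k.martingale[of n] by eventually_elim (auto simp: abs_minus_commute)
    qed simp
    also have "\<dots> \<le> (\<integral>y. \<bar>y - clamp_real m y\<bar> \<partial>\<nu>)"
      by (rule k.integral_abs_diff_le[OF k.snd_marginal integrable_nu integrable_clamp[OF m]])
    finally show ?thesis .
  qed
  then show "\<exists>N. \<forall>n\<ge>N. (\<integral>x. \<bar>(\<integral>y. clamp_real m y \<partial>\<kappa> n x) - x\<bar> \<partial>\<mu>) \<le> (\<integral>y. \<bar>y - clamp_real m y\<bar> \<partial>\<nu>)"
    by blast
qed

text \<open>The truncation error enters twice, once when the limit fibre is truncated and once
  through \<open>limit_clamp_error\<close>. It tends to 0 with growing m because \<nu> has a finite
  first moment.\<close>

lemma martingale_limit: "AE x in \<mu>. integrable (limit_kernel x) (\<lambda>y. y) \<and> (\<integral>y. y \<partial>limit_kernel x) = x"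
proof -
  let ?e = "\<lambda>m. \<integral>y. \<bar>y - clamp_real m y\<bar> \<partial>\<nu>"
  note L = limit.integral_snd[OF snd_marginal_limit]
  have i: "integrable \<mu> (\<lambda>x. \<bar>(\<integral>y. y \<partial>limit_kernel x) - x\<bar>)"
    using L(3)[OF integrable_nu] integrable_mu by auto
  have "(\<integral>x. \<bar>(\<integral>y. y \<partial>limit_kernel x) - x\<bar> \<partial>\<mu>) \<le> 2 * ?e (real m)" for m
  proof -
    have ic: "integrable \<nu> (clamp_real (real m))"
      by (simp add: integrable_clamp)
    have ix: "integrable \<mu> (\<lambda>x. \<bar>(\<integral>y. clamp_real (real m) y \<partial>limit_kernel x) - x\<bar>)"
      "integrable \<mu> (\<lambda>x. \<bar>(\<integral>y. y \<partial>limit_kernel x) - (\<integral>y. clamp_real (real m) y \<partial>limit_kernel x)\<bar>)"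
      using L(3)[OF ic] L(3)[OF integrable_nu] integrable_mu by auto
    have "(\<integral>x. \<bar>(\<integral>y. y \<partial>limit_kernel x) - x\<bar> \<partial>\<mu>) \<le>
      (\<integral>x. \<bar>(\<integral>y. y \<partial>limit_kernel x) - (\<integral>y. clamp_real (real m) y \<partial>limit_kernel x)\<bar>
        + \<bar>(\<integral>y. clamp_real (real m) y \<partial>limit_kernel x) - x\<bar> \<partial>\<mu>)"
      using i ix by (intro integral_mono) auto
    also have "\<dots> \<le> ?e (real m) + ?e (real m)"
      using ix limit.integral_abs_diff_le[OF snd_marginal_limit integrable_nu ic] limit_clamp_error[of "real m"]
      by simp
    finally show ?thesis by simp
  qed
  moreover have "(\<lambda>m. 2 * ?e (real m)) \<longlonglongrightarrow> 2 * 0"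
    by (intro tendsto_intros truncation_error_tendsto)
  ultimately have "(\<integral>x. \<bar>(\<integral>y. y \<partial>limit_kernel x) - x\<bar> \<partial>\<mu>) \<le> 0"
    using LIMSEQ_le_const[of "\<lambda>m. 2 * ?e (real m)" 0] by simp
  then have "(\<integral>x. \<bar>(\<integral>y. y \<partial>limit_kernel x) - x\<bar> \<partial>\<mu>) = 0"
    by (intro antisym integral_nonneg) auto
  then have "AE x in \<mu>. \<bar>(\<integral>y. y \<partial>limit_kernel x) - x\<bar> = 0"
    using i by (subst (asm) integral_nonneg_eq_0_iff_AE) auto
  then show ?thesis
    using L(2)[OF integrable_nu] by eventually_elim auto
qed

lemma martingale_kernel_limit: "martingale_kernel \<mu> \<nu> limit_kernel"
  by (intro martingale_kernel.intro martingale_kernel_axioms.intro limit.kernel_axioms snd_marginal_limit martingale_limit)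

end

text \<open>Each truncation min f j is bounded and continuous, so its integrals converge under weak
  convergence; monotone convergence in j then recovers f, at the price of an inequality.\<close>

lemma nn_integral_le_liminf:
  fixes f :: "real \<Rightarrow> real"
  assumes Ms: "\<And>n. real_distribution (Ms n)" and M: "real_distribution M" and w: "weak_conv_m Ms M"
    and f: "\<And>y. isCont f y" "\<And>y. 0 \<le> f y"
  shows "(\<integral>\<^sup>+ y. ennreal (f y) \<partial>M) \<le> liminf (\<lambda>n. \<integral>\<^sup>+ y. ennreal (f y) \<partial>Ms n)"
proof -
  interpret M: real_distribution M by fact
  have m [measurable]: "f \<in> borel_measurable borel"
    using f by (intro borel_measurable_continuous_onI) (auto simp: continuous_at_imp_continuous_on)
  have sup: "(SUP j. ennreal (min (f y) (real j))) = ennreal (f y)" for y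
  proof (rule antisym)
    show "(SUP j. ennreal (min (f y) (real j))) \<le> ennreal (f y)"
      by (intro SUP_least ennreal_leI) simp
    obtain j where "f y \<le> real j"
      using real_arch_simple by blast
    then show "ennreal (f y) \<le> (SUP j. ennreal (min (f y) (real j)))"
      by (intro SUP_upper2[of j]) auto
  qed
  have "(\<integral>\<^sup>+ y. ennreal (f y) \<partial>M) = (\<integral>\<^sup>+ y. (SUP j. ennreal (min (f y) (real j))) \<partial>M)"
    by (simp add: sup)
  also have "\<dots> = (SUP j. \<integral>\<^sup>+ y. ennreal (min (f y) (real j)) \<partial>M)"
    by (intro nn_integral_monotone_convergence_SUP)
      (auto simp: incseq_def le_fun_def min_le_iff_disj intro!: ennreal_leI)
  also have "\<dots> \<le> liminf (\<lambda>n. \<integral>\<^sup>+ y. ennreal (f y) \<partial>Ms n)"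
  proof (rule SUP_least)
    fix j
    have b: "norm (min (f y) (real j)) \<le> real j" for y
      using f(2)[of y] by auto
    have e: "(\<integral>\<^sup>+ y. ennreal (min (f y) (real j)) \<partial>N) = ennreal (\<integral>y. min (f y) (real j) \<partial>N)"
      if "real_distribution N" for N
    proof -
      interpret N: real_distribution N by fact
      show ?thesis
        using b f(2) by (intro nn_integral_eq_integral N.integrable_const_bound[of _ "real j"]) auto
    qed
    have "(\<lambda>n. \<integral>y. min (f y) (real j) \<partial>Ms n) \<longlonglongrightarrow> (\<integral>y. min (f y) (real j) \<partial>M)"
      by (rule weak_conv_imp_integral_bdd_continuous_conv[OF Ms M w _ b]) (intro continuous_intros f(1))
    then have "(\<lambda>n. ennreal (\<integral>y. min (f y) (real j) \<partial>Ms n)) \<longlonglongrightarrow> ennreal (\<integral>y. min (f y) (real j) \<partial>M)"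
      by (rule tendsto_ennrealI)
    then have "(\<integral>\<^sup>+ y. ennreal (min (f y) (real j)) \<partial>M) = liminf (\<lambda>n. \<integral>\<^sup>+ y. ennreal (min (f y) (real j)) \<partial>Ms n)"
      using Ms M by (simp add: e lim_imp_Liminf)
    also have "\<dots> \<le> liminf (\<lambda>n. \<integral>\<^sup>+ y. ennreal (f y) \<partial>Ms n)"
      by (intro Liminf_mono always_eventually allI nn_integral_mono ennreal_leI) simp
    finally show "(\<integral>\<^sup>+ y. ennreal (min (f y) (real j)) \<partial>M) \<le> liminf (\<lambda>n. \<integral>\<^sup>+ y. ennreal (f y) \<partial>Ms n)" .
  qed
  finally show ?thesis .
qed

section \<open>Existence of a minimizer\<close>

lemma integral_excess_tendsto_0:
  fixes a :: "'a \<Rightarrow> real"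
  assumes a: "integrable M a"
  shows "(\<lambda>m. \<integral>x. max 0 (\<bar>a x\<bar> - real m / 2) \<partial>M) \<longlonglongrightarrow> 0"
proof -
  have "(\<lambda>m. \<integral>x. max 0 (\<bar>a x\<bar> - real m / 2) \<partial>M) \<longlonglongrightarrow> (\<integral>x. 0 \<partial>M)"
  proof (rule integral_dominated_convergence[where w="\<lambda>x. \<bar>a x\<bar>"])
    show "AE x in M. (\<lambda>m. max 0 (\<bar>a x\<bar> - real m / 2)) \<longlonglongrightarrow> 0"
    proof (rule AE_I2)
      fix x
      obtain m0 where "2 * \<bar>a x\<bar> \<le> real m0"
        using real_arch_simple by blast
      then have "\<forall>\<^sub>F m in sequentially. max 0 (\<bar>a x\<bar> - real m / 2) = 0"
        by (intro eventually_sequentiallyI[of m0]) auto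
      then show "(\<lambda>m. max 0 (\<bar>a x\<bar> - real m / 2)) \<longlonglongrightarrow> 0"
        by (rule tendsto_eventually)
    qed
    show "integrable M (\<lambda>x. \<bar>a x\<bar>)"
      using a by (rule integrable_abs)
    show "(\<lambda>x. max 0 (\<bar>a x\<bar> - real m / 2)) \<in> borel_measurable M" for m
      using a by measurable
  qed auto
  then show ?thesis by simp
qed

locale cost_bound =
  fixes \<mu> \<nu> :: "real measure" and c :: "real \<Rightarrow> real \<Rightarrow> real" and a b :: "real \<Rightarrow> real"
  assumes c_measurable: "(\<lambda>(x, y). c x y) \<in> borel_measurable borel"
    and c_continuous: "\<And>x y. isCont (c x) y"
    and integrable_a: "integrable \<mu> a" and integrable_b: "integrable \<nu> b"
    and c_ge: "\<And>x y. a x + b y \<le> c x y"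
begin

text \<open>A bound, common to all plans, on what is added by cutting the cost off at -m. Where c x
  y < -m, the amount -m - c x y is at most (|a x| - m/2) + (|b y| - m/2) since c dominates a + b;
  the two halves of m serve the two marginals.\<close>

definition excess :: "nat \<Rightarrow> real" where
  "excess m = (\<integral>x. max 0 (\<bar>a x\<bar> - real m / 2) \<partial>\<mu>) + (\<integral>y. max 0 (\<bar>b y\<bar> - real m / 2) \<partial>\<nu>)"

context
  fixes \<kappa> assumes k: "martingale_kernel \<mu> \<nu> \<kappa>"
begin

interpretation martingale_kernel \<mu> \<nu> \<kappa> by (rule k)

lemma integrable_ab: "integrable (semidirect \<mu> \<kappa>) (\<lambda>z. a (fst z) + b (snd z))"
  by (intro Bochner_Integration.integrable_add integrable_fst integrable_snd integrable_a integrable_b)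

lemma integral_fst_eq:
  fixes f :: "real \<Rightarrow> real"
  assumes "integrable \<mu> f"
  shows "(\<integral>z. f (fst z) \<partial>semidirect \<mu> \<kappa>) = (\<integral>x. f x \<partial>\<mu>)"
  using assms by (subst (2) distr_fst_semidirect[symmetric], subst (asm) distr_fst_semidirect[symmetric])
    (auto simp: integral_distr dest: borel_measurable_integrable)

lemma integral_snd_eq:
  fixes f :: "real \<Rightarrow> real"
  assumes "integrable \<nu> f"
  shows "(\<integral>z. f (snd z) \<partial>semidirect \<mu> \<kappa>) = (\<integral>y. f y \<partial>\<nu>)"
  using assms by (subst snd_marginal[symmetric], subst (asm) snd_marginal[symmetric])
    (auto simp: integral_distr dest: borel_measurable_integrable)

lemma
  assumes i: "integrable (semidirect \<mu> \<kappa>) (\<lambda>(x, y). c x y)"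
  shows integrable_max_cost: "integrable (semidirect \<mu> \<kappa>) (\<lambda>(x, y). max (c x y) (- real m))"
    and integral_max_cost_le: "(\<integral>(x, y). max (c x y) (- real m) \<partial>semidirect \<mu> \<kappa>) \<le> (\<integral>(x, y). c x y \<partial>semidirect \<mu> \<kappa>) + excess m"
    and integral_cost_le: "(\<integral>(x, y). c x y \<partial>semidirect \<mu> \<kappa>) \<le> (\<integral>(x, y). max (c x y) (- real m) \<partial>semidirect \<mu> \<kappa>)"
    and integral_cost_ge: "(\<integral>x. a x \<partial>\<mu>) + (\<integral>y. b y \<partial>\<nu>) \<le> (\<integral>(x, y). c x y \<partial>semidirect \<mu> \<kappa>)"
proof -
  interpret S: prob_space "semidirect \<mu> \<kappa>" by (rule prob_semidirect)
  interpret mu: prob_space \<mu> by (rule prob_mu)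
  interpret nu: real_distribution \<nu> by (rule real_distribution_nu)
  have ia: "integrable \<mu> (\<lambda>x. max 0 (\<bar>a x\<bar> - real m / 2))" and ib: "integrable \<nu> (\<lambda>y. max 0 (\<bar>b y\<bar> - real m / 2))"
    using integrable_a integrable_b by auto
  have i': "integrable (semidirect \<mu> \<kappa>) (\<lambda>z. c (fst z) (snd z))"
    using i by (simp add: case_prod_beta')
  have im: "integrable (semidirect \<mu> \<kappa>) (\<lambda>z. max (c (fst z) (snd z)) (- real m))"
    using i' by auto
  then show im': "integrable (semidirect \<mu> \<kappa>) (\<lambda>(x, y). max (c x y) (- real m))"
    by (simp add: case_prod_beta')
  show "(\<integral>(x, y). c x y \<partial>semidirect \<mu> \<kappa>) \<le> (\<integral>(x, y). max (c x y) (- real m) \<partial>semidirect \<mu> \<kappa>)"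
    by (rule integral_mono[OF i im']) auto
  have "(\<integral>z. a (fst z) + b (snd z) \<partial>semidirect \<mu> \<kappa>) \<le> (\<integral>(x, y). c x y \<partial>semidirect \<mu> \<kappa>)"
    by (rule integral_mono[OF integrable_ab i]) (auto simp: c_ge)
  then show "(\<integral>x. a x \<partial>\<mu>) + (\<integral>y. b y \<partial>\<nu>) \<le> (\<integral>(x, y). c x y \<partial>semidirect \<mu> \<kappa>)"
    by (simp add: integrable_fst integrable_snd integrable_a integrable_b integral_fst_eq integral_snd_eq)
  have "(\<integral>z. max (c (fst z) (snd z)) (- real m) \<partial>semidirect \<mu> \<kappa>)
     \<le> (\<integral>z. c (fst z) (snd z) + (max 0 (\<bar>a (fst z)\<bar> - real m / 2) + max 0 (\<bar>b (snd z)\<bar> - real m / 2)) \<partial>semidirect \<mu> \<kappa>)"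
  proof (rule integral_mono[OF im])
    show "integrable (semidirect \<mu> \<kappa>) (\<lambda>z. c (fst z) (snd z) + (max 0 (\<bar>a (fst z)\<bar> - real m / 2) + max 0 (\<bar>b (snd z)\<bar> - real m / 2)))"
      by (intro Bochner_Integration.integrable_add i' integrable_fst[OF ia] integrable_snd[OF ib])
    fix z
    show "max (c (fst z) (snd z)) (- real m)
      \<le> c (fst z) (snd z) + (max 0 (\<bar>a (fst z)\<bar> - real m / 2) + max 0 (\<bar>b (snd z)\<bar> - real m / 2))"
      using c_ge[of "fst z" "snd z"] by (auto simp: max_def abs_if)
  qed
  also have "\<dots> = (\<integral>z. c (fst z) (snd z) \<partial>semidirect \<mu> \<kappa>) + excess m"
    using i' integrable_fst[OF ia] integrable_snd[OF ib]
    by (simp add: excess_def integral_fst_eq[OF ia] integral_snd_eq[OF ib])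
  finally show "(\<integral>(x, y). max (c x y) (- real m) \<partial>semidirect \<mu> \<kappa>) \<le> (\<integral>(x, y). c x y \<partial>semidirect \<mu> \<kappa>) + excess m"
    by (simp add: case_prod_beta')
qed

end

lemma excess_tendsto_0: "excess \<longlonglongrightarrow> 0"
proof -
  have "(\<lambda>m. excess m) \<longlonglongrightarrow> 0 + 0"
    unfolding excess_def[abs_def] by (intro tendsto_add integral_excess_tendsto_0 integrable_a integrable_b)
  then show ?thesis by simp
qed

end

locale cost_limit = kernel_limit \<mu> \<nu> \<kappa> + cost_bound \<mu> \<nu> c a b for \<mu> \<nu> \<kappa> c a b +
  fixes J :: "nat \<Rightarrow> real" and J0 :: real
  assumes integrable_cost: "\<And>n. integrable (semidirect \<mu> (\<kappa> n)) (\<lambda>(x, y). c x y)"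
    and cost_le: "\<And>n. (\<integral>(x, y). c x y \<partial>semidirect \<mu> (\<kappa> n)) \<le> J n"
    and J_lim: "J \<longlonglongrightarrow> J0"
begin

text \<open>After the cut-off at -m and a shift by m the cost is nonnegative. The lower
  semicontinuity in each fibre and Fatou's lemma over \<mu> can then be applied in
  succession.\<close>

lemma nn_integral_limit_le:
  "(\<integral>\<^sup>+ (x, y). ennreal (max (c x y) (- real m) + real m) \<partial>semidirect \<mu> limit_kernel)
    \<le> ennreal (J0 + excess m + real m)"
proof -
  let ?f = "\<lambda>x y. ennreal (max (c x y) (- real m) + real m)"
  have cm [measurable]: "(\<lambda>z. c (fst z) (snd z)) \<in> borel_measurable borel"
    using c_measurable by (simp add: case_prod_beta')
  have mm: "(\<lambda>z. ?f (fst z) (snd z)) \<in> borel_measurable borel"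
    by measurable
  have cost: "(\<integral>\<^sup>+ z. ?f (fst z) (snd z) \<partial>semidirect \<mu> (\<kappa> n)) \<le> ennreal (J n + excess m + real m)" for n
  proof -
    interpret S: prob_space "semidirect \<mu> (\<kappa> n)" by (rule k.prob_semidirect)
    have i: "integrable (semidirect \<mu> (\<kappa> n)) (\<lambda>z. max (c (fst z) (snd z)) (- real m))"
      using integrable_max_cost[OF k integrable_cost] by (simp add: case_prod_beta')
    have "(\<integral>\<^sup>+ z. ?f (fst z) (snd z) \<partial>semidirect \<mu> (\<kappa> n)) = ennreal (\<integral>z. max (c (fst z) (snd z)) (- real m) + real m \<partial>semidirect \<mu> (\<kappa> n))"
      using i by (intro nn_integral_eq_integral) (auto simp: max_def)
    also have "\<dots> = ennreal ((\<integral>z. max (c (fst z) (snd z)) (- real m) \<partial>semidirect \<mu> (\<kappa> n)) + real m)"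
      using i by (simp add: S.prob_space[simplified])
    also have "\<dots> \<le> ennreal (J n + excess m + real m)"
      using integral_max_cost_le[OF k integrable_cost, of n m] cost_le[of n]
      by (intro ennreal_leI) (simp add: case_prod_beta')
    finally show ?thesis .
  qed
  have "(\<integral>\<^sup>+ z. ?f (fst z) (snd z) \<partial>semidirect \<mu> limit_kernel) = (\<integral>\<^sup>+ x. \<integral>\<^sup>+ y. ?f x y \<partial>limit_kernel x \<partial>\<mu>)"
    using limit.nn_integral_semidirect[OF mm] by simp
  also have "\<dots> \<le> (\<integral>\<^sup>+ x. liminf (\<lambda>n. \<integral>\<^sup>+ y. ?f x y \<partial>\<kappa> n x) \<partial>\<mu>)"
  proof (rule nn_integral_mono_AE)
    show "AE x in \<mu>. (\<integral>\<^sup>+ y. ?f x y \<partial>limit_kernel x) \<le> liminf (\<lambda>n. \<integral>\<^sup>+ y. ?f x y \<partial>\<kappa> n x)"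
      using AE_weak_conv
    proof eventually_elim
      case (elim x)
      then show ?case
        by (intro nn_integral_le_liminf k.real_distribution_kernel limit.real_distribution_kernel continuous_intros c_continuous)
           auto
    qed
  qed
  also have "\<dots> \<le> liminf (\<lambda>n. \<integral>\<^sup>+ x. \<integral>\<^sup>+ y. ?f x y \<partial>\<kappa> n x \<partial>\<mu>)"
  proof (rule nn_integral_liminf)
    have "(\<lambda>(x, y). ?f x y) \<in> borel_measurable borel"
      using mm by (simp add: case_prod_beta')
    then show "(\<lambda>x. \<integral>\<^sup>+ y. ?f x y \<partial>\<kappa> n x) \<in> borel_measurable \<mu>" for n
      using k.borel_measurable_kernel_nn_integral by (simp add: measurable_cong_sets[OF k.sets_mu refl])
  qed
  also have "\<dots> = liminf (\<lambda>n. \<integral>\<^sup>+ z. ?f (fst z) (snd z) \<partial>semidirect \<mu> (\<kappa> n))"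
    using k.nn_integral_semidirect[OF mm] by simp
  also have "\<dots> \<le> liminf (\<lambda>n. ennreal (J n + excess m + real m))"
    by (intro Liminf_mono always_eventually allI cost)
  also have "\<dots> = ennreal (J0 + excess m + real m)"
    by (intro lim_imp_Liminf tendsto_ennrealI tendsto_intros J_lim) simp
  finally show ?thesis
    by (simp add: case_prod_beta')
qed

lemma integrable_cost_limit: "integrable (semidirect \<mu> limit_kernel) (\<lambda>(x, y). c x y)"
  and integral_cost_limit_le: "(\<integral>(x, y). c x y \<partial>semidirect \<mu> limit_kernel) \<le> J0"
proof -
  interpret S: prob_space "semidirect \<mu> limit_kernel" by (rule limit.prob_semidirect)
  have cm [measurable]: "(\<lambda>z. c (fst z) (snd z)) \<in> borel_measurable borel"
    using c_measurable by (simp add: case_prod_beta')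
  have ip: "integrable (semidirect \<mu> limit_kernel) (\<lambda>z. max (c (fst z) (snd z)) (- real m) + real m)" for m
  proof (rule integrableI_nonneg)
    show "(\<integral>\<^sup>+ z. ennreal (max (c (fst z) (snd z)) (- real m) + real m) \<partial>semidirect \<mu> limit_kernel) < \<infinity>"
      using nn_integral_limit_le[of m] by (simp add: case_prod_beta' le_less_trans[OF _ ennreal_less_top])
  qed (auto simp: max_def)
  \<comment> \<open>The case m = 0 controls the positive part of c, and the lower bound a + b
    controls the negative part.\<close>
  have ic: "integrable (semidirect \<mu> limit_kernel) (\<lambda>z. c (fst z) (snd z))"
  proof (rule Bochner_Integration.integrable_bound)
    show "integrable (semidirect \<mu> limit_kernel) (\<lambda>z. (max (c (fst z) (snd z)) (- real 0) + real 0) + \<bar>a (fst z) + b (snd z)\<bar>)"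
      by (intro Bochner_Integration.integrable_add[OF ip integrable_abs[OF integrable_ab[OF martingale_kernel_limit]]])
    show "AE z in semidirect \<mu> limit_kernel. norm (c (fst z) (snd z)) \<le> norm ((max (c (fst z) (snd z)) (- real 0) + real 0) + \<bar>a (fst z) + b (snd z)\<bar>)"
    proof (rule AE_I2)
      fix z :: "real \<times> real"
      show "norm (c (fst z) (snd z)) \<le> norm ((max (c (fst z) (snd z)) (- real 0) + real 0) + \<bar>a (fst z) + b (snd z)\<bar>)"
        using c_ge[of "fst z" "snd z"] by (auto simp: max_def abs_if)
    qed
  qed simp
  then show ic': "integrable (semidirect \<mu> limit_kernel) (\<lambda>(x, y). c x y)"
    by (simp add: case_prod_beta')
  have le: "(\<integral>(x, y). c x y \<partial>semidirect \<mu> limit_kernel) \<le> J0 + excess m" for m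
  proof -
    let ?I = "\<integral>z. max (c (fst z) (snd z)) (- real m) \<partial>semidirect \<mu> limit_kernel"
    have im: "integrable (semidirect \<mu> limit_kernel) (\<lambda>z. max (c (fst z) (snd z)) (- real m))"
      using ic by auto
    have nn: "0 \<le> ?I + real m"
    proof -
      have "0 \<le> (\<integral>z. max (c (fst z) (snd z)) (- real m) + real m \<partial>semidirect \<mu> limit_kernel)"
        by (intro Bochner_Integration.integral_nonneg) (auto simp: max_def)
      then show ?thesis
        using im by (simp add: S.prob_space[simplified])
    qed
    \<comment> \<open>\<open>ennreal\<close> sends negative reals to 0, so the inequality between
      \<open>ennreal\<close> values returns to the reals only if its right-hand side is
      nonnegative.\<close>
    have ex: "0 \<le> J0 + excess m + real m"
    proof (rule LIMSEQ_le_const)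
      show "(\<lambda>n. J n + excess m + real m) \<longlonglongrightarrow> J0 + excess m + real m"
        by (intro tendsto_intros J_lim)
      have "0 \<le> J n + excess m + real m" for n
      proof -
        interpret Sn: prob_space "semidirect \<mu> (\<kappa> n)" by (rule k.prob_semidirect)
        have "- real m \<le> (\<integral>(x, y). max (c x y) (- real m) \<partial>semidirect \<mu> (\<kappa> n))"
          by (rule Sn.integral_ge_const[OF integrable_max_cost[OF k integrable_cost]]) auto
        then show ?thesis
          using integral_max_cost_le[OF k integrable_cost, of n m] cost_le[of n] by simp
      qed
      then show "\<exists>N. \<forall>n\<ge>N. 0 \<le> J n + excess m + real m" by blast
    qed
    have "ennreal (?I + real m) = (\<integral>\<^sup>+ z. ennreal (max (c (fst z) (snd z)) (- real m) + real m) \<partial>semidirect \<mu> limit_kernel)"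
      using im by (subst nn_integral_eq_integral[OF ip]) (auto simp: max_def S.prob_space[simplified])
    also have "\<dots> \<le> ennreal (J0 + excess m + real m)"
      using nn_integral_limit_le[of m] by (simp add: case_prod_beta')
    finally have "?I + real m \<le> J0 + excess m + real m"
      using ex by (simp add: ennreal_le_iff)
    then show ?thesis
      using integral_cost_le[OF martingale_kernel_limit ic', of m] by (simp add: case_prod_beta')
  qed
  have "(\<lambda>m. J0 + excess m) \<longlonglongrightarrow> J0 + 0"
    by (intro tendsto_intros excess_tendsto_0)
  then show "(\<integral>(x, y). c x y \<partial>semidirect \<mu> limit_kernel) \<le> J0"
    using LIMSEQ_le_const[of "\<lambda>m. J0 + excess m" "J0 + 0"] le by auto
qed

end

text \<open>
  The parallelogram law makes almost-minimizing sequences of a quadratic functional on convex sets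
  Cauchy, so that strong limits replace a weak compactness theorem.
\<close>

lemma parallelogram_Cauchy_selection:
  fixes S :: "nat \<Rightarrow> 'k set" and N :: "'k \<Rightarrow> real" and d :: "'k \<Rightarrow> 'k \<Rightarrow> real" and mid :: "'k \<Rightarrow> 'k \<Rightarrow> 'k"
  assumes ne: "\<And>n. S n \<noteq> {}" and dec: "\<And>n. S (Suc n) \<subseteq> S n"
    and mid: "\<And>n p q. p \<in> S n \<Longrightarrow> q \<in> S n \<Longrightarrow> mid p q \<in> S n"
    and N: "\<And>p. p \<in> S 0 \<Longrightarrow> 0 \<le> N p" "\<And>p. p \<in> S 0 \<Longrightarrow> N p \<le> 1"
    and par: "\<And>p q. p \<in> S 0 \<Longrightarrow> q \<in> S 0 \<Longrightarrow> d p q = 2 * N p + 2 * N q - 4 * N (mid p q)"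
  obtains p where "\<And>n. p n \<in> S n" "\<And>e. 0 < e \<Longrightarrow> \<exists>n0. \<forall>m\<ge>n0. \<forall>n\<ge>n0. d (p m) (p n) < e"
proof -
  have antimono: "S n \<subseteq> S m" if "m \<le> n" for m n
    using dec that by (rule lift_Suc_antimono_le)
  have sub0: "S n \<subseteq> S 0" for n
    by (rule antimono) simp
  \<comment> \<open>The sets shrink, so these infima increase; their limit L is then approached by
    \<open>N (p n)\<close>, which lies between v n and v n + 1/(n + 1).\<close>
  define v where "v n = Inf (N ` S n)" for n
  have bdd: "bdd_below (N ` S n)" for n
    using N(1) sub0 by (intro bdd_belowI[of _ 0]) auto
  have v_le: "v n \<le> N p" if "p \<in> S n" for n p
    unfolding v_def using that by (intro cInf_lower bdd) auto
  have v_mono: "v m \<le> v n" if "m \<le> n" for m n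
    unfolding v_def using ne antimono[OF that] by (intro cInf_superset_mono bdd) auto
  have v_1: "v n \<le> 1" for n
    using ne[of n] v_le N(2) sub0 by (metis all_not_in_conv order_trans subsetD)
  obtain L where L: "v \<longlonglongrightarrow> L" "\<And>n. v n \<le> L"
    using v_mono v_1 by (metis incseq_convergent incseq_def)
  have "\<exists>p. p \<in> S n \<and> N p < v n + inverse (real (Suc n))" for n
  proof -
    have "Inf (N ` S n) < v n + inverse (real (Suc n))"
      by (simp add: v_def)
    then show ?thesis
      using ne bdd by (subst (asm) cInf_less_iff) auto
  qed
  then obtain p where p: "\<And>n. p n \<in> S n" "\<And>n. N (p n) < v n + inverse (real (Suc n))"
    by metis
  have "\<exists>n0. \<forall>m\<ge>n0. \<forall>n\<ge>n0. d (p m) (p n) < e" if e: "0 < e" for e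
  proof -
    have "\<forall>\<^sub>F k in sequentially. L - e / 8 < v k"
      using order_tendstoD(1)[OF L(1), of "L - e / 8"] e by simp
    moreover have "\<forall>\<^sub>F k in sequentially. inverse (real (Suc k)) < e / 8"
      using order_tendstoD(2)[OF LIMSEQ_inverse_real_of_nat, of "e / 8"] e by simp
    ultimately have "\<forall>\<^sub>F k in sequentially. L - e / 8 < v k \<and> inverse (real (Suc k)) < e / 8"
      by eventually_elim simp
    then obtain n0 where n0: "L - e / 8 < v n0" "inverse (real (Suc n0)) < e / 8"
      using eventually_happens sequentially_bot by blast
    have "d (p m) (p n) < e" if "n0 \<le> m" "n0 \<le> n" for m n
    proof -
      have inS: "p m \<in> S n0" "p n \<in> S n0"
        using p(1) antimono that by blast+
      have "v n0 \<le> N (mid (p m) (p n))"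
        by (intro v_le mid inS)
      have "N (p j) < L + e / 8" if "n0 \<le> j" for j
      proof -
        have "inverse (real (Suc j)) \<le> inverse (real (Suc n0))"
          using that by (simp add: field_simps)
        then show ?thesis
          using p(2)[of j] L(2)[of j] n0(2) by linarith
      qed
      then have "N (p m) < L + e / 8" "N (p n) < L + e / 8"
        using that by auto
      moreover have "d (p m) (p n) = 2 * N (p m) + 2 * N (p n) - 4 * N (mid (p m) (p n))"
        using inS sub0 by (intro par) auto
      ultimately show ?thesis
        using n0(1) \<open>v n0 \<le> N (mid (p m) (p n))\<close> by linarith
    qed
    then show ?thesis by blast
  qed
  with p(1) show thesis
    by (rule that)
qed

section \<open>Kernels as points of an L2 space\<close>

locale transport_problem = cost_bound \<mu> \<nu> c a b for \<mu> \<nu> c a b +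
  assumes prob_mu: "prob_space \<mu>" and sets_mu: "sets \<mu> = sets borel"
    and integrable_mu: "integrable \<mu> (\<lambda>x. x)" and integrable_nu: "integrable \<nu> (\<lambda>y. y)"
begin

text \<open>The geometric law is a probability measure charging every index. Almost everywhere on
  the product therefore means for almost every x and all i at once, and bounded profiles are square
  integrable.\<close>

definition index_measure :: "(real \<times> nat) measure" where
  "index_measure = \<mu> \<Otimes>\<^sub>M measure_pmf (geometric_pmf (1/2))"

text \<open>An embedding of kernels into L2 of \<open>index_measure\<close> that maps midpoints to
  midpoints, since distribution functions are affine in the measure.\<close>

definition profile :: "(real \<Rightarrow> real measure) \<Rightarrow> real \<times> nat \<Rightarrow> real" where
  "profile \<kappa> = (\<lambda>(x, i). cdf (\<kappa> x) (rat_enum i))"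

lemma prob_index_measure: "prob_space index_measure"
  unfolding index_measure_def by (intro prob_space_pair prob_mu prob_space_measure_pmf)

lemma AE_index_measure:
  assumes "AE z in index_measure. P z"
  shows "AE x in \<mu>. \<forall>i. P (x, i)"
proof -
  interpret mu: prob_space \<mu> by (rule prob_mu)
  interpret pair_sigma_finite \<mu> "measure_pmf (geometric_pmf (1/2))" ..
  have "AE x in \<mu>. AE i in geometric_pmf (1/2). P (x, i)"
    using assms unfolding index_measure_def by (rule AE_pair)
  then show ?thesis
    by (simp add: AE_measure_pmf_iff set_pmf_geometric)
qed

context
  fixes \<kappa> assumes k: "kernel \<mu> \<kappa>"
begin

interpretation kernel \<mu> \<kappa> by (rule k)

lemma profile_measurable: "profile \<kappa> \<in> borel_measurable index_measure"
proof -
  have "(\<lambda>z. (\<lambda>i z. cdf (\<kappa> (fst z)) (rat_enum i)) (snd z) z) \<in> borel_measurable index_measure"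
  proof (rule measurable_compose_countable)
    fix i
    have "fst \<in> measurable index_measure \<mu>"
      unfolding index_measure_def by simp
    moreover have "(\<lambda>x. cdf (\<kappa> x) (rat_enum i)) \<in> borel_measurable \<mu>"
      using cdf_measurable by (simp add: measurable_cong_sets[OF sets_mu refl])
    ultimately show "(\<lambda>z. cdf (\<kappa> (fst z)) (rat_enum i)) \<in> borel_measurable index_measure"
      by (rule measurable_compose)
  next
    show "snd \<in> measurable index_measure (count_space UNIV)"
      unfolding index_measure_def by simp
  qed
  then show ?thesis
    by (simp add: profile_def case_prod_beta')
qed

lemma profile_bounds: "0 \<le> profile \<kappa> z" "profile \<kappa> z \<le> 1"
  using real_distribution.cdf_bounded_prob[OF real_distribution_kernel]
  by (auto simp: profile_def cdf_def split: prod.split)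

lemma integrable_profile: "integrable index_measure (profile \<kappa>)"
proof -
  interpret prob_space index_measure by (rule prob_index_measure)
  show ?thesis
    using profile_bounds by (intro integrable_const_bound[of _ 1] profile_measurable) auto
qed

end

lemma integrable_profile_mult:
  assumes "kernel \<mu> \<kappa>" "kernel \<mu> \<kappa>'"
  shows "integrable index_measure (\<lambda>z. profile \<kappa> z * profile \<kappa>' z)"
proof -
  interpret prob_space index_measure by (rule prob_index_measure)
  note [measurable] = profile_measurable[OF assms(1)] profile_measurable[OF assms(2)]
  show ?thesis
    using profile_bounds[OF assms(1)] profile_bounds[OF assms(2)]
    by (intro integrable_const_bound[of _ 1]) (auto intro!: mult_le_one)
qed

lemma exists_minimizer:
  assumes ne: "\<exists>\<kappa>\<in>martingale_kernels \<mu> \<nu>. integrable (semidirect \<mu> \<kappa>) (\<lambda>(x, y). c x y)"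
  obtains \<kappa> where "\<kappa> \<in> martingale_kernels \<mu> \<nu>" "integrable (semidirect \<mu> \<kappa>) (\<lambda>(x, y). c x y)"
    "\<And>\<kappa>'. \<kappa>' \<in> martingale_kernels \<mu> \<nu> \<Longrightarrow> integrable (semidirect \<mu> \<kappa>') (\<lambda>(x, y). c x y) \<Longrightarrow>
      (\<integral>(x, y). c x y \<partial>semidirect \<mu> \<kappa>) \<le> (\<integral>(x, y). c x y \<partial>semidirect \<mu> \<kappa>')"
proof -
  interpret I: prob_space index_measure by (rule prob_index_measure)
  define cost where "cost \<kappa> = (\<integral>(x, y). c x y \<partial>semidirect \<mu> \<kappa>)" for \<kappa>
  define K where "K = {\<kappa>. martingale_kernel \<mu> \<nu> \<kappa> \<and> integrable (semidirect \<mu> \<kappa>) (\<lambda>(x, y). c x y)}"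
  define J where "J = Inf (cost ` K)"
  \<comment> \<open>Nested nonempty sets of almost optimal kernels. They are closed under
    \<open>mid\<close> because the cost is affine.\<close>
  define S where "S n = {\<kappa> \<in> K. cost \<kappa> \<le> J + inverse (real (Suc n))}" for n
  define mid where "mid \<kappa> \<kappa>' = (\<lambda>x. mixture (1/2) (\<kappa> x) (\<kappa>' x))" for \<kappa> \<kappa>' :: "real \<Rightarrow> real measure"
  \<comment> \<open>N is the squared L2 norm of the profile and d the squared L2 distance, so the
    identity asked for below is the parallelogram law.\<close>
  define N where "N \<kappa> = (\<integral>z. profile \<kappa> z * profile \<kappa> z \<partial>index_measure)" for \<kappa>
  define d where "d \<kappa> \<kappa>' = (\<integral>z. (profile \<kappa> z - profile \<kappa>' z)\<^sup>2 \<partial>index_measure)" for \<kappa> \<kappa>'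
  have kern: "kernel \<mu> \<kappa>" if "\<kappa> \<in> K" for \<kappa>
    using that by (simp add: K_def martingale_kernel_def)
  have bdd: "bdd_below (cost ` K)"
    using integral_cost_ge by (intro bdd_belowI[of _ "(\<integral>x. a x \<partial>\<mu>) + (\<integral>y. b y \<partial>\<nu>)"]) (auto simp: K_def cost_def)
  have Kne: "K \<noteq> {}"
    using ne by (auto simp: K_def martingale_kernels_iff)
  have J_le: "J \<le> cost \<kappa>" if "\<kappa> \<in> K" for \<kappa>
    unfolding J_def using that by (intro cInf_lower bdd) auto
  obtain p where p: "\<And>n. p n \<in> S n" "\<And>e. 0 < e \<Longrightarrow> \<exists>n0. \<forall>m\<ge>n0. \<forall>n\<ge>n0. d (p m) (p n) < e"
  proof (rule parallelogram_Cauchy_selection[of S mid N d])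
    show "S n \<noteq> {}" for n
    proof -
      have "Inf (cost ` K) < J + inverse (real (Suc n))"
        by (simp add: J_def)
      then obtain \<kappa> where "\<kappa> \<in> K" "cost \<kappa> < J + inverse (real (Suc n))"
        using Kne bdd by (subst (asm) cInf_less_iff) auto
      then show ?thesis
        by (auto simp: S_def)
    qed
    show "S (Suc n) \<subseteq> S n" for n
    proof -
      have "inverse (real (Suc (Suc n))) \<le> inverse (real (Suc n))"
        by (simp add: field_simps)
      then have "J + inverse (real (Suc (Suc n))) \<le> J + inverse (real (Suc n))"
        by (rule add_left_mono)
      then show ?thesis
        unfolding S_def using order_trans by blast
    qed
    show "mid \<kappa> \<kappa>' \<in> S n" if "\<kappa> \<in> S n" "\<kappa>' \<in> S n" for n \<kappa> \<kappa>'
    proof -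
      have *: "martingale_kernel \<mu> \<nu> \<kappa>" "martingale_kernel \<mu> \<nu> \<kappa>'"
        "integrable (semidirect \<mu> \<kappa>) (\<lambda>(x, y). c x y)" "integrable (semidirect \<mu> \<kappa>') (\<lambda>(x, y). c x y)"
        using that by (auto simp: S_def K_def)
      have "cost (mid \<kappa> \<kappa>') = (cost \<kappa> + cost \<kappa>') / 2"
        unfolding cost_def mid_def by (rule integral_half_mixture[OF *])
      then show ?thesis
        using that martingale_kernel_half_mixture[OF *(1,2)] integrable_half_mixture[OF *]
        by (auto simp: S_def K_def mid_def)
    qed
    have mult_le: "profile \<kappa> z * profile \<kappa> z \<le> 1" if "\<kappa> \<in> S 0" for \<kappa> z
      using profile_bounds[OF kern, of \<kappa> z] that by (auto simp: S_def intro: mult_le_one)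
    show "0 \<le> N \<kappa>" "N \<kappa> \<le> 1" if "\<kappa> \<in> S 0" for \<kappa>
      using that kern integrable_profile_mult mult_le[OF that]
      by (auto simp: N_def S_def intro!: I.integral_le_const Bochner_Integration.integral_nonneg)
    show "d \<kappa> \<kappa>' = 2 * N \<kappa> + 2 * N \<kappa>' - 4 * N (mid \<kappa> \<kappa>')" if "\<kappa> \<in> S 0" "\<kappa>' \<in> S 0" for \<kappa> \<kappa>'
    proof -
      have kk: "kernel \<mu> \<kappa>" "kernel \<mu> \<kappa>'" and mk: "martingale_kernel \<mu> \<nu> \<kappa>" "martingale_kernel \<mu> \<nu> \<kappa>'"
        using that by (auto simp: S_def K_def martingale_kernel_def)
      have pm: "profile (mid \<kappa> \<kappa>') z = (profile \<kappa> z + profile \<kappa>' z) / 2" for z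
      proof (cases z)
        case (Pair x i)
        note half = in_prob_algebra_half[OF mk, of x]
        interpret M: prob_space "\<kappa> x" by (rule kernel.prob_kernel[OF kk(1)])
        interpret M': prob_space "\<kappa>' x" by (rule kernel.prob_kernel[OF kk(2)])
        interpret m: prob_space "mixture (1/2) (\<kappa> x) (\<kappa>' x)"
          by (rule prob_space_mixture[OF _ _ half]) auto
        let ?A = "{..rat_enum i}"
        have "ennreal (m.prob ?A) = ennreal (1 - 1/2) * ennreal (M.prob ?A) + ennreal (1/2) * ennreal (M'.prob ?A)"
          using emeasure_mixture[OF _ _ half, of "1/2" ?A]
          by (simp only: m.emeasure_eq_measure M.emeasure_eq_measure M'.emeasure_eq_measure) simp
        also have "\<dots> = ennreal ((M.prob ?A + M'.prob ?A) / 2)"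
          by (simp only: ennreal_mult[symmetric] ennreal_plus[symmetric] measure_nonneg mult_nonneg_nonneg) (simp add: field_simps)
        finally have "m.prob ?A = (M.prob ?A + M'.prob ?A) / 2"
          by (subst (asm) ennreal_inj) auto
        then show ?thesis
          by (simp add: Pair profile_def mid_def cdf_def)
      qed
      note i = integrable_profile_mult[OF kk(1) kk(1)] integrable_profile_mult[OF kk(2) kk(2)] integrable_profile_mult[OF kk]
      have "N (mid \<kappa> \<kappa>') = (\<integral>z. (profile \<kappa> z * profile \<kappa> z + profile \<kappa>' z * profile \<kappa>' z + 2 * (profile \<kappa> z * profile \<kappa>' z)) / 4 \<partial>index_measure)"
        unfolding N_def by (intro Bochner_Integration.integral_cong) (auto simp: pm field_simps)
      also have "\<dots> = (N \<kappa> + N \<kappa>' + 2 * (\<integral>z. profile \<kappa> z * profile \<kappa>' z \<partial>index_measure)) / 4"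
        using i by (simp add: N_def)
      finally have 1: "N (mid \<kappa> \<kappa>') = (N \<kappa> + N \<kappa>' + 2 * (\<integral>z. profile \<kappa> z * profile \<kappa>' z \<partial>index_measure)) / 4" .
      have "d \<kappa> \<kappa>' = (\<integral>z. profile \<kappa> z * profile \<kappa> z + profile \<kappa>' z * profile \<kappa>' z - 2 * (profile \<kappa> z * profile \<kappa>' z) \<partial>index_measure)"
        unfolding d_def by (intro Bochner_Integration.integral_cong) (auto simp: power2_eq_square algebra_simps)
      also have "\<dots> = N \<kappa> + N \<kappa>' - 2 * (\<integral>z. profile \<kappa> z * profile \<kappa>' z \<partial>index_measure)"
        using i by (simp add: N_def)
      finally show ?thesis
        using 1 by simp
    qed
    fix p assume "\<And>n. p n \<in> S n" "\<And>e. 0 < e \<Longrightarrow> \<exists>n0. \<forall>m\<ge>n0. \<forall>n\<ge>n0. d (p m) (p n) < e"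
    then show thesis by (rule that)
  qed
  have pK: "p n \<in> K" for n
    using p(1)[of n] by (simp add: S_def)
  have mk: "martingale_kernel \<mu> \<nu> (p n)" and ic: "integrable (semidirect \<mu> (p n)) (\<lambda>(x, y). c x y)" for n
    using pK[of n] by (auto simp: K_def)
  \<comment> \<open>A sequence that is Cauchy in L1 has a subsequence that is Cauchy almost
    everywhere; this is the almost sure convergence of fibres at all rationals.\<close>
  obtain r where r: "strict_mono r" "AE z in index_measure. Cauchy (\<lambda>n. profile (p (r n)) z)"
  proof (rule cauchy_L1_AE_cauchy_subseq[of index_measure "\<lambda>n. profile (p n)"])
    show "integrable index_measure (profile (p n))" for n
      by (rule integrable_profile[OF kern[OF pK]])
    fix e :: real assume e: "0 < e"
    obtain n0 where n0: "\<And>m n. n0 \<le> m \<Longrightarrow> n0 \<le> n \<Longrightarrow> d (p m) (p n) < (e / 2)\<^sup>2"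
      using p(2)[of "(e / 2)\<^sup>2"] e by auto
    have "(\<integral>z. norm (profile (p m) z - profile (p n) z) \<partial>index_measure) < e" if "n0 \<le> m" "n0 \<le> n" for m n
    proof -
      note i = integrable_profile_mult[OF kern kern, OF pK pK]
      have i2: "integrable index_measure (\<lambda>z. (profile (p m) z - profile (p n) z)\<^sup>2)"
      proof -
        have "(\<lambda>z. (profile (p m) z - profile (p n) z)\<^sup>2) =
            (\<lambda>z. profile (p m) z * profile (p m) z + profile (p n) z * profile (p n) z - 2 * (profile (p m) z * profile (p n) z))"
          by (auto simp: power2_eq_square algebra_simps)
        then show ?thesis
          using i by simp
      qed
      have i1: "integrable index_measure (\<lambda>z. profile (p m) z - profile (p n) z)"
        by (intro Bochner_Integration.integrable_diff integrable_profile kern pK)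
      \<comment> \<open>\<open>\<bar>u\<bar> \<le> e/4 + u\<^sup>2/e\<close> instead of Cauchy-Schwarz\<close>
      have "(\<integral>z. norm (profile (p m) z - profile (p n) z) \<partial>index_measure)
          \<le> (\<integral>z. e / 4 + (profile (p m) z - profile (p n) z)\<^sup>2 / e \<partial>index_measure)"
      proof (rule integral_mono)
        fix z
        let ?u = "\<bar>profile (p m) z - profile (p n) z\<bar>"
        have "0 \<le> (?u - e / 2)\<^sup>2" by simp
        then have "e * ?u \<le> e\<^sup>2 / 4 + ?u\<^sup>2"
          by (simp add: power2_eq_square algebra_simps)
        then have "?u \<le> (e\<^sup>2 / 4 + ?u\<^sup>2) / e"
          using e by (simp add: field_simps)
        also have "\<dots> = e / 4 + ?u\<^sup>2 / e"
          using e by (simp add: field_simps power2_eq_square)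
        finally show "norm (profile (p m) z - profile (p n) z) \<le> e / 4 + (profile (p m) z - profile (p n) z)\<^sup>2 / e"
          by simp
      qed (use i1 i2 in auto)
      also have "\<dots> = e / 4 + d (p m) (p n) / e"
        using i2 by (simp add: d_def I.prob_space)
      also have "\<dots> < e / 4 + (e / 2)\<^sup>2 / e"
        using n0[OF that] e by (simp add: divide_strict_right_mono)
      also have "\<dots> \<le> e"
        using e by (simp add: power2_eq_square)
      finally show ?thesis .
    qed
    then show "\<exists>n0. \<forall>m\<ge>n0. \<forall>n\<ge>n0. (\<integral>z. norm (profile (p m) z - profile (p n) z) \<partial>index_measure) < e"
      by blast
  qed (rule that)
  have J_lim: "(\<lambda>n. J + inverse (real (Suc (r n)))) \<longlonglongrightarrow> J"
    using LIMSEQ_subseq_LIMSEQ[OF LIMSEQ_inverse_real_of_nat_add[of J] r(1)] by (simp add: comp_def)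
  interpret L: cost_limit \<mu> \<nu> "\<lambda>n. p (r n)" c a b "\<lambda>n. J + inverse (real (Suc (r n)))" J
  proof (intro cost_limit.intro kernel_limit.intro cost_limit_axioms.intro)
    show "martingale_kernel \<mu> \<nu> (p (r n))" for n
      by (rule mk)
    show "AE x in \<mu>. \<forall>i. convergent (\<lambda>n. cdf (p (r n) x) (rat_enum i))"
      using AE_index_measure[OF r(2)] by (simp add: profile_def Cauchy_convergent_iff)
    show "integrable (semidirect \<mu> (p (r n))) (\<lambda>(x, y). c x y)" for n
      by (rule ic)
    show "(\<integral>(x, y). c x y \<partial>semidirect \<mu> (p (r n))) \<le> J + inverse (real (Suc (r n)))" for n
      using p(1)[of "r n"] by (simp add: S_def cost_def)
  qed (fact J_lim integrable_mu integrable_nu cost_bound_axioms)+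
  show thesis
  proof (rule that[of L.limit_kernel])
    show "L.limit_kernel \<in> martingale_kernels \<mu> \<nu>"
      using L.martingale_kernel_limit by (simp add: martingale_kernels_iff)
    show "integrable (semidirect \<mu> L.limit_kernel) (\<lambda>(x, y). c x y)"
      by (rule L.integrable_cost_limit)
    fix \<kappa>' assume "\<kappa>' \<in> martingale_kernels \<mu> \<nu>" "integrable (semidirect \<mu> \<kappa>') (\<lambda>(x, y). c x y)"
    then have "J \<le> (\<integral>(x, y). c x y \<partial>semidirect \<mu> \<kappa>')"
      using J_le[of \<kappa>'] by (simp add: K_def cost_def martingale_kernels_iff)
    then show "(\<integral>(x, y). c x y \<partial>semidirect \<mu> L.limit_kernel) \<le> (\<integral>(x, y). c x y \<partial>semidirect \<mu> \<kappa>')"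
      using L.integral_cost_limit_le by simp
  qed
qed

end

section \<open>Uniqueness of left-monotone plans\<close>

text \<open>As D vanishes at both ends, a positive value would force a maximum to be attained. The
  leftmost maximizer lies in U, and the midpoint inequality around it forces the same maximal value
  at a point further left, a contradiction.\<close>

lemma continuous_midpoint_max_principle:
  fixes D :: "real \<Rightarrow> real"
  assumes U: "open U" and cont: "continuous_on UNIV D"
    and top: "(D \<longlongrightarrow> 0) at_top" and bot: "(D \<longlongrightarrow> 0) at_bot"
    and out: "\<And>k. k \<notin> U \<Longrightarrow> D k \<le> 0"
    and mid: "\<And>k e. 0 < e \<Longrightarrow> {k - e..k + e} \<subseteq> U \<Longrightarrow> D k \<le> (D (k - e) + D (k + e)) / 2"
  shows "D k \<le> 0"
proof (rule ccontr)
  assume "\<not> D k \<le> 0"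
  then have k: "0 < D k" by simp
  obtain B1 where B1: "\<And>j. B1 \<le> j \<Longrightarrow> D j < D k"
    using order_tendstoD(2)[OF top k] by (auto simp: eventually_at_top_linorder)
  obtain B2 where B2: "\<And>j. j \<le> B2 \<Longrightarrow> D j < D k"
    using order_tendstoD(2)[OF bot k] by (auto simp: eventually_at_bot_linorder)
  let ?S = "{B2..B1}"
  have kS: "k \<in> ?S"
    using B1[of k] B2[of k] by (metis atLeastAtMost_iff less_irrefl linear)
  obtain m where m: "m \<in> ?S" "\<And>j. j \<in> ?S \<Longrightarrow> D j \<le> D m"
    using continuous_attains_sup[of ?S D] continuous_on_subset[OF cont, of ?S] kS by (metis compact_Icc empty_iff subset_UNIV)
  have max: "D j \<le> D m" for j
    using m(2)[of j] m(2)[OF kS] B1[of j] B2[of j] by force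
  let ?T = "{j \<in> ?S. D j = D m}"
  have "compact ?T"
  proof -
    have "closed {j. D j = D m}"
      using cont by (intro closed_Collect_eq continuous_intros)
    then have "compact (?S \<inter> {j. D j = D m})"
      by (intro compact_Int_closed) auto
    then show ?thesis
      by (simp add: Collect_conj_eq[symmetric] Int_def conj_commute)
  qed
  moreover have "?T \<noteq> {}"
    using m(1) by auto
  ultimately obtain l where l: "l \<in> ?T" "\<And>j. j \<in> ?T \<Longrightarrow> l \<le> j"
    using continuous_attains_inf[of ?T "\<lambda>j. j"] by auto
  have "0 < D l"
    using l(1) max[of k] k by simp
  then have "l \<in> U"
    using out[of l] by force
  then obtain e where e: "0 < e" "{l - e..l + e} \<subseteq> U"
    using U by (metis open_contains_cball cball_eq_atLeastAtMost)
  have "D (l - e) \<ge> D m"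
    using mid[OF e] max[of "l + e"] l(1) by simp
  then have eq: "D (l - e) = D m"
    using max[of "l - e"] by simp
  then have "l - e \<in> ?S"
    using B1[of "l - e"] B2[of "l - e"] max[of k] by force
  then have "l \<le> l - e"
    using eq by (intro l(2)) simp
  with e show False by simp
qed

text \<open>As a function of k this is the call function of the second marginal of the plan
  restricted to x \<le> s. It is convex in k and its slopes recover that marginal.\<close>

definition truncated_potential :: "(real \<times> real) measure \<Rightarrow> real \<Rightarrow> real \<Rightarrow> real" where
  "truncated_potential \<pi> s k = (\<integral>z. indicator {..s} (fst z) * max 0 (snd z - k) \<partial>\<pi>)"

locale martingale_coupling = martingale_kernel +
  assumes integrable_mu: "integrable \<mu> (\<lambda>x. x)" and integrable_nu: "integrable \<nu> (\<lambda>y. y)"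
begin

abbreviation "\<pi> \<equiv> semidirect \<mu> \<kappa>"

sublocale pi: prob_space \<pi>
  by (rule prob_semidirect)

sublocale mu: prob_space \<mu>
  by (rule prob_mu)

sublocale nu: real_distribution \<nu>
  by (rule real_distribution_nu)

lemma integrable_call: "integrable \<nu> (\<lambda>y. max 0 (y - k))" "integrable \<nu> (\<lambda>y. max 0 (k - y))"
  using integrable_nu by auto

lemma integrable_pi_snd: "integrable \<pi> (\<lambda>z. snd z)"
  by (rule integrable_snd[OF integrable_nu])

lemma integrable_restrict:
  fixes f :: "real \<times> real \<Rightarrow> real"
  assumes "integrable \<pi> f"
  shows "integrable \<pi> (\<lambda>z. indicator {..s} (fst z) * f z)" "integrable \<pi> (\<lambda>z. indicator {s<..} (fst z) * f z)"
  by (rule Bochner_Integration.integrable_bound[OF assms];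
      use assms in \<open>auto split: split_indicator dest: borel_measurable_integrable\<close>)+

lemma integrable_pi_call: "integrable \<pi> (\<lambda>z. max 0 (snd z - k))" "integrable \<pi> (\<lambda>z. max 0 (k - snd z))"
  by (rule integrable_snd integrable_call)+

lemma integral_call: "(\<integral>z. max 0 (snd z - k) \<partial>\<pi>) = (\<integral>y. max 0 (y - k) \<partial>\<nu>)"
  "(\<integral>z. max 0 (k - snd z) \<partial>\<pi>) = (\<integral>y. max 0 (k - y) \<partial>\<nu>)"
  by (subst snd_marginal[symmetric], simp add: integral_distr)+

text \<open>The contributions from both sides of s add up to an integral against \<nu>, so comparing
  two plans on the left of s amounts to comparing them on the right with the opposite sign.\<close>

lemma truncated_potential_complement:
  "truncated_potential \<pi> s k = (\<integral>y. max 0 (y - k) \<partial>\<nu>) - (\<integral>z. indicator {s<..} (fst z) * max 0 (snd z - k) \<partial>\<pi>)"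
proof -
  have "(\<integral>z. max 0 (snd z - k) \<partial>\<pi>)
      = (\<integral>z. indicator {..s} (fst z) * max 0 (snd z - k) + indicator {s<..} (fst z) * max 0 (snd z - k) \<partial>\<pi>)"
    by (intro Bochner_Integration.integral_cong) (auto split: split_indicator)
  then show ?thesis
    using integrable_restrict[OF integrable_pi_call(1)] by (simp add: truncated_potential_def integral_call)
qed

lemma truncated_potential_bounds:
  "0 \<le> truncated_potential \<pi> s k" "truncated_potential \<pi> s k \<le> (\<integral>y. max 0 (y - k) \<partial>\<nu>)"
proof -
  show "0 \<le> truncated_potential \<pi> s k"
    unfolding truncated_potential_def by (intro Bochner_Integration.integral_nonneg) auto
  have "truncated_potential \<pi> s k \<le> (\<integral>z. max 0 (snd z - k) \<partial>\<pi>)"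
    unfolding truncated_potential_def
    by (intro integral_mono integrable_restrict integrable_pi_call) (auto split: split_indicator)
  then show "truncated_potential \<pi> s k \<le> (\<integral>y. max 0 (y - k) \<partial>\<nu>)"
    by (simp add: integral_call)
qed

lemma integral_restrict_martingale:
  "(\<integral>z. indicator {..s} (fst z) * (snd z - k) \<partial>\<pi>) = (\<integral>x. indicator {..s} x * (x - k) \<partial>\<mu>)"
proof -
  have i: "integrable \<pi> (\<lambda>z. indicator {..s} (fst z) * (snd z - k))"
    by (intro integrable_restrict Bochner_Integration.integrable_diff integrable_pi_snd) simp
  show ?thesis
    unfolding integral_semidirect[OF i]
  proof (rule integral_cong_AE)
    show "(\<lambda>x. \<integral>y. indicator {..s} (fst (x, y)) * (snd (x, y) - k) \<partial>\<kappa> x) \<in> borel_measurable \<mu>"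
      using integrable_integral_semidirect[OF i] by auto
    show "(\<lambda>x. indicator {..s} x * (x - k)) \<in> borel_measurable \<mu>"
      by (simp add: measurable_cong_sets[OF sets_mu refl])
    show "AE x in \<mu>. (\<integral>y. indicator {..s} (fst (x, y)) * (snd (x, y) - k) \<partial>\<kappa> x) = indicator {..s} x * (x - k)"
      using martingale
    proof eventually_elim
      case (elim x)
      interpret kx: prob_space "\<kappa> x" by (rule prob_kernel)
      show ?case
        using elim by (simp add: kx.prob_space[simplified])
    qed
  qed
qed

text \<open>Put-call parity. As k tends to minus infinity the potential need not stay bounded, but
  the subtracted term is common to all martingale plans, and what remains is a put function that
  vanishes in the limit. This is how differences of potentials are controlled at the lower
  end.\<close>

lemma truncated_potential_below:
  "truncated_potential \<pi> s k - (\<integral>x. indicator {..s} x * (x - k) \<partial>\<mu>) = (\<integral>z. indicator {..s} (fst z) * max 0 (k - snd z) \<partial>\<pi>)"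
proof -
  have "truncated_potential \<pi> s k - (\<integral>z. indicator {..s} (fst z) * (snd z - k) \<partial>\<pi>)
     = (\<integral>z. indicator {..s} (fst z) * max 0 (snd z - k) - indicator {..s} (fst z) * (snd z - k) \<partial>\<pi>)"
    unfolding truncated_potential_def
    by (intro Bochner_Integration.integral_diff[symmetric] integrable_restrict integrable_pi_call Bochner_Integration.integrable_diff integrable_pi_snd) simp
  also have "\<dots> = (\<integral>z. indicator {..s} (fst z) * max 0 (k - snd z) \<partial>\<pi>)"
    by (intro Bochner_Integration.integral_cong) (auto split: split_indicator simp: max_def)
  finally show ?thesis
    by (simp add: integral_restrict_martingale)
qed

lemma truncated_potential_below_bounds:
  "0 \<le> truncated_potential \<pi> s k - (\<integral>x. indicator {..s} x * (x - k) \<partial>\<mu>)"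
  "truncated_potential \<pi> s k - (\<integral>x. indicator {..s} x * (x - k) \<partial>\<mu>) \<le> (\<integral>y. max 0 (k - y) \<partial>\<nu>)"
proof -
  show "0 \<le> truncated_potential \<pi> s k - (\<integral>x. indicator {..s} x * (x - k) \<partial>\<mu>)"
    unfolding truncated_potential_below by (intro Bochner_Integration.integral_nonneg) auto
  have "truncated_potential \<pi> s k - (\<integral>x. indicator {..s} x * (x - k) \<partial>\<mu>) \<le> (\<integral>z. max 0 (k - snd z) \<partial>\<pi>)"
    unfolding truncated_potential_below
    by (intro integral_mono integrable_restrict integrable_pi_call) (auto split: split_indicator)
  then show "truncated_potential \<pi> s k - (\<integral>x. indicator {..s} x * (x - k) \<partial>\<mu>) \<le> (\<integral>y. max 0 (k - y) \<partial>\<nu>)"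
    by (simp add: integral_call)
qed

lemma truncated_potential_lipschitz: "\<bar>truncated_potential \<pi> s k - truncated_potential \<pi> s l\<bar> \<le> \<bar>k - l\<bar>"
proof -
  note i = integrable_restrict(1)[OF integrable_pi_call(1)]
  have 1: "truncated_potential \<pi> s k - truncated_potential \<pi> s l =
      (\<integral>z. indicator {..s} (fst z) * max 0 (snd z - k) - indicator {..s} (fst z) * max 0 (snd z - l) \<partial>\<pi>)"
    unfolding truncated_potential_def by (intro Bochner_Integration.integral_diff[symmetric] i)
  have 2: "\<bar>\<integral>z. indicator {..s} (fst z) * max 0 (snd z - k) - indicator {..s} (fst z) * max 0 (snd z - l) \<partial>\<pi>\<bar> \<le> (\<integral>z. \<bar>indicator {..s} (fst z) * max 0 (snd z - k) - indicator {..s} (fst z) * max 0 (snd z - l)\<bar> \<partial>\<pi>)"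
    by (rule integral_abs_bound)
  have 3: "(\<integral>z. \<bar>indicator {..s} (fst z) * max 0 (snd z - k) - indicator {..s} (fst z) * max 0 (snd z - l)\<bar> \<partial>\<pi>) \<le> \<bar>k - l\<bar>"
  proof (rule pi.integral_le_const)
    show "AE z in \<pi>. \<bar>indicator {..s} (fst z) * max 0 (snd z - k) - indicator {..s} (fst z) * max 0 (snd z - l)\<bar> \<le> \<bar>k - l\<bar>"
    proof (rule AE_I2)
      fix z :: "real \<times> real"
      have "\<bar>max 0 (snd z - k) - max 0 (snd z - l)\<bar> \<le> \<bar>k - l\<bar>"
        by (auto simp: max_def)
      then show "\<bar>indicator {..s} (fst z) * max 0 (snd z - k) - indicator {..s} (fst z) * max 0 (snd z - l)\<bar> \<le> \<bar>k - l\<bar>"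
        by (cases "fst z \<le> s") simp_all
    qed
    show "integrable \<pi> (\<lambda>z. \<bar>indicator {..s} (fst z) * max 0 (snd z - k) - indicator {..s} (fst z) * max 0 (snd z - l)\<bar>)"
      by (rule integrable_abs, rule Bochner_Integration.integrable_diff, rule i, rule i)
  qed
  show ?thesis
    unfolding 1 using 2 3 by (rule order_trans)
qed

lemma call_tendsto_0: "((\<lambda>k. \<integral>y. max 0 (y - k) \<partial>\<nu>) \<longlongrightarrow> 0) at_top"
proof -
  have "((\<lambda>k. \<integral>y. max 0 (y - k) \<partial>\<nu>) \<longlongrightarrow> (\<integral>y. 0 \<partial>\<nu>)) at_top"
  proof (rule integral_dominated_convergence_at_top[where w="\<lambda>y. \<bar>y\<bar>"])
    show "\<forall>\<^sub>F k in at_top. AE y in \<nu>. norm (max 0 (y - k)) \<le> \<bar>y\<bar>"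
      by (rule eventually_mono[OF eventually_ge_at_top[of 0]]) (auto intro!: AE_I2)
    show "AE y in \<nu>. ((\<lambda>k. max 0 (y - k)) \<longlongrightarrow> 0) at_top"
    proof (rule AE_I2, rule tendsto_eventually)
      fix y :: real
      show "\<forall>\<^sub>F k in at_top. max 0 (y - k) = 0"
        by (rule eventually_mono[OF eventually_ge_at_top[of y]]) auto
    qed
    show "integrable \<nu> (\<lambda>y. \<bar>y\<bar>)"
      by (rule integrable_abs[OF integrable_nu])
  qed simp_all
  then show ?thesis by simp
qed

lemma put_tendsto_0: "((\<lambda>k. \<integral>y. max 0 (k - y) \<partial>\<nu>) \<longlongrightarrow> 0) at_bot"
proof -
  have "((\<lambda>k. \<integral>y. max 0 (- k - y) \<partial>\<nu>) \<longlongrightarrow> (\<integral>y. 0 \<partial>\<nu>)) at_top"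
  proof (rule integral_dominated_convergence_at_top[where w="\<lambda>y. \<bar>y\<bar>"])
    show "\<forall>\<^sub>F k in at_top. AE y in \<nu>. norm (max 0 (- k - y)) \<le> \<bar>y\<bar>"
      by (rule eventually_mono[OF eventually_ge_at_top[of 0]]) (auto intro!: AE_I2)
    show "AE y in \<nu>. ((\<lambda>k. max 0 (- k - y)) \<longlongrightarrow> 0) at_top"
    proof (rule AE_I2, rule tendsto_eventually)
      fix y :: real
      show "\<forall>\<^sub>F k in at_top. max 0 (- k - y) = 0"
        by (rule eventually_mono[OF eventually_ge_at_top[of "- y"]]) auto
    qed
    show "integrable \<nu> (\<lambda>y. \<bar>y\<bar>)"
      by (rule integrable_abs[OF integrable_nu])
  qed simp_all
  then show ?thesis
    unfolding filterlim_at_bot_mirror by simp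
qed

text \<open>The Jensen lower bound is attained when no fibre to the left of \<open>s\<close> crosses the level \<open>k\<close>.\<close>

lemma truncated_potential_ge: "(\<integral>x. indicator {..s} x * max 0 (x - k) \<partial>\<mu>) \<le> truncated_potential \<pi> s k"
  and truncated_potential_eq:
    "AE x in \<mu>. x \<le> s \<longrightarrow> (AE y in \<kappa> x. y \<le> k) \<or> (AE y in \<kappa> x. k \<le> y) \<Longrightarrow>
      truncated_potential \<pi> s k = (\<integral>x. indicator {..s} x * max 0 (x - k) \<partial>\<mu>)"
proof -
  note i = integrable_restrict(1)[OF integrable_pi_call(1)]
  have eq: "truncated_potential \<pi> s k = (\<integral>x. \<integral>y. indicator {..s} x * max 0 (y - k) \<partial>\<kappa> x \<partial>\<mu>)"
    unfolding truncated_potential_def integral_semidirect[OF i] by simp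
  have int: "integrable \<mu> (\<lambda>x. \<integral>y. indicator {..s} x * max 0 (y - k) \<partial>\<kappa> x)"
    using integrable_integral_semidirect[OF i] by simp
  have im: "integrable \<mu> (\<lambda>x. indicator {..s} x * max 0 (x - k))"
  proof (rule Bochner_Integration.integrable_bound)
    show "integrable \<mu> (\<lambda>x. \<bar>x\<bar> + \<bar>k\<bar>)"
      using integrable_mu by auto
  qed (auto split: split_indicator simp: measurable_cong_sets[OF sets_mu refl])
  show "(\<integral>x. indicator {..s} x * max 0 (x - k) \<partial>\<mu>) \<le> truncated_potential \<pi> s k"
    unfolding eq
  proof (rule integral_mono_AE[OF im int])
    show "AE x in \<mu>. indicator {..s} x * max 0 (x - k) \<le> (\<integral>y. indicator {..s} x * max 0 (y - k) \<partial>\<kappa> x)"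
      using martingale
    proof eventually_elim
      case (elim x)
      interpret kx: prob_space "\<kappa> x" by (rule prob_kernel)
      have ik: "integrable (\<kappa> x) (\<lambda>y. y - k)" "integrable (\<kappa> x) (\<lambda>y. max 0 (y - k))"
        using elim by auto
      have "x - k = (\<integral>y. y - k \<partial>\<kappa> x)"
        using elim by (simp add: kx.prob_space[simplified])
      also have "\<dots> \<le> (\<integral>y. max 0 (y - k) \<partial>\<kappa> x)"
        using ik by (intro integral_mono) auto
      finally have "x - k \<le> (\<integral>y. max 0 (y - k) \<partial>\<kappa> x)" .
      moreover have "0 \<le> (\<integral>y. max 0 (y - k) \<partial>\<kappa> x)"
        by (intro Bochner_Integration.integral_nonneg) auto
      ultimately show ?case
        by (auto split: split_indicator)
    qed
  qed
  assume A: "AE x in \<mu>. x \<le> s \<longrightarrow> (AE y in \<kappa> x. y \<le> k) \<or> (AE y in \<kappa> x. k \<le> y)"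
  show "truncated_potential \<pi> s k = (\<integral>x. indicator {..s} x * max 0 (x - k) \<partial>\<mu>)"
    unfolding eq
  proof (rule integral_cong_AE)
    show "AE x in \<mu>. (\<integral>y. indicator {..s} x * max 0 (y - k) \<partial>\<kappa> x) = indicator {..s} x * max 0 (x - k)"
      using martingale A
    proof eventually_elim
      case (elim x)
      interpret kx: prob_space "\<kappa> x" by (rule prob_kernel)
      have mean: "x - k = (\<integral>y. y - k \<partial>\<kappa> x)"
        using elim by (simp add: kx.prob_space[simplified])
      have "(\<integral>y. max 0 (y - k) \<partial>\<kappa> x) = max 0 (x - k)" if "x \<le> s"
      proof (cases "AE y in \<kappa> x. y \<le> k")
        case True
        have "(\<integral>y. max 0 (y - k) \<partial>\<kappa> x) = (\<integral>y. 0 \<partial>\<kappa> x)"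
          by (rule integral_cong_AE) (use True in auto)
        moreover have "(\<integral>y. y - k \<partial>\<kappa> x) \<le> (\<integral>y. 0 \<partial>\<kappa> x)"
          by (rule integral_mono_AE) (use True elim in auto)
        ultimately show ?thesis
          using mean by simp
      next
        case False
        then have *: "AE y in \<kappa> x. k \<le> y"
          using elim that by blast
        have "(\<integral>y. max 0 (y - k) \<partial>\<kappa> x) = (\<integral>y. y - k \<partial>\<kappa> x)"
          by (rule integral_cong_AE) (use * in auto)
        moreover have "0 \<le> (\<integral>y. y - k \<partial>\<kappa> x)"
          by (rule integral_nonneg_AE) (use * in auto)
        ultimately show ?thesis
          using mean by simp
      qed
      then show ?case
        by (auto split: split_indicator)
    qed
  qed (use int im in auto)
qed

end

text \<open>
  Let \<open>U\<close> be the set of levels strictly crossed by a fibre over some \<open>x \<le> s\<close>. Off \<open>U\<close> the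
  potential attains its Jensen lower bound; by left-monotonicity no mass from the right of \<open>s\<close> enters \<open>U\<close>,
  so there the difference of two potentials is locally convex.
\<close>

lemma truncated_potential_minimal:
  assumes c: "martingale_coupling \<mu> \<nu> \<kappa>" and c': "martingale_coupling \<mu> \<nu> \<kappa>'"
    and lm: "left_monotone (semidirect \<mu> \<kappa>)"
  shows "truncated_potential (semidirect \<mu> \<kappa>) s k \<le> truncated_potential (semidirect \<mu> \<kappa>') s k"
proof -
  interpret c: martingale_coupling \<mu> \<nu> \<kappa> by fact
  interpret c': martingale_coupling \<mu> \<nu> \<kappa>' by fact
  let ?F = "truncated_potential (semidirect \<mu> \<kappa>)" and ?F' = "truncated_potential (semidirect \<mu> \<kappa>')"
  obtain \<Gamma> where \<Gamma> [measurable]: "\<Gamma> \<in> sets borel" and full: "emeasure (semidirect \<mu> \<kappa>) \<Gamma> = 1"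
    and mono: "\<And>x ym yp x' y'. (x, ym) \<in> \<Gamma> \<Longrightarrow> (x, yp) \<in> \<Gamma> \<Longrightarrow> (x', y') \<in> \<Gamma> \<Longrightarrow> \<not> (x < x' \<and> ym < y' \<and> y' < yp)"
    using lm unfolding left_monotone_def by blast
  have AE_\<Gamma>: "AE z in semidirect \<mu> \<kappa>. z \<in> \<Gamma>"
    using full by (intro c.pi.AE_in_set_eq_1[THEN iffD2]) (auto simp: c.pi.emeasure_eq_measure)
  then have AE_fibre: "AE x in \<mu>. AE y in \<kappa> x. (x, y) \<in> \<Gamma>"
    by (subst (asm) c.AE_semidirect) auto
  \<comment> \<open>An arbitrary union of open intervals is open, so it does not matter that
    uncountably many x may contribute.\<close>
  define U where "U = \<Union> {{ym<..<yp} | x ym yp. x \<le> s \<and> (x, ym) \<in> \<Gamma> \<and> (x, yp) \<in> \<Gamma>}"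
  have "?F s k - ?F' s k \<le> 0"
  proof (rule continuous_midpoint_max_principle[where D="\<lambda>k. ?F s k - ?F' s k" and U=U])
    show "open U"
      unfolding U_def by (rule open_Union) auto
    show "continuous_on UNIV (\<lambda>k. ?F s k - ?F' s k)"
    proof -
      have "continuous_on UNIV (?F s)" "continuous_on UNIV (?F' s)"
        using c.truncated_potential_lipschitz c'.truncated_potential_lipschitz
        by (auto intro!: lipschitz_on_continuous_on[of 1] lipschitz_onI simp: dist_real_def)
      then show ?thesis
        by (intro continuous_intros)
    qed
    show "((\<lambda>k. ?F s k - ?F' s k) \<longlongrightarrow> 0) at_top"
    proof (rule Lim_null_comparison[OF _ c.call_tendsto_0])
      show "\<forall>\<^sub>F k in at_top. norm (?F s k - ?F' s k) \<le> (\<integral>y. max 0 (y - k) \<partial>\<nu>)"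
        using c.truncated_potential_bounds[of s] c'.truncated_potential_bounds[of s]
        by (intro always_eventually allI) (smt (verit) real_norm_def)
    qed
    show "((\<lambda>k. ?F s k - ?F' s k) \<longlongrightarrow> 0) at_bot"
    proof (rule Lim_null_comparison[OF _ c.put_tendsto_0])
      show "\<forall>\<^sub>F k in at_bot. norm (?F s k - ?F' s k) \<le> (\<integral>y. max 0 (k - y) \<partial>\<nu>)"
        using c.truncated_potential_below_bounds[of s] c'.truncated_potential_below_bounds[of s]
        by (intro always_eventually allI) (smt (verit) real_norm_def)
    qed
    fix k
    {
      assume k: "k \<notin> U"
      have "AE x in \<mu>. x \<le> s \<longrightarrow> (AE y in \<kappa> x. y \<le> k) \<or> (AE y in \<kappa> x. k \<le> y)"
        using AE_fibre
      proof eventually_elim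
        case (elim x)
        show ?case
        proof
          assume x: "x \<le> s"
          have "(\<forall>y. (x, y) \<in> \<Gamma> \<longrightarrow> y \<le> k) \<or> (\<forall>y. (x, y) \<in> \<Gamma> \<longrightarrow> k \<le> y)"
          proof (rule ccontr)
            assume "\<not> ?thesis"
            then obtain ym yp where "(x, ym) \<in> \<Gamma>" "(x, yp) \<in> \<Gamma>" "ym < k" "k < yp"
              by (auto simp: not_le)
            then have "k \<in> U"
              unfolding U_def using x by (intro UnionI[of "{ym<..<yp}"]) auto
            with k show False ..
          qed
          then show "(AE y in \<kappa> x. y \<le> k) \<or> (AE y in \<kappa> x. k \<le> y)"
          proof
            assume "\<forall>y. (x, y) \<in> \<Gamma> \<longrightarrow> y \<le> k"
            with elim have "AE y in \<kappa> x. y \<le> k" by (auto elim!: eventually_mono)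
            then show ?thesis ..
          next
            assume "\<forall>y. (x, y) \<in> \<Gamma> \<longrightarrow> k \<le> y"
            with elim have "AE y in \<kappa> x. k \<le> y" by (auto elim!: eventually_mono)
            then show ?thesis ..
          qed
        qed
      qed
      then show "?F s k - ?F' s k \<le> 0"
        using c.truncated_potential_eq[of s k] c'.truncated_potential_ge[of s k] by simp
    }
    fix e :: real assume e: "0 < e" and sub: "{k - e..k + e} \<subseteq> U"
    \<comment> \<open>On the right of s the difference reverses sign: F - F' equals G' - G. The
      midpoint inequality follows once G of \<kappa> is affine at the three levels while G of
      \<kappa>' is convex.\<close>
    let ?G = "\<lambda>\<kappa> k. \<integral>z. indicator {s<..} (fst z) * max 0 (snd z - k) \<partial>semidirect \<mu> \<kappa>"
    note i = c.integrable_restrict(2)[OF c.integrable_pi_call(1)]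
    note i' = c'.integrable_restrict(2)[OF c'.integrable_pi_call(1)]
    have "?G \<kappa> k = (\<integral>z. (indicator {s<..} (fst z) * max 0 (snd z - (k - e)) + indicator {s<..} (fst z) * max 0 (snd z - (k + e))) / 2 \<partial>semidirect \<mu> \<kappa>)"
    proof (rule integral_cong_AE)
      show "AE z in semidirect \<mu> \<kappa>. indicator {s<..} (fst z) * max 0 (snd z - k) =
          (indicator {s<..} (fst z) * max 0 (snd z - (k - e)) + indicator {s<..} (fst z) * max 0 (snd z - (k + e))) / 2"
        using AE_\<Gamma>
      proof eventually_elim
        case (elim z)
        show ?case
        proof (cases "s < fst z")
          case True
          have "snd z \<notin> U"
          proof
            assume "snd z \<in> U"
            then obtain x ym yp where "x \<le> s" "(x, ym) \<in> \<Gamma>" "(x, yp) \<in> \<Gamma>" "ym < snd z" "snd z < yp"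
              unfolding U_def by auto
            with mono[of x ym yp "fst z" "snd z"] elim True show False
              by auto
          qed
          \<comment> \<open>For y outside [k - e, k + e] the function \<open>max 0 (y - k)\<close>
            is affine in the strike across that interval, which turns the midpoint inequality into
            an equality.\<close>
          then have "snd z < k - e \<or> k + e < snd z"
            using sub by (meson atLeastAtMost_iff not_le subsetD)
          then have "max 0 (snd z - k) = (max 0 (snd z - (k - e)) + max 0 (snd z - (k + e))) / 2"
            using e by (auto simp: max_def)
          with True show ?thesis
            by simp
        qed simp
      qed
    qed (use i in \<open>auto dest: borel_measurable_integrable\<close>)
    also have "\<dots> = (?G \<kappa> (k - e) + ?G \<kappa> (k + e)) / 2"
      using i by simp
    finally have 1: "?G \<kappa> k = (?G \<kappa> (k - e) + ?G \<kappa> (k + e)) / 2" .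
    have "?G \<kappa>' k \<le> (\<integral>z. (indicator {s<..} (fst z) * max 0 (snd z - (k - e)) + indicator {s<..} (fst z) * max 0 (snd z - (k + e))) / 2 \<partial>semidirect \<mu> \<kappa>')"
    proof (rule integral_mono)
      fix z :: "real \<times> real"
      have "max 0 (snd z - k) \<le> (max 0 (snd z - (k - e)) + max 0 (snd z - (k + e))) / 2"
        using e by (auto simp: max_def)
      then show "indicator {s<..} (fst z) * max 0 (snd z - k) \<le>
          (indicator {s<..} (fst z) * max 0 (snd z - (k - e)) + indicator {s<..} (fst z) * max 0 (snd z - (k + e))) / 2"
        by (cases "s < fst z") simp_all
    qed (use i' in simp_all)
    also have "\<dots> = (?G \<kappa>' (k - e) + ?G \<kappa>' (k + e)) / 2"
      using i' by simp
    finally have 2: "?G \<kappa>' k \<le> (?G \<kappa>' (k - e) + ?G \<kappa>' (k + e)) / 2" .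
    have D: "?F s k - ?F' s k = ?G \<kappa>' k - ?G \<kappa> k" for k
      by (simp add: c.truncated_potential_complement c'.truncated_potential_complement)
    have "?G \<kappa>' k - ?G \<kappa> k \<le> ((?G \<kappa>' (k - e) - ?G \<kappa> (k - e)) + (?G \<kappa>' (k + e) - ?G \<kappa> (k + e))) / 2"
    proof -
      have "a' - a \<le> ((b' - b) + (c' - c)) / 2" if "a = (b + c) / 2" "a' \<le> (b' + c') / 2" for a b c a' b' c' :: real
        using that by (simp add: field_simps)
      from this[OF 1 2] show ?thesis .
    qed
    then show "?F s k - ?F' s k \<le> ((?F s (k - e) - ?F' s (k - e)) + (?F s (k + e) - ?F' s (k + e))) / 2"
      by (simp only: D)
  qed
  then show ?thesis by simp
qed

text \<open>The difference quotient of \<open>max 0 (y - k)\<close> towards larger strikes stays in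
  [0, 1] and tends to the indicator of y > k. Stepping to the right is what produces the open
  half-line.\<close>

lemma (in martingale_coupling) truncated_potential_slope:
  "(\<lambda>n. real (Suc n) * (truncated_potential \<pi> s k - truncated_potential \<pi> s (k + inverse (real (Suc n)))))
     \<longlonglongrightarrow> measure \<pi> ({..s} \<times> {k<..})"
proof -
  note i = integrable_restrict(1)[OF integrable_pi_call(1)]
  let ?f = "\<lambda>n z. indicator {..s} (fst z) * (real (Suc n) * (max 0 (snd z - k) - max 0 (snd z - (k + inverse (real (Suc n))))))"
  have A: "{..s} \<times> {k<..} \<in> sets \<pi>"
    by (simp add: borel_Times)
  have "(\<lambda>n. \<integral>z. ?f n z \<partial>\<pi>) \<longlonglongrightarrow> (\<integral>z. indicator ({..s} \<times> {k<..}) z \<partial>\<pi>)"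
  proof (rule integral_dominated_convergence[where w="\<lambda>_. 1"])
    show "(\<lambda>z. indicator ({..s} \<times> {k<..}) z :: real) \<in> borel_measurable \<pi>"
      using A by simp
    show "?f n \<in> borel_measurable \<pi>" for n
      by measurable
    show "integrable \<pi> (\<lambda>_. 1 :: real)"
      by simp
    show "AE z in \<pi>. norm (?f n z) \<le> 1" for n
    proof (rule AE_I2)
      fix z :: "real \<times> real"
      let ?h = "inverse (real (Suc n))"
      have h: "0 < ?h" "real (Suc n) * ?h = 1"
        by simp_all
      have "0 \<le> max 0 (snd z - k) - max 0 (snd z - (k + d))" "max 0 (snd z - k) - max 0 (snd z - (k + d)) \<le> d" if "0 < d" for d
        using that by (auto simp: max_def)
      note * = this[OF h(1)]
      have "0 \<le> real (Suc n) * (max 0 (snd z - k) - max 0 (snd z - (k + ?h)))"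
        "real (Suc n) * (max 0 (snd z - k) - max 0 (snd z - (k + ?h))) \<le> real (Suc n) * ?h"
        by (intro mult_nonneg_nonneg mult_left_mono * of_nat_0_le_iff)+
      then show "norm (?f n z) \<le> 1"
        unfolding h(2) by (cases "fst z \<le> s") (simp_all del: of_nat_Suc)
    qed
    show "AE z in \<pi>. (\<lambda>n. ?f n z) \<longlonglongrightarrow> indicator ({..s} \<times> {k<..}) z"
    proof (rule AE_I2)
      fix z :: "real \<times> real"
      have "\<forall>\<^sub>F n in sequentially. ?f n z = indicator ({..s} \<times> {k<..}) z"
      proof (cases "k < snd z")
        case True
        then have "\<forall>\<^sub>F n in sequentially. inverse (real (Suc n)) < snd z - k"
          using order_tendstoD(2)[OF LIMSEQ_inverse_real_of_nat, of "snd z - k"] by simp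
        then show ?thesis
        proof eventually_elim
          case (elim n)
          then have "max 0 (snd z - k) - max 0 (snd z - (k + inverse (real (Suc n)))) = inverse (real (Suc n))"
            using True by (simp add: max_def del: of_nat_Suc)
          then show ?case
            using True by (cases z) (simp add: indicator_def del: of_nat_Suc)
        qed
      next
        case False
        have "max 0 (snd z - k) - max 0 (snd z - (k + inverse (real (Suc n)))) = 0" for n
        proof -
          have "max 0 (snd z - k) - max 0 (snd z - (k + d)) = 0" if "0 < d" for d
            using that False by (auto simp: max_def)
          then show ?thesis
            by simp
        qed
        then show ?thesis
          using False by (cases z) (simp add: indicator_def del: of_nat_Suc)
      qed
      then show "(\<lambda>n. ?f n z) \<longlonglongrightarrow> indicator ({..s} \<times> {k<..}) z"
        by (rule tendsto_eventually)
    qed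
  qed
  moreover have "(\<integral>z. ?f n z \<partial>\<pi>) = real (Suc n) * (truncated_potential \<pi> s k - truncated_potential \<pi> s (k + inverse (real (Suc n))))" for n
  proof -
    have "(\<integral>z. ?f n z \<partial>\<pi>) = (\<integral>z. real (Suc n) * (indicator {..s} (fst z) * max 0 (snd z - k) - indicator {..s} (fst z) * max 0 (snd z - (k + inverse (real (Suc n))))) \<partial>\<pi>)"
      by (intro Bochner_Integration.integral_cong) (auto simp: algebra_simps)
    also have "\<dots> = real (Suc n) * (truncated_potential \<pi> s k - truncated_potential \<pi> s (k + inverse (real (Suc n))))"
      unfolding truncated_potential_def
      by (subst integral_mult_right_zero, subst Bochner_Integration.integral_diff[OF i i]) simp
    finally show ?thesis .
  qed
  ultimately show ?thesis
    using A by simp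
qed

text \<open>Each of the two plans minimizes every potential, so the potentials coincide. Their
  slopes and the common first marginal give equal masses to all lower-left quadrants, which form an
  intersection-stable generator.\<close>

lemma left_monotone_unique:
  assumes c: "martingale_coupling \<mu> \<nu> \<kappa>" and c': "martingale_coupling \<mu> \<nu> \<kappa>'"
    and lm: "left_monotone (semidirect \<mu> \<kappa>)" and lm': "left_monotone (semidirect \<mu> \<kappa>')"
  shows "semidirect \<mu> \<kappa> = semidirect \<mu> \<kappa>'"
proof -
  interpret c: martingale_coupling \<mu> \<nu> \<kappa> by fact
  interpret c': martingale_coupling \<mu> \<nu> \<kappa>' by fact
  have pot: "truncated_potential (semidirect \<mu> \<kappa>) = truncated_potential (semidirect \<mu> \<kappa>')"
    using truncated_potential_minimal[OF c c' lm] truncated_potential_minimal[OF c' c lm']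
    by (intro ext antisym) auto
  have up: "measure (semidirect \<mu> \<kappa>) ({..s} \<times> {k<..}) = measure (semidirect \<mu> \<kappa>') ({..s} \<times> {k<..})" for s k
    using LIMSEQ_unique[OF c.truncated_potential_slope[of s k]] c'.truncated_potential_slope[of s k] by (simp add: pot)
  have fst_eq: "measure (semidirect \<mu> \<kappa>) ({..s} \<times> UNIV) = measure (semidirect \<mu> \<kappa>') ({..s} \<times> UNIV)" for s
  proof -
    have "measure (distr (semidirect \<mu> \<kappa>) borel fst) {..s} = measure (distr (semidirect \<mu> \<kappa>') borel fst) {..s}"
      by (simp add: c.distr_fst_semidirect c'.distr_fst_semidirect)
    moreover have "fst -` {..s} = {..s} \<times> (UNIV :: real set)"
      by auto
    ultimately show ?thesis
      by (simp add: measure_distr)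
  qed
  \<comment> \<open>The generator consists of lower-left quadrants, whereas the slopes yield the
    upper parts of the strips; the common first marginal supplies the whole strip.\<close>
  have low: "measure (semidirect \<mu> \<kappa>) ({..s} \<times> {..k}) = measure (semidirect \<mu> \<kappa>') ({..s} \<times> {..k})" for s k :: real
  proof -
    have "{..s} \<times> {..k} = {..s} \<times> UNIV - {..s} \<times> {k<..}"
      by auto
    moreover have "measure M ({..s} \<times> UNIV - {..s} \<times> {k<..}) = measure M ({..s} \<times> UNIV) - measure M ({..s} \<times> {k<..})"
      if "finite_measure M" "sets M = sets borel" for M :: "(real \<times> real) measure"
      using that by (intro finite_measure.finite_measure_Diff) (auto simp: borel_Times)
    ultimately show ?thesis
      using c.pi.finite_measure_axioms c'.pi.finite_measure_axioms by (simp add: up fst_eq)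
  qed
  show ?thesis
  proof (rule measure_eqI_generator_eq[where \<Omega>=UNIV and E="range (\<lambda>a :: real \<times> real. {..a})" and A="\<lambda>n. {..(real n, real n)}"])
    have at: "{..a} = {..fst a} \<times> {..snd a}" for a :: "real \<times> real"
      by (auto simp: less_eq_prod_def)
    show "Int_stable (range (\<lambda>a :: real \<times> real. {..a}))"
    proof (rule Int_stableI)
      fix A B :: "(real \<times> real) set" assume "A \<in> range (\<lambda>a. {..a})" "B \<in> range (\<lambda>a. {..a})"
      then obtain a b where "A = {..a}" "B = {..b}" by auto
      then have "A \<inter> B = {..(min (fst a) (fst b), min (snd a) (snd b))}"
        by (auto simp: at)
      then show "A \<inter> B \<in> range (\<lambda>a. {..a})" by blast
    qed
    show "emeasure (semidirect \<mu> \<kappa>) X = emeasure (semidirect \<mu> \<kappa>') X" if "X \<in> range (\<lambda>a :: real \<times> real. {..a})" for X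
      using that by (auto simp: at low c.pi.emeasure_eq_measure c'.pi.emeasure_eq_measure)
    show "sets (semidirect \<mu> \<kappa>) = sigma_sets UNIV (range (\<lambda>a :: real \<times> real. {..a}))"
      "sets (semidirect \<mu> \<kappa>') = sigma_sets UNIV (range (\<lambda>a :: real \<times> real. {..a}))"
      using arg_cong[OF borel_eq_atMost[where 'a="real \<times> real"], of sets] by simp_all
    show "(\<Union>n. {..(real n, real n)}) = UNIV"
    proof (intro set_eqI iffI UNIV_I)
      fix z :: "real \<times> real"
      obtain n where "max (fst z) (snd z) \<le> real n"
        using real_arch_simple by blast
      then show "z \<in> (\<Union>n. {..(real n, real n)})"
        by (auto simp: at mem_Times_iff)
    qed
  qed auto
qed

section \<open>Rerouting mass\<close>

text \<open>A particle at (x, y) stays with probability 1 - w (x, y) and is otherwise redrawn from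
  \<rho> (x, y). Acting within fibres preserves the first marginal for every w and \<rho>; the
  second marginal and the barycentres have to be arranged by their choice.\<close>

definition reroute ::
  "(real \<Rightarrow> real measure) \<Rightarrow> (real \<times> real \<Rightarrow> real) \<Rightarrow> (real \<times> real \<Rightarrow> real measure) \<Rightarrow> real \<Rightarrow> real measure" where
  "reroute \<kappa> w \<rho> x = \<kappa> x \<bind> (\<lambda>y. mixture (w (x, y)) (return borel y) (\<rho> (x, y)))"

locale rerouting = kernel \<mu> \<kappa> for \<mu> \<kappa> +
  fixes w :: "real \<times> real \<Rightarrow> real" and \<rho> :: "real \<times> real \<Rightarrow> real measure"
  assumes w_measurable: "w \<in> borel_measurable borel" and w: "\<And>z. 0 \<le> w z" "\<And>z. w z \<le> 1"
    and \<rho>: "\<rho> \<in> borel \<rightarrow>\<^sub>M prob_algebra borel"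
begin

lemma rho_in: "\<rho> z \<in> space (prob_algebra borel)"
  using measurable_space[OF \<rho>, of z] by simp

lemma return_in: "return borel y \<in> space (prob_algebra (borel :: real measure))"
  by (simp add: space_prob_algebra prob_space_return)

lemma sets_rho [simp]: "sets (\<rho> z) = sets borel"
  using rho_in[of z] by (auto simp: space_prob_algebra)

lemma mixture_step_measurable:
  "(\<lambda>(x, y). mixture (w (x, y)) (return borel y) (\<rho> (x, y))) \<in> borel \<Otimes>\<^sub>M borel \<rightarrow>\<^sub>M prob_algebra borel"
proof -
  have [measurable]: "w \<in> borel_measurable (borel \<Otimes>\<^sub>M borel)" "\<rho> \<in> borel \<Otimes>\<^sub>M borel \<rightarrow>\<^sub>M prob_algebra borel"
    using w_measurable \<rho> by (simp_all add: borel_prod)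
  have "(\<lambda>z. mixture (w z) (return borel (snd z)) (\<rho> z)) \<in> borel \<Otimes>\<^sub>M borel \<rightarrow>\<^sub>M prob_algebra borel"
    by (rule measurable_mixture) (use w in auto)
  then show ?thesis
    by (simp add: case_prod_beta')
qed

lemma kernel_reroute: "kernel \<mu> (reroute \<kappa> w \<rho>)"
proof (intro kernel.intro prob_mu sets_mu)
  show "reroute \<kappa> w \<rho> \<in> borel \<rightarrow>\<^sub>M prob_algebra borel"
    unfolding reroute_def[abs_def] by (rule measurable_bind_prob_space2[OF kernel mixture_step_measurable])
qed

lemma step_fibre_measurable:
  "(\<lambda>y. mixture (w (x, y)) (return borel y) (\<rho> (x, y))) \<in> \<kappa> x \<rightarrow>\<^sub>M subprob_algebra borel"
  using measurable_compose[OF measurable_Pair1' mixture_step_measurable, of x]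
  by (auto intro: measurable_prob_algebraD)

lemma nn_integral_reroute:
  assumes "f \<in> borel_measurable borel"
  shows "(\<integral>\<^sup>+ y. f y \<partial>reroute \<kappa> w \<rho> x) =
    (\<integral>\<^sup>+ y. ennreal (1 - w (x, y)) * f y + ennreal (w (x, y)) * (\<integral>\<^sup>+ y'. f y' \<partial>\<rho> (x, y)) \<partial>\<kappa> x)"
  unfolding reroute_def using assms w
  by (subst nn_integral_bind[OF _ step_fibre_measurable])
    (auto intro!: nn_integral_cong simp: nn_integral_mixture[OF _ _ return_in rho_in] nn_integral_return)

lemma rho_nn_integral_le:
  fixes g :: "real \<Rightarrow> real"
  assumes g: "integrable (\<rho> z) g" "(\<integral>y. \<bar>g y\<bar> \<partial>\<rho> z) \<le> C"
  shows "(\<integral>\<^sup>+ y. ennreal \<bar>g y\<bar> \<partial>\<rho> z) \<le> ennreal C"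
  using g by (subst nn_integral_eq_integral) (auto intro: ennreal_leI)

lemma step_nn_integral_le:
  fixes g :: "real \<Rightarrow> real"
  assumes g: "w z \<noteq> 0 \<Longrightarrow> integrable (\<rho> z) g \<and> (\<integral>y. \<bar>g y\<bar> \<partial>\<rho> z) \<le> C"
  shows "ennreal (1 - w z) * ennreal \<bar>g (snd z)\<bar> + ennreal (w z) * (\<integral>\<^sup>+ y. ennreal \<bar>g y\<bar> \<partial>\<rho> z)
    \<le> ennreal \<bar>g (snd z)\<bar> + ennreal C"
proof (rule add_mono)
  have "ennreal (1 - w z) \<le> 1"
    using w by simp
  then show "ennreal (1 - w z) * ennreal \<bar>g (snd z)\<bar> \<le> ennreal \<bar>g (snd z)\<bar>"
    using mult_right_mono[of "ennreal (1 - w z)" 1 "ennreal \<bar>g (snd z)\<bar>"] by simp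
  show "ennreal (w z) * (\<integral>\<^sup>+ y. ennreal \<bar>g y\<bar> \<partial>\<rho> z) \<le> ennreal C"
  proof (cases "w z = 0")
    case False
    have "ennreal (w z) \<le> 1"
      using w by simp
    then have "ennreal (w z) * (\<integral>\<^sup>+ y. ennreal \<bar>g y\<bar> \<partial>\<rho> z) \<le> 1 * ennreal C"
      using g[OF False] by (intro mult_mono rho_nn_integral_le) auto
    then show ?thesis by simp
  qed simp
qed

lemma
  fixes g :: "real \<Rightarrow> real"
  assumes g: "integrable (\<kappa> x) g"
    and \<rho>g: "\<And>y. w (x, y) \<noteq> 0 \<Longrightarrow> integrable (\<rho> (x, y)) g \<and> (\<integral>y'. \<bar>g y'\<bar> \<partial>\<rho> (x, y)) \<le> C"
  shows integrable_reroute: "integrable (reroute \<kappa> w \<rho> x) g"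
    and integral_reroute: "(\<integral>y. g y \<partial>reroute \<kappa> w \<rho> x) =
      (\<integral>y. g y \<partial>\<kappa> x) + (\<integral>y. w (x, y) * ((\<integral>y'. g y' \<partial>\<rho> (x, y)) - g y) \<partial>\<kappa> x)"
proof -
  interpret kx: prob_space "\<kappa> x" by (rule prob_kernel)
  have gm [measurable]: "g \<in> borel_measurable borel"
    using borel_measurable_integrable[OF g] by simp
  let ?K = "\<lambda>y. mixture (w (x, y)) (return borel y) (\<rho> (x, y))"
  have step: "(\<integral>y'. g y' \<partial>?K y) = g y + w (x, y) * ((\<integral>y'. g y' \<partial>\<rho> (x, y)) - g y)" for y
  proof (cases "w (x, y) = 0")
    case False
    have r: "integrable (return borel y) g"
      by (simp add: integrable_iff_bounded nn_integral_return)
    show ?thesis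
      using integral_mixture[OF w return_in rho_in r] \<rho>g[OF False] by (simp add: integral_return algebra_simps)
  next
    case True
    have "?K y = return borel y"
    proof (rule measure_eqI)
      show "sets (?K y) = sets (return borel y)"
        using sets_mixture[OF w return_in rho_in] by simp
      fix A assume "A \<in> sets (?K y)"
      then have "A \<in> sets borel"
        using sets_mixture[OF w return_in rho_in, of "(x, y)" y "(x, y)"] by simp
      then show "emeasure (?K y) A = emeasure (return borel y) A"
        using emeasure_mixture[OF w return_in rho_in, of A "(x, y)" y "(x, y)"] by (simp add: True)
    qed
    then show ?thesis
      using True by (simp add: integral_return)
  qed
  have "(\<integral>\<^sup>+ y. \<integral>\<^sup>+ y'. ennreal \<bar>g y'\<bar> \<partial>?K y \<partial>\<kappa> x) \<le> (\<integral>\<^sup>+ y. ennreal \<bar>g y\<bar> + ennreal C \<partial>\<kappa> x)"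
  proof (rule nn_integral_mono)
    fix y
    have "(\<integral>\<^sup>+ y'. ennreal \<bar>g y'\<bar> \<partial>?K y) = ennreal (1 - w (x, y)) * ennreal \<bar>g y\<bar> + ennreal (w (x, y)) * (\<integral>\<^sup>+ y'. ennreal \<bar>g y'\<bar> \<partial>\<rho> (x, y))"
      using nn_integral_mixture[OF w return_in rho_in, of "\<lambda>y. ennreal \<bar>g y\<bar>"] by (simp add: nn_integral_return)
    also have "\<dots> \<le> ennreal \<bar>g y\<bar> + ennreal C"
      using step_nn_integral_le[of "(x, y)" g C] \<rho>g[of y] by simp
    finally show "(\<integral>\<^sup>+ y'. ennreal \<bar>g y'\<bar> \<partial>?K y) \<le> ennreal \<bar>g y\<bar> + ennreal C" .
  qed
  also have "\<dots> < \<infinity>"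
    using g by (subst nn_integral_add) (auto simp: integrable_iff_bounded kx.emeasure_space_1[simplified])
  finally have fin: "(\<integral>\<^sup>+ y. \<integral>\<^sup>+ y'. ennreal \<bar>g y'\<bar> \<partial>?K y \<partial>\<kappa> x) < \<infinity>" .
  have int: "integrable (\<kappa> x \<bind> ?K) g"
    by (rule integrable_bindI[OF step_fibre_measurable _ gm fin]) simp
  then show "integrable (reroute \<kappa> w \<rho> x) g"
    by (simp add: reroute_def)
  have i2: "integrable (\<kappa> x) (\<lambda>y. g y + w (x, y) * ((\<integral>y'. g y' \<partial>\<rho> (x, y)) - g y))"
    using integrable_integral_bind[OF step_fibre_measurable _ int] by (simp add: step)
  from Bochner_Integration.integrable_diff[OF this g]
  have i3: "integrable (\<kappa> x) (\<lambda>y. w (x, y) * ((\<integral>y'. g y' \<partial>\<rho> (x, y)) - g y))"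
    by simp
  show "(\<integral>y. g y \<partial>reroute \<kappa> w \<rho> x) =
      (\<integral>y. g y \<partial>\<kappa> x) + (\<integral>y. w (x, y) * ((\<integral>y'. g y' \<partial>\<rho> (x, y)) - g y) \<partial>\<kappa> x)"
    using integral_bind_eq[OF step_fibre_measurable _ int] g i3 by (simp add: step reroute_def)
qed

text \<open>Integrating the fibre formula for the change over \<mu> makes the effect on any
  integrable function explicit. Indicators of y give the second marginal and c gives the
  cost.\<close>

lemma
  fixes f :: "real \<times> real \<Rightarrow> real"
  assumes f: "integrable (semidirect \<mu> \<kappa>) f"
    and \<rho>f: "\<And>x y. w (x, y) \<noteq> 0 \<Longrightarrow> integrable (\<rho> (x, y)) (\<lambda>y'. f (x, y')) \<and> (\<integral>y'. \<bar>f (x, y')\<bar> \<partial>\<rho> (x, y)) \<le> C"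
  shows integrable_semidirect_reroute: "integrable (semidirect \<mu> (reroute \<kappa> w \<rho>)) f"
    and integrable_semidirect_change: "integrable (semidirect \<mu> \<kappa>) (\<lambda>(x, y). w (x, y) * ((\<integral>y'. f (x, y') \<partial>\<rho> (x, y)) - f (x, y)))"
    and integral_semidirect_reroute: "(\<integral>z. f z \<partial>semidirect \<mu> (reroute \<kappa> w \<rho>)) =
      (\<integral>z. f z \<partial>semidirect \<mu> \<kappa>) + (\<integral>(x, y). w (x, y) * ((\<integral>y'. f (x, y') \<partial>\<rho> (x, y)) - f (x, y)) \<partial>semidirect \<mu> \<kappa>)"
proof -
  interpret r: kernel \<mu> "reroute \<kappa> w \<rho>" by (rule kernel_reroute)
  interpret S: prob_space "semidirect \<mu> \<kappa>" by (rule prob_semidirect)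
  have fm [measurable]: "f \<in> borel_measurable borel"
    using borel_measurable_integrable[OF f] by (simp add: measurable_cong_sets[OF sets_semidirect refl])
  have fm' [measurable]: "f \<in> borel_measurable (borel \<Otimes>\<^sub>M borel)"
    using fm by (simp only: borel_prod)
  have wm [measurable]: "w \<in> borel_measurable (borel \<Otimes>\<^sub>M borel)"
    using w_measurable by (simp only: borel_prod)
  have \<rho>m [measurable]: "\<rho> \<in> borel \<Otimes>\<^sub>M borel \<rightarrow>\<^sub>M subprob_algebra borel"
    using \<rho> by (auto simp: borel_prod intro: measurable_prob_algebraD)
  have fx: "(\<lambda>y. f (x, y)) \<in> borel_measurable borel" for x
    by measurable
  let ?h = "\<lambda>z. w z * ((\<integral>y'. f (fst z, y') \<partial>\<rho> z) - f z)"
  \<comment> \<open>The integrand depends on z as well as on y'. Pushing \<rho> z forward along y'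
    \<mapsto> (fst z, y') gives an integral of the fixed f against a measurable family of
    measures.\<close>
  have hm0: "(\<lambda>z. \<integral>y'. f (fst z, y') \<partial>\<rho> z) \<in> borel_measurable (borel \<Otimes>\<^sub>M borel)"
  proof -
    have "(\<lambda>z. distr (\<rho> z) (borel \<Otimes>\<^sub>M borel) (Pair (fst z))) \<in> borel \<Otimes>\<^sub>M borel \<rightarrow>\<^sub>M subprob_algebra (borel \<Otimes>\<^sub>M borel)"
      by (rule measurable_distr2[OF _ \<rho>m]) measurable
    note measurable_compose[OF this integral_measurable_subprob_algebra[OF fm']]
    moreover have "integral\<^sup>L (distr (\<rho> z) (borel \<Otimes>\<^sub>M borel) (Pair (fst z))) f = (\<integral>y'. f (fst z, y') \<partial>\<rho> z)" for z
      by (rule integral_distr[OF _ fm']) (simp add: measurable_cong_sets[OF sets_rho refl])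
    ultimately show ?thesis
      using fm' by simp
  qed
  have hm: "?h \<in> borel_measurable (semidirect \<mu> \<kappa>)"
    unfolding measurable_cong_sets[OF sets_semidirect_pair refl]
    by (intro borel_measurable_times borel_measurable_diff wm hm0 fm')
  have "(\<integral>\<^sup>+ z. ennreal \<bar>f z\<bar> \<partial>semidirect \<mu> (reroute \<kappa> w \<rho>)) = (\<integral>\<^sup>+ x. \<integral>\<^sup>+ y. ennreal \<bar>f (x, y)\<bar> \<partial>reroute \<kappa> w \<rho> x \<partial>\<mu>)"
    by (rule r.nn_integral_semidirect) measurable
  also have "\<dots> \<le> (\<integral>\<^sup>+ x. \<integral>\<^sup>+ y. ennreal \<bar>f (x, y)\<bar> + ennreal C \<partial>\<kappa> x \<partial>\<mu>)"
  proof (rule nn_integral_mono)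
    fix x
    have m: "(\<lambda>y. ennreal \<bar>f (x, y)\<bar>) \<in> borel_measurable borel"
      by measurable
    show "(\<integral>\<^sup>+ y. ennreal \<bar>f (x, y)\<bar> \<partial>reroute \<kappa> w \<rho> x) \<le> (\<integral>\<^sup>+ y. ennreal \<bar>f (x, y)\<bar> + ennreal C \<partial>\<kappa> x)"
      unfolding nn_integral_reroute[OF m]
    proof (rule nn_integral_mono)
      fix y
      show "ennreal (1 - w (x, y)) * ennreal \<bar>f (x, y)\<bar> + ennreal (w (x, y)) * (\<integral>\<^sup>+ y'. ennreal \<bar>f (x, y')\<bar> \<partial>\<rho> (x, y))
          \<le> ennreal \<bar>f (x, y)\<bar> + ennreal C"
        using step_nn_integral_le[of "(x, y)" "\<lambda>y. f (x, y)" C] \<rho>f[of x y] by simp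
    qed
  qed
  also have "\<dots> = (\<integral>\<^sup>+ z. ennreal \<bar>f z\<bar> + ennreal C \<partial>semidirect \<mu> \<kappa>)"
    by (rule nn_integral_semidirect[symmetric]) measurable
  also have "\<dots> < \<infinity>"
    using f by (subst nn_integral_add) (auto simp: integrable_iff_bounded S.emeasure_space_1[simplified])
  finally show i: "integrable (semidirect \<mu> (reroute \<kappa> w \<rho>)) f"
    by (simp add: integrable_iff_bounded measurable_cong_sets[OF r.sets_semidirect refl])
  have ih: "integrable (semidirect \<mu> \<kappa>) ?h"
  proof (rule Bochner_Integration.integrable_bound)
    show "integrable (semidirect \<mu> \<kappa>) (\<lambda>z. \<bar>f z\<bar> + max 0 C)"
      using f by auto
    show "AE z in semidirect \<mu> \<kappa>. norm (?h z) \<le> norm (\<bar>f z\<bar> + max 0 C)"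
    proof (rule AE_I2)
      fix z :: "real \<times> real"
      show "norm (?h z) \<le> norm (\<bar>f z\<bar> + max 0 C)"
      proof (cases "w z = 0")
        case False
        have "\<bar>\<integral>y'. f (fst z, y') \<partial>\<rho> z\<bar> \<le> (\<integral>y'. \<bar>f (fst z, y')\<bar> \<partial>\<rho> z)"
          by (rule integral_abs_bound)
        also have "\<dots> \<le> C"
          using \<rho>f[of "fst z" "snd z"] False by simp
        finally have "\<bar>\<integral>y'. f (fst z, y') \<partial>\<rho> z\<bar> \<le> max 0 C"
          by simp
        then have "\<bar>(\<integral>y'. f (fst z, y') \<partial>\<rho> z) - f z\<bar> \<le> \<bar>f z\<bar> + max 0 C"
          using abs_triangle_ineq4[of "\<integral>y'. f (fst z, y') \<partial>\<rho> z" "f z"] by simp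
        moreover have "\<bar>w z\<bar> * \<bar>(\<integral>y'. f (fst z, y') \<partial>\<rho> z) - f z\<bar> \<le> 1 * \<bar>(\<integral>y'. f (fst z, y') \<partial>\<rho> z) - f z\<bar>"
          using w by (intro mult_right_mono) (auto simp: abs_le_iff order_trans[of _ 0])
        ultimately show ?thesis
          by (simp add: abs_mult)
      qed simp
    qed
  qed (rule hm)
  then show "integrable (semidirect \<mu> \<kappa>) (\<lambda>(x, y). w (x, y) * ((\<integral>y'. f (x, y') \<partial>\<rho> (x, y)) - f (x, y)))"
    by (simp add: case_prod_beta')
  have "(\<integral>z. f z \<partial>semidirect \<mu> (reroute \<kappa> w \<rho>)) = (\<integral>x. \<integral>y. f (x, y) \<partial>reroute \<kappa> w \<rho> x \<partial>\<mu>)"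
    by (rule r.integral_semidirect[OF i])
  also have "\<dots> = (\<integral>x. (\<integral>y. f (x, y) \<partial>\<kappa> x) + (\<integral>y. ?h (x, y) \<partial>\<kappa> x) \<partial>\<mu>)"
  proof (rule integral_cong_AE)
    show "AE x in \<mu>. (\<integral>y. f (x, y) \<partial>reroute \<kappa> w \<rho> x) = (\<integral>y. f (x, y) \<partial>\<kappa> x) + (\<integral>y. ?h (x, y) \<partial>\<kappa> x)"
      using AE_integrable_semidirect[OF f]
    proof eventually_elim
      case (elim x)
      show ?case
        using integral_reroute[OF elim, of C] \<rho>f by simp
    qed
  qed (use r.integrable_integral_semidirect[OF i] integrable_integral_semidirect[OF f] integrable_integral_semidirect[OF ih] in auto)
  also have "\<dots> = (\<integral>z. f z \<partial>semidirect \<mu> \<kappa>) + (\<integral>z. ?h z \<partial>semidirect \<mu> \<kappa>)"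
    using integrable_integral_semidirect[OF f] integrable_integral_semidirect[OF ih]
    by (simp add: integral_semidirect[OF f] integral_semidirect[OF ih])
  finally show "(\<integral>z. f z \<partial>semidirect \<mu> (reroute \<kappa> w \<rho>)) =
      (\<integral>z. f z \<partial>semidirect \<mu> \<kappa>) + (\<integral>(x, y). w (x, y) * ((\<integral>y'. f (x, y') \<partial>\<rho> (x, y)) - f (x, y)) \<partial>semidirect \<mu> \<kappa>)"
    by (simp add: case_prod_beta')
qed

end

section \<open>The exchange of outer and middle mass\<close>

definition snd_law :: "(real \<times> real) measure \<Rightarrow> (real \<times> real \<Rightarrow> real) \<Rightarrow> real measure" where
  "snd_law M u = distr (density M (\<lambda>z. ennreal (u z / (\<integral>z. u z \<partial>M)))) borel snd"

context
  fixes M :: "(real \<times> real) measure" and u :: "real \<times> real \<Rightarrow> real"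
  assumes M: "sets M = sets borel" and u: "integrable M u" "\<And>z. 0 \<le> u z" and pos: "0 < (\<integral>z. u z \<partial>M)"
begin

lemma sets_snd_law: "sets (snd_law M u) = sets borel"
  by (simp add: snd_law_def)

lemma u_measurable: "u \<in> borel_measurable M"
  using u(1) by (rule borel_measurable_integrable)

lemma snd_measurable_M: "snd \<in> borel_measurable M"
  by (simp add: measurable_cong_sets[OF M refl])

lemma prob_space_snd_law: "prob_space (snd_law M u)"
proof -
  note [measurable] = u_measurable snd_measurable_M
  have "emeasure (density M (\<lambda>z. ennreal (u z / (\<integral>z. u z \<partial>M)))) (space M) = (\<integral>\<^sup>+ z. ennreal (u z / (\<integral>z. u z \<partial>M)) \<partial>M)"
    by (subst emeasure_density) (auto intro!: nn_integral_cong)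
  also have "\<dots> = ennreal (\<integral>z. u z / (\<integral>z. u z \<partial>M) \<partial>M)"
    using u pos by (intro nn_integral_eq_integral) auto
  also have "\<dots> = 1"
    using u pos by simp
  finally have "prob_space (density M (\<lambda>z. ennreal (u z / (\<integral>z. u z \<partial>M))))"
    by (intro prob_spaceI) simp
  then show ?thesis
    unfolding snd_law_def by (rule prob_space.prob_space_distr) simp
qed

lemma snd_law_in: "snd_law M u \<in> space (prob_algebra borel)"
  by (simp add: space_prob_algebra sets_snd_law prob_space_snd_law)

lemma integral_snd_law:
  fixes f :: "real \<Rightarrow> real"
  assumes f [measurable]: "f \<in> borel_measurable borel"
  shows "(\<integral>y. f y \<partial>snd_law M u) = (\<integral>z. u z * f (snd z) \<partial>M) / (\<integral>z. u z \<partial>M)"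
proof -
  note [measurable] = u_measurable snd_measurable_M
  have "(\<integral>y. f y \<partial>snd_law M u) = (\<integral>z. f (snd z) \<partial>density M (\<lambda>z. ennreal (u z / (\<integral>z. u z \<partial>M))))"
    unfolding snd_law_def by (rule integral_distr) simp_all
  also have "\<dots> = (\<integral>z. u z / (\<integral>z. u z \<partial>M) * f (snd z) \<partial>M)"
    using u pos by (subst integral_density) auto
  also have "\<dots> = (\<integral>z. u z * f (snd z) \<partial>M) / (\<integral>z. u z \<partial>M)"
    by (subst integral_divide_zero[symmetric]) (auto intro!: Bochner_Integration.integral_cong)
  finally show ?thesis .
qed

lemma AE_snd_law:
  assumes A [measurable]: "A \<in> sets borel" and supp: "\<And>z. u z \<noteq> 0 \<Longrightarrow> snd z \<in> A"
  shows "AE y in snd_law M u. y \<in> A"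
proof -
  note [measurable] = u_measurable snd_measurable_M
  show ?thesis
    unfolding snd_law_def
    by (subst AE_distr_iff) (auto simp: AE_density intro!: AE_I2 supp)
qed

end

lemma integrable_AE_bounded:
  fixes f :: "real \<Rightarrow> real"
  assumes M: "M \<in> space (prob_algebra borel)" and f: "f \<in> borel_measurable borel"
    and A: "AE y in M. y \<in> A" and b: "\<And>y. y \<in> A \<Longrightarrow> \<bar>f y\<bar> \<le> C"
  shows "integrable M f" "(\<integral>y. \<bar>f y\<bar> \<partial>M) \<le> C"
proof -
  interpret prob_space M using M by (simp add: space_prob_algebra)
  have s: "sets M = sets borel" using M by (simp add: space_prob_algebra)
  have ae: "AE y in M. \<bar>f y\<bar> \<le> C"
    using A by eventually_elim (rule b)
  show i: "integrable M f"
    using ae f by (intro integrable_const_bound[of _ C]) (auto simp: measurable_cong_sets[OF s refl])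
  show "(\<integral>y. \<bar>f y\<bar> \<partial>M) \<le> C"
    using i ae by (intro integral_le_const) auto
qed

text \<open>The cut-off R confines the moved mass to a bounded square, on which a continuous cost is
  bounded. \<open>low\<close> provides fibres over x \<le> s charging both outer intervals, on a set
  of x that is not null; \<open>high\<close> provides mass over x > s inside (p, q).\<close>

locale swap = martingale_kernel \<mu> \<nu> \<kappa> for \<mu> \<nu> \<kappa> +
  fixes R s p q :: real
  assumes pq: "p < q" and R: "\<bar>p\<bar> < R" "\<bar>q\<bar> < R" "\<bar>s\<bar> < R"
    and low: "\<not> (AE x in \<mu>. - R < x \<and> x \<le> s \<longrightarrow> measure (\<kappa> x) {- R<..<p} = 0 \<or> measure (\<kappa> x) {q<..<R} = 0)"
    and high: "0 < measure (semidirect \<mu> \<kappa>) ({s<..<R} \<times> {p<..<q})"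
begin

abbreviation "\<pi> \<equiv> semidirect \<mu> \<kappa>"

sublocale pi: prob_space \<pi>
  by (rule prob_semidirect)

lemma kernel_integral_measurable:
  fixes f :: "real \<Rightarrow> real"
  assumes "f \<in> borel_measurable borel"
  shows "(\<lambda>x. \<integral>y. f y \<partial>\<kappa> x) \<in> borel_measurable borel"
  by (rule measurable_compose[OF kernel_subprob integral_measurable_subprob_algebra[OF assms]])

definition u_mid :: "real \<times> real \<Rightarrow> real" where
  "u_mid z = indicator {s<..<R} (fst z) * indicator {p<..<q} (snd z)"

definition m :: real where
  "m = (\<integral>z. u_mid z * snd z \<partial>\<pi>) / (\<integral>z. u_mid z \<partial>\<pi>)"

text \<open>The first moments about m of the two outer pieces. Weighting the lower piece by
  \<open>d_up\<close> and the upper one by \<open>d_down\<close> makes their moments cancel within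
  each fibre, and nothing moves in a fibre with only one outer piece.\<close>

definition d_up :: "real \<Rightarrow> real" where
  "d_up x = (\<integral>y. indicator {q<..<R} y * (y - m) \<partial>\<kappa> x)"

definition d_down :: "real \<Rightarrow> real" where
  "d_down x = (\<integral>y. indicator {- R<..<p} y * (m - y) \<partial>\<kappa> x)"

text \<open>
  Over \<open>x\<close> the outer mass is removed with weights that make its barycentre \<open>m\<close>,
  so that the removed mass can be replaced by the middle mass.
\<close>

definition u_down :: "real \<times> real \<Rightarrow> real" where
  "u_down z = indicator {- R<..s} (fst z) * indicator {- R<..<p} (snd z) * d_up (fst z)"

definition u_up :: "real \<times> real \<Rightarrow> real" where
  "u_up z = indicator {- R<..s} (fst z) * indicator {q<..<R} (snd z) * d_down (fst z)"

lemma indicator_fst_snd_measurable [measurable]: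
  "A \<in> sets borel \<Longrightarrow> (\<lambda>z. indicator A (fst z) :: real) \<in> borel_measurable (borel :: (real \<times> real) measure)"
  "A \<in> sets borel \<Longrightarrow> (\<lambda>z. indicator A (snd z) :: real) \<in> borel_measurable (borel :: (real \<times> real) measure)"
  by (simp_all add: measurable_compose[OF borel_measurable_fst_borel] measurable_compose[OF borel_measurable_snd_borel])

lemma u_mid_measurable [measurable]: "u_mid \<in> borel_measurable borel"
  unfolding u_mid_def[abs_def] by measurable

lemma d_up_measurable [measurable]: "d_up \<in> borel_measurable borel"
  unfolding d_up_def[abs_def] by (rule kernel_integral_measurable) measurable

lemma d_down_measurable [measurable]: "d_down \<in> borel_measurable borel"
  unfolding d_down_def[abs_def] by (rule kernel_integral_measurable) measurable

lemma u_down_measurable [measurable]: "u_down \<in> borel_measurable borel"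
  unfolding u_down_def[abs_def] by measurable

lemma u_up_measurable [measurable]: "u_up \<in> borel_measurable borel"
  unfolding u_up_def[abs_def] by measurable

lemma u_mid_bounds: "0 \<le> u_mid z" "u_mid z \<le> 1"
  by (auto simp: u_mid_def split: split_indicator)

lemma u_mid_nonzero: "u_mid z \<noteq> 0 \<longleftrightarrow> s < fst z \<and> fst z < R \<and> p < snd z \<and> snd z < q"
  by (auto simp: u_mid_def split: split_indicator)

lemma integrable_u_mid: "integrable \<pi> u_mid"
  using u_mid_bounds by (intro pi.integrable_const_bound[of _ 1]) (auto simp: measurable_cong_sets[OF sets_semidirect refl])

lemma integral_u_mid_pos: "0 < (\<integral>z. u_mid z \<partial>\<pi>)"
proof -
  have "{s<..<R} \<times> {p<..<q} \<in> sets \<pi>"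
    by (simp add: borel_Times)
  moreover have "u_mid = indicator ({s<..<R} \<times> {p<..<q})"
    by (auto simp: u_mid_def fun_eq_iff split: split_indicator)
  ultimately show ?thesis
    using high by simp
qed

definition mid_law :: "real measure" where "mid_law = snd_law \<pi> u_mid"

lemmas mid_law_in = snd_law_in[OF sets_semidirect integrable_u_mid u_mid_bounds(1) integral_u_mid_pos, folded mid_law_def]
lemmas integral_mid_law = integral_snd_law[OF sets_semidirect integrable_u_mid u_mid_bounds(1) integral_u_mid_pos, folded mid_law_def]
lemmas AE_mid_law = AE_snd_law[OF sets_semidirect integrable_u_mid u_mid_bounds(1) integral_u_mid_pos, folded mid_law_def]

lemma AE_mid: "AE y in mid_law. y \<in> {p<..<q}"
  by (rule AE_mid_law) (auto simp: u_mid_nonzero)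

lemma mid_law_mean: "integrable mid_law (\<lambda>y. y)" "(\<integral>y. y \<partial>mid_law) = m"
proof -
  show "integrable mid_law (\<lambda>y. y)"
    by (rule integrable_AE_bounded[OF mid_law_in _ AE_mid, where C=R]) (use R in auto)
  show "(\<integral>y. y \<partial>mid_law) = m"
    by (simp add: integral_mid_law m_def)
qed

lemma m_bounds: "p \<le> m" "m \<le> q"
proof -
  interpret mid: prob_space mid_law using mid_law_in by (simp add: space_prob_algebra)
  show "p \<le> m"
    using AE_mid by (subst mid_law_mean(2)[symmetric], intro mid.integral_ge_const mid_law_mean(1)) (auto elim: eventually_mono)
  show "m \<le> q"
    using AE_mid by (subst mid_law_mean(2)[symmetric], intro mid.integral_le_const mid_law_mean(1)) (auto elim: eventually_mono)
qed

lemma abs_m_less: "\<bar>m\<bar> < R"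
  using m_bounds R by auto

lemma d_bounds: "0 \<le> d_up x" "d_up x \<le> 2 * R" "0 \<le> d_down x" "d_down x \<le> 2 * R"
proof -
  interpret kx: prob_space "\<kappa> x" by (rule prob_kernel)
  have b: "0 \<le> indicator {q<..<R} y * (y - m)" "indicator {q<..<R} y * (y - m) \<le> 2 * R"
    "0 \<le> indicator {- R<..<p} y * (m - y)" "indicator {- R<..<p} y * (m - y) \<le> 2 * R" for y
    using m_bounds abs_m_less by (auto split: split_indicator)
  have i: "integrable (\<kappa> x) (\<lambda>y. indicator {q<..<R} y * (y - m))" "integrable (\<kappa> x) (\<lambda>y. indicator {- R<..<p} y * (m - y))"
    using b by (intro kx.integrable_const_bound[of _ "2 * R"]; simp)+
  show "0 \<le> d_up x" "0 \<le> d_down x"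
    unfolding d_up_def d_down_def using b by (auto intro!: Bochner_Integration.integral_nonneg)
  show "d_up x \<le> 2 * R" "d_down x \<le> 2 * R"
    unfolding d_up_def d_down_def using b i by (auto intro!: kx.integral_le_const)
qed

text \<open>Because p \<le> m \<le> q, the integrands are strictly positive on the open outer
  intervals, so a vanishing moment means vanishing mass.\<close>

lemma d_zero: "d_up x = 0 \<Longrightarrow> measure (\<kappa> x) {q<..<R} = 0" "d_down x = 0 \<Longrightarrow> measure (\<kappa> x) {- R<..<p} = 0"
proof -
  interpret kx: prob_space "\<kappa> x" by (rule prob_kernel)
  have b: "0 \<le> indicator {q<..<R} y * (y - m)" "indicator {q<..<R} y * (y - m) \<le> 2 * R"
    "0 \<le> indicator {- R<..<p} y * (m - y)" "indicator {- R<..<p} y * (m - y) \<le> 2 * R" for y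
    using m_bounds abs_m_less by (auto split: split_indicator)
  have i: "integrable (\<kappa> x) (\<lambda>y. indicator {q<..<R} y * (y - m))" "integrable (\<kappa> x) (\<lambda>y. indicator {- R<..<p} y * (m - y))"
    using b by (intro kx.integrable_const_bound[of _ "2 * R"]; simp)+
  show "measure (\<kappa> x) {q<..<R} = 0" if "d_up x = 0"
  proof -
    have "AE y in \<kappa> x. indicator {q<..<R} y * (y - m) = 0"
      using that b i unfolding d_up_def by (subst (asm) integral_nonneg_eq_0_iff_AE) auto
    then have "AE y in \<kappa> x. y \<notin> {q<..<R}"
      by eventually_elim (use m_bounds in \<open>auto split: split_indicator_asm\<close>)
    then show ?thesis
      by (subst kx.prob_eq_0) auto
  qed
  show "measure (\<kappa> x) {- R<..<p} = 0" if "d_down x = 0"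
  proof -
    have "AE y in \<kappa> x. indicator {- R<..<p} y * (m - y) = 0"
      using that b i unfolding d_down_def by (subst (asm) integral_nonneg_eq_0_iff_AE) auto
    then have "AE y in \<kappa> x. y \<notin> {- R<..<p}"
      by eventually_elim (use m_bounds in \<open>auto split: split_indicator_asm\<close>)
    then show ?thesis
      by (subst kx.prob_eq_0) auto
  qed
qed

lemma u_outer_bounds: "0 \<le> u_down z" "0 \<le> u_up z" "u_down z + u_up z \<le> 2 * R"
  using d_bounds[of "fst z"] pq by (auto simp: u_down_def u_up_def split: split_indicator)

lemma u_nonzero:
  "u_down z \<noteq> 0 \<Longrightarrow> - R < fst z \<and> fst z \<le> s \<and> - R < snd z \<and> snd z < p"
  "u_up z \<noteq> 0 \<Longrightarrow> - R < fst z \<and> fst z \<le> s \<and> q < snd z \<and> snd z < R"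
  by (auto simp: u_down_def u_up_def split: split_indicator_asm)

lemma u_le: "u_down z \<le> 2 * R" "u_up z \<le> 2 * R" "u_mid z \<le> 1"
  using u_outer_bounds[of z] u_mid_bounds[of z] by auto

lemma integrable_u_mult:
  assumes g: "g \<in> borel_measurable borel" and C: "\<And>z. \<bar>fst z\<bar> \<le> R \<Longrightarrow> \<bar>snd z\<bar> \<le> R \<Longrightarrow> \<bar>g z\<bar> \<le> C"
  shows "integrable \<pi> (\<lambda>z. u_mid z * g z)" "integrable \<pi> (\<lambda>z. u_down z * g z)" "integrable \<pi> (\<lambda>z. u_up z * g z)"
proof -
  note [measurable] = g
  have gen: "integrable \<pi> (\<lambda>z. u z * g z)"
    if [measurable]: "u \<in> borel_measurable borel" and u: "\<And>z. 0 \<le> u z" "\<And>z. u z \<le> B" and supp: "\<And>z. u z \<noteq> 0 \<Longrightarrow> \<bar>fst z\<bar> \<le> R \<and> \<bar>snd z\<bar> \<le> R"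
    for u B
  proof (rule pi.integrable_const_bound[of _ "B * C"])
    show "AE z in \<pi>. norm (u z * g z) \<le> B * C"
    proof (rule AE_I2)
      fix z :: "real \<times> real"
      show "norm (u z * g z) \<le> B * C"
      proof (cases "u z = 0")
        case True
        have "0 \<le> B" using u order_trans by blast
        moreover have "0 \<le> C" using order_trans[OF abs_ge_zero C[of "(0, 0)"]] R by simp
        ultimately show ?thesis using True by simp
      next
        case False
        then show ?thesis
          using u[of z] supp[OF False] C[of z] by (auto simp: abs_mult intro!: mult_mono)
      qed
    qed
    show "(\<lambda>z. u z * g z) \<in> borel_measurable \<pi>"
      by (simp add: measurable_cong_sets[OF sets_semidirect refl])
  qed
  show "integrable \<pi> (\<lambda>z. u_mid z * g z)"
    by (rule gen[OF u_mid_measurable u_mid_bounds]) (use R in \<open>auto simp: u_mid_nonzero\<close>)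
  show "integrable \<pi> (\<lambda>z. u_down z * g z)"
    by (rule gen[OF u_down_measurable u_outer_bounds(1) u_le(1)]) (use R u_nonzero(1) in force)
  show "integrable \<pi> (\<lambda>z. u_up z * g z)"
    by (rule gen[OF u_up_measurable u_outer_bounds(2) u_le(2)]) (use R u_nonzero(2) in force)
qed

lemma integrable_u: "integrable \<pi> u_down" "integrable \<pi> u_up"
  using integrable_u_mult[of "\<lambda>_. 1" 1] by simp_all

lemma fibre_integral:
  "(\<integral>y. u_down (x, y) * g y \<partial>\<kappa> x) = indicator {- R<..s} x * d_up x * (\<integral>y. indicator {- R<..<p} y * g y \<partial>\<kappa> x)"
  "(\<integral>y. u_up (x, y) * g y \<partial>\<kappa> x) = indicator {- R<..s} x * d_down x * (\<integral>y. indicator {q<..<R} y * g y \<partial>\<kappa> x)"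
  by (simp_all add: u_down_def u_up_def ac_simps flip: integral_mult_right_zero)

text \<open>If either total vanished, then in almost every fibre over (-R, s] a moment or a mass
  would be zero, hence one of the two outer masses, against \<open>low\<close>.\<close>

lemma integral_u_outer_pos: "0 < (\<integral>z. u_down z \<partial>\<pi>)" "0 < (\<integral>z. u_up z \<partial>\<pi>)"
proof -
  have e: "(\<integral>z. u_down z \<partial>\<pi>) = (\<integral>x. indicator {- R<..s} x * d_up x * measure (\<kappa> x) {- R<..<p} \<partial>\<mu>)"
    "(\<integral>z. u_up z \<partial>\<pi>) = (\<integral>x. indicator {- R<..s} x * d_down x * measure (\<kappa> x) {q<..<R} \<partial>\<mu>)"
    using integral_semidirect[OF integrable_u(1)] integral_semidirect[OF integrable_u(2)]
      fibre_integral[where g="\<lambda>_. 1"] by simp_all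
  have i: "integrable \<mu> (\<lambda>x. indicator {- R<..s} x * d_up x * measure (\<kappa> x) {- R<..<p})"
    "integrable \<mu> (\<lambda>x. indicator {- R<..s} x * d_down x * measure (\<kappa> x) {q<..<R})"
    using integrable_integral_semidirect[OF integrable_u(1)] integrable_integral_semidirect[OF integrable_u(2)]
      fibre_integral[where g="\<lambda>_. 1"] by simp_all
  have nz: "(\<integral>z. u_down z \<partial>\<pi>) \<noteq> 0" "(\<integral>z. u_up z \<partial>\<pi>) \<noteq> 0"
  proof -
    show "(\<integral>z. u_down z \<partial>\<pi>) \<noteq> 0"
    proof
      assume "(\<integral>z. u_down z \<partial>\<pi>) = 0"
      then have "AE x in \<mu>. indicator {- R<..s} x * d_up x * measure (\<kappa> x) {- R<..<p} = 0"
        unfolding e using i d_bounds by (subst (asm) integral_nonneg_eq_0_iff_AE) auto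
      then have "AE x in \<mu>. - R < x \<and> x \<le> s \<longrightarrow> measure (\<kappa> x) {- R<..<p} = 0 \<or> measure (\<kappa> x) {q<..<R} = 0"
        by eventually_elim (use d_zero in \<open>auto split: split_indicator_asm\<close>)
      with low show False ..
    qed
    show "(\<integral>z. u_up z \<partial>\<pi>) \<noteq> 0"
    proof
      assume "(\<integral>z. u_up z \<partial>\<pi>) = 0"
      then have "AE x in \<mu>. indicator {- R<..s} x * d_down x * measure (\<kappa> x) {q<..<R} = 0"
        unfolding e using i d_bounds by (subst (asm) integral_nonneg_eq_0_iff_AE) auto
      then have "AE x in \<mu>. - R < x \<and> x \<le> s \<longrightarrow> measure (\<kappa> x) {- R<..<p} = 0 \<or> measure (\<kappa> x) {q<..<R} = 0"
        by eventually_elim (use d_zero in \<open>auto split: split_indicator_asm\<close>)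
      with low show False ..
    qed
  qed
  then show "0 < (\<integral>z. u_down z \<partial>\<pi>)" "0 < (\<integral>z. u_up z \<partial>\<pi>)"
    using u_outer_bounds by (auto simp: less_le intro!: Bochner_Integration.integral_nonneg)
qed

text \<open>The crosswise weights give d_up times d_down minus d_down times d_up. The factor a is 1
  when barycentres are checked and a chord slope depending on x in the cost estimate.\<close>

lemma outer_barycentre_fibre: "(\<integral>y. (u_down (x, y) + u_up (x, y)) * (a * (m - y)) \<partial>\<kappa> x) = 0"
proof -
  interpret kx: prob_space "\<kappa> x" by (rule prob_kernel)
  have i1: "integrable (\<kappa> x) (\<lambda>y. u_down (x, y) * (m - y))" "integrable (\<kappa> x) (\<lambda>y. u_up (x, y) * (m - y))"
  proof -
    have gen: "\<bar>b * (m - y)\<bar> \<le> 2 * R * (2 * R)" if "0 \<le> b" "b \<le> 2 * R" "b \<noteq> 0 \<Longrightarrow> \<bar>y\<bar> \<le> R" for b y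
    proof (cases "b = 0")
      case False
      then have "\<bar>m - y\<bar> \<le> 2 * R"
        using that abs_m_less by auto
      then show ?thesis
        using that abs_m_less unfolding abs_mult by (intro mult_mono) auto
    qed simp
    have "\<bar>u_down (x, y) * (m - y)\<bar> \<le> 2 * R * (2 * R)" for y
      by (rule gen[OF u_outer_bounds(1) u_le(1)]) (use u_nonzero(1) R in force)
    moreover have "\<bar>u_up (x, y) * (m - y)\<bar> \<le> 2 * R * (2 * R)" for y
      by (rule gen[OF u_outer_bounds(2) u_le(2)]) (use u_nonzero(2) R in force)
    ultimately show "integrable (\<kappa> x) (\<lambda>y. u_down (x, y) * (m - y))" "integrable (\<kappa> x) (\<lambda>y. u_up (x, y) * (m - y))"
      by (auto intro!: kx.integrable_const_bound[of _ "2 * R * (2 * R)"] simp: u_down_def u_up_def)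
  qed
  have dd: "(\<integral>y. indicator {- R<..<p} y * (m - y) \<partial>\<kappa> x) = d_down x"
    "(\<integral>y. indicator {q<..<R} y * (m - y) \<partial>\<kappa> x) = - d_up x"
    unfolding d_down_def d_up_def
    by (simp_all only: Bochner_Integration.integral_minus[symmetric] mult_minus_right[symmetric] minus_diff_eq)
  have "(\<integral>y. (u_down (x, y) + u_up (x, y)) * (a * (m - y)) \<partial>\<kappa> x)
     = (\<integral>y. a * (u_down (x, y) * (m - y) + u_up (x, y) * (m - y)) \<partial>\<kappa> x)"
    by (intro Bochner_Integration.integral_cong) (simp_all add: algebra_simps)
  also have "\<dots> = a * ((\<integral>y. u_down (x, y) * (m - y) \<partial>\<kappa> x) + (\<integral>y. u_up (x, y) * (m - y) \<partial>\<kappa> x))"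
    using i1 by simp
  also have "\<dots> = 0"
    unfolding fibre_integral dd by simp
  finally show ?thesis .
qed

lemma outer_barycentre:
  assumes \<sigma> [measurable]: "\<sigma> \<in> borel_measurable borel" and b: "\<And>x. \<bar>x\<bar> \<le> R \<Longrightarrow> \<bar>\<sigma> x\<bar> \<le> C"
  shows "(\<integral>z. (u_down z + u_up z) * (\<sigma> (fst z) * (m - snd z)) \<partial>\<pi>) = 0"
    and "integrable \<pi> (\<lambda>z. (u_down z + u_up z) * (\<sigma> (fst z) * (m - snd z)))"
proof -
  have gm: "(\<lambda>z. \<sigma> (fst z) * (m - snd z)) \<in> borel_measurable borel"
    by measurable
  have gb: "\<bar>\<sigma> (fst z) * (m - snd z)\<bar> \<le> C * (2 * R)" if "\<bar>fst z\<bar> \<le> R" "\<bar>snd z\<bar> \<le> R" for z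
    using b[OF that(1)] that abs_m_less by (auto simp: abs_mult intro!: mult_mono)
  note i = integrable_u_mult[OF gm gb]
  show int: "integrable \<pi> (\<lambda>z. (u_down z + u_up z) * (\<sigma> (fst z) * (m - snd z)))"
    using Bochner_Integration.integrable_add[OF i(2) i(3)] by (simp add: distrib_right)
  show "(\<integral>z. (u_down z + u_up z) * (\<sigma> (fst z) * (m - snd z)) \<partial>\<pi>) = 0"
    using integral_semidirect[OF int] by (simp add: outer_barycentre_fibre)
qed

end

lemma AE_mixture:
  assumes t: "0 \<le> t" "t \<le> 1" and M: "M \<in> space (prob_algebra borel)" and N: "N \<in> space (prob_algebra borel)"
    and P: "Measurable.pred borel P" and "AE y in M. P y" "AE y in N. P y"
  shows "AE y in mixture t M N. P y"
  unfolding mixture_def using assms by (subst AE_bind[OF mixture_kernel'[OF t M N] P]) auto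

context swap
begin

abbreviation "t_down \<equiv> \<integral>z. u_down z \<partial>\<pi>"
abbreviation "t_up \<equiv> \<integral>z. u_up z \<partial>\<pi>"
abbreviation "t_mid \<equiv> \<integral>z. u_mid z \<partial>\<pi>"

definition down_law :: "real measure" where "down_law = snd_law \<pi> u_down"
definition up_law :: "real measure" where "up_law = snd_law \<pi> u_up"

lemmas down_law_in = snd_law_in[OF sets_semidirect integrable_u(1) u_outer_bounds(1) integral_u_outer_pos(1), folded down_law_def]
lemmas integral_down_law = integral_snd_law[OF sets_semidirect integrable_u(1) u_outer_bounds(1) integral_u_outer_pos(1), folded down_law_def]
lemmas AE_down_law = AE_snd_law[OF sets_semidirect integrable_u(1) u_outer_bounds(1) integral_u_outer_pos(1), folded down_law_def]
lemmas up_law_in = snd_law_in[OF sets_semidirect integrable_u(2) u_outer_bounds(2) integral_u_outer_pos(2), folded up_law_def]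
lemmas integral_up_law = integral_snd_law[OF sets_semidirect integrable_u(2) u_outer_bounds(2) integral_u_outer_pos(2), folded up_law_def]
lemmas AE_up_law = AE_snd_law[OF sets_semidirect integrable_u(2) u_outer_bounds(2) integral_u_outer_pos(2), folded up_law_def]

lemma AE_down: "AE y in down_law. y \<in> {- R<..<p}"
  by (rule AE_down_law) (auto dest: u_nonzero)

lemma AE_up: "AE y in up_law. y \<in> {q<..<R}"
  by (rule AE_up_law) (auto dest: u_nonzero)

definition m_down :: real where "m_down = (\<integral>y. y \<partial>down_law)"
definition m_up :: real where "m_up = (\<integral>y. y \<partial>up_law)"

lemma integrable_id_laws: "integrable down_law (\<lambda>y. y)" "integrable up_law (\<lambda>y. y)"
proof -
  show "integrable down_law (\<lambda>y. y)"
    by (rule integrable_AE_bounded[OF down_law_in _ AE_down, where C=R]) (use R in auto)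
  show "integrable up_law (\<lambda>y. y)"
    by (rule integrable_AE_bounded[OF up_law_in _ AE_up, where C=R]) (use R in auto)
qed

lemma m_down_le: "m_down \<le> p"
proof -
  interpret prob_space down_law using down_law_in by (simp add: space_prob_algebra)
  show ?thesis
    unfolding m_down_def using AE_down
    by (intro integral_le_const integrable_id_laws) (auto elim: eventually_mono)
qed

lemma m_up_ge: "q \<le> m_up"
proof -
  interpret prob_space up_law using up_law_in by (simp add: space_prob_algebra)
  show ?thesis
    unfolding m_up_def using AE_up
    by (intro integral_ge_const integrable_id_laws) (auto elim: eventually_mono)
qed

lemma m_down_less_up: "0 < m_up - m_down"
  using m_down_le m_up_ge pq by linarith

definition T :: real where "T = t_down + t_up"

lemma T_pos: "0 < T"
  using integral_u_outer_pos by (simp add: T_def)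

text \<open>Integrating the fibre identity over \<mu>: the selected outer mass as a whole also has
  barycentre m, so it can trade places with the middle mass.\<close>

lemma outer_mean: "t_down * m_down + t_up * m_up = m * T"
proof -
  have b: "\<bar>snd z\<bar> \<le> R" if "\<bar>snd z\<bar> \<le> R" for z :: "real \<times> real"
    by (rule that)
  note i = integrable_u_mult[OF borel_measurable_snd_borel b]
  have "(\<integral>z. (u_down z + u_up z) * (1 * (m - snd z)) \<partial>\<pi>) = 0"
    by (rule outer_barycentre(1)[of "\<lambda>_. 1" 1]) auto
  moreover have "(\<integral>z. (u_down z + u_up z) * (1 * (m - snd z)) \<partial>\<pi>) =
      (\<integral>z. m * u_down z + m * u_up z - u_down z * snd z - u_up z * snd z \<partial>\<pi>)"
    by (intro Bochner_Integration.integral_cong) (auto simp: algebra_simps)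
  moreover have "\<dots> = m * T - (\<integral>z. u_down z * snd z \<partial>\<pi>) - (\<integral>z. u_up z * snd z \<partial>\<pi>)"
    using i integrable_u by (simp add: T_def algebra_simps)
  moreover have "t_down * m_down = (\<integral>z. u_down z * snd z \<partial>\<pi>)" "t_up * m_up = (\<integral>z. u_up z * snd z \<partial>\<pi>)"
    using integral_u_outer_pos by (simp_all add: m_down_def m_up_def integral_down_law integral_up_law)
  ultimately show ?thesis
    by linarith
qed

text \<open>The weight of \<open>up_law\<close> for which the mixture with \<open>down_law\<close>
  has mean y. The clamp only secures values in [0, 1]; it is inactive on (p, q), because m_down
  \<le> p and q \<le> m_up.\<close>

definition tau :: "real \<Rightarrow> real" where
  "tau y = max 0 (min 1 ((y - m_down) / (m_up - m_down)))"

lemma tau_bounds: "0 \<le> tau y" "tau y \<le> 1"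
  by (auto simp: tau_def)

lemma tau_mid: "p < y \<Longrightarrow> y < q \<Longrightarrow> tau y = (y - m_down) / (m_up - m_down)"
  using m_down_le m_up_ge m_down_less_up by (auto simp: tau_def max_def min_def field_simps)

definition spread_law :: "real \<Rightarrow> real measure" where
  "spread_law y = mixture (tau y) down_law up_law"

text \<open>The first bound keeps the outer weight at most 1, as u_down + u_up is at most 2R; the
  second does so for the middle weight \<epsilon>'. The choice of \<epsilon>' equates the two moved
  masses \<epsilon> T and \<epsilon>' t_mid.\<close>

definition \<epsilon> :: real where "\<epsilon> = min (1 / (2 * R)) (t_mid / T)"
definition \<epsilon>' :: real where "\<epsilon>' = \<epsilon> * T / t_mid"

lemma R_pos: "0 < R"
  using R by linarith

lemma eps: "0 < \<epsilon>" "\<epsilon> * (2 * R) \<le> 1" "0 < \<epsilon>'" "\<epsilon>' \<le> 1"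
proof -
  show e: "0 < \<epsilon>"
    using R_pos T_pos integral_u_mid_pos by (simp add: \<epsilon>_def)
  have "\<epsilon> \<le> 1 / (2 * R)"
    by (simp add: \<epsilon>_def)
  then show "\<epsilon> * (2 * R) \<le> 1"
    using R_pos by (simp add: field_simps)
  show "0 < \<epsilon>'"
    using e T_pos integral_u_mid_pos by (simp add: \<epsilon>'_def)
  have "\<epsilon> \<le> t_mid / T"
    by (simp add: \<epsilon>_def)
  then show "\<epsilon>' \<le> 1"
    using T_pos integral_u_mid_pos by (simp add: \<epsilon>'_def field_simps)
qed

definition w :: "real \<times> real \<Rightarrow> real" where
  "w z = \<epsilon> * (u_down z + u_up z) + \<epsilon>' * u_mid z"

definition \<rho> :: "real \<times> real \<Rightarrow> real measure" where
  "\<rho> z = (if fst z \<le> s then mid_law else spread_law (snd z))"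

lemma u_disjoint: "u_mid z \<noteq> 0 \<Longrightarrow> u_down z = 0 \<and> u_up z = 0"
  using u_nonzero[of z] by (auto simp: u_mid_nonzero)

lemma w_bounds: "0 \<le> w z" "w z \<le> 1"
proof -
  show "0 \<le> w z"
    using eps u_outer_bounds[of z] u_mid_bounds[of z] by (simp add: w_def)
  show "w z \<le> 1"
  proof (cases "u_mid z = 0")
    case True
    have "\<epsilon> * (u_down z + u_up z) \<le> \<epsilon> * (2 * R)"
      using eps u_outer_bounds[of z] by (intro mult_left_mono) auto
    from order_trans[OF this eps(2)] show ?thesis
      by (simp only: w_def True mult_zero_right add_0_right)
  next
    case False
    have "\<epsilon>' * u_mid z \<le> 1 * 1"
      using eps u_mid_bounds[of z] by (intro mult_mono) auto
    then show ?thesis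
      using u_disjoint[OF False] by (simp add: w_def)
  qed
qed

lemma w_measurable: "w \<in> borel_measurable borel"
  unfolding w_def[abs_def] by measurable

lemma rho_measurable: "\<rho> \<in> borel \<rightarrow>\<^sub>M prob_algebra borel"
proof -
  have [measurable]: "tau \<in> borel_measurable borel"
    unfolding tau_def[abs_def] by measurable
  have "(\<lambda>y. mixture (tau y) down_law up_law) \<in> borel \<rightarrow>\<^sub>M prob_algebra borel"
    by (rule measurable_mixture) (use tau_bounds down_law_in up_law_in in auto)
  then have "spread_law \<in> borel \<rightarrow>\<^sub>M prob_algebra borel"
    by (simp add: spread_law_def[abs_def])
  from measurable_compose[OF borel_measurable_snd_borel this]
  show ?thesis
    unfolding \<rho>_def[abs_def] using mid_law_in
    by (intro measurable_If) (auto simp: pred_def[symmetric])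
qed

sublocale rr: rerouting \<mu> \<kappa> w \<rho>
  by unfold_locales (fact w_measurable w_bounds rho_measurable)+

lemma AE_bounded_laws: "AE y in mid_law. y \<in> {- R..R}" "AE y in down_law. y \<in> {- R..R}" "AE y in up_law. y \<in> {- R..R}"
proof -
  show "AE y in mid_law. y \<in> {- R..R}"
    using AE_mid by eventually_elim (use R in auto)
  show "AE y in down_law. y \<in> {- R..R}"
    using AE_down by eventually_elim (use R in auto)
  show "AE y in up_law. y \<in> {- R..R}"
    using AE_up by eventually_elim (use R in auto)
qed

lemma AE_rho: "AE y in \<rho> z. y \<in> {- R..R}"
proof (cases "fst z \<le> s")
  case False
  have "AE y in mixture (tau (snd z)) down_law up_law. y \<in> {- R..R}"
    using AE_bounded_laws by (intro AE_mixture tau_bounds down_law_in up_law_in) simp_all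
  moreover have "\<rho> z = mixture (tau (snd z)) down_law up_law"
    using False by (simp add: \<rho>_def spread_law_def)
  ultimately show ?thesis
    by (simp only:)
next
  case True
  then have "\<rho> z = mid_law"
    by (simp add: \<rho>_def)
  then show ?thesis
    using AE_bounded_laws(1) by (simp only:)
qed

context
  fixes f :: "real \<Rightarrow> real" and C :: real
  assumes f: "f \<in> borel_measurable borel" and C: "\<And>y. \<bar>y\<bar> \<le> R \<Longrightarrow> \<bar>f y\<bar> \<le> C"
begin

lemma f_bound: "y \<in> {- R..R} \<Longrightarrow> \<bar>f y\<bar> \<le> C"
  using C by auto

lemmas integrable_laws = integrable_AE_bounded(1)[OF mid_law_in f AE_bounded_laws(1) f_bound]
  integrable_AE_bounded(1)[OF down_law_in f AE_bounded_laws(2) f_bound]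
  integrable_AE_bounded(1)[OF up_law_in f AE_bounded_laws(3) f_bound]

lemmas integrable_rho = integrable_AE_bounded[OF rr.rho_in f AE_rho f_bound]

lemma integral_spread: "(\<integral>y. f y \<partial>spread_law y0) = (1 - tau y0) * (\<integral>y. f y \<partial>down_law) + tau y0 * (\<integral>y. f y \<partial>up_law)"
  unfolding spread_law_def by (rule integral_mixture[OF tau_bounds down_law_in up_law_in integrable_laws(2,3)])

text \<open>Wherever u_mid is nonzero the clamp in \<open>tau\<close> is inactive, and elsewhere its
  factor disappears. The case distinction in \<rho> thus becomes a sum whose middle term is affine
  in y apart from f itself, ready for integration.\<close>

lemma swap_change:
  "w z * ((\<integral>y. f y \<partial>\<rho> z) - f (snd z)) =
    \<epsilon> * ((u_down z + u_up z) * ((\<integral>y. f y \<partial>mid_law) - f (snd z))) +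
    \<epsilon>' * (u_mid z * ((\<integral>y. f y \<partial>down_law) +
      (snd z - m_down) / (m_up - m_down) * ((\<integral>y. f y \<partial>up_law) - (\<integral>y. f y \<partial>down_law)) - f (snd z)))"
proof (cases "u_mid z = 0")
  case False
  then have "s < fst z" "p < snd z" "snd z < q"
    by (auto simp: u_mid_nonzero)
  moreover have "(snd z - m_down) / (m_up - m_down) = tau (snd z)"
    using calculation by (simp add: tau_mid)
  ultimately show ?thesis
    using u_disjoint[OF False] by (simp add: w_def \<rho>_def integral_spread algebra_simps)
next
  case True
  show ?thesis
  proof (cases "u_down z + u_up z = 0")
    case False
    then have "fst z \<le> s"
      using u_nonzero[of z] by fastforce
    then show ?thesis
      using True by (simp add: w_def \<rho>_def)
  next
    case z: True
    then show ?thesis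
      using True unfolding w_def z by simp
  qed
qed

text \<open>The second marginal does not change.\<close>

lemma swap_balanced:
  "integrable \<pi> (\<lambda>z. w z * ((\<integral>y. f y \<partial>\<rho> z) - f (snd z)))"
  "(\<integral>z. w z * ((\<integral>y. f y \<partial>\<rho> z) - f (snd z)) \<partial>\<pi>) = 0"
proof -
  let ?b = "\<integral>y. f y \<partial>mid_law" and ?d = "\<integral>y. f y \<partial>down_law" and ?u = "\<integral>y. f y \<partial>up_law"
  \<comment> \<open>The slope of the affine function taking the value ?d at m_down and ?u at
    m_up.\<close>
  define k where "k = (?u - ?d) / (m_up - m_down)"
  have k: "a / (m_up - m_down) * (?u - ?d) = a * k" for a
    by (simp add: k_def)
  have fs: "(\<lambda>z. f (snd z)) \<in> borel_measurable (borel :: (real \<times> real) measure)"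
    by (rule measurable_compose[OF borel_measurable_snd_borel f])
  note i = integrable_u_mult[OF fs C, simplified]
  have b: "\<bar>snd z\<bar> \<le> R" if "\<bar>snd z\<bar> \<le> R" for z :: "real \<times> real"
    by (rule that)
  note j = integrable_u_mult[OF borel_measurable_snd_borel b]
  have eq: "w z * ((\<integral>y. f y \<partial>\<rho> z) - f (snd z)) =
      \<epsilon> * (?b * u_down z + ?b * u_up z - u_down z * f (snd z) - u_up z * f (snd z)) +
      \<epsilon>' * ((?d - m_down * k) * u_mid z + k * (u_mid z * snd z) - u_mid z * f (snd z))" for z
    unfolding swap_change k by (simp add: algebra_simps)
  have int: "integrable \<pi> (\<lambda>z. \<epsilon> * (?b * u_down z + ?b * u_up z - u_down z * f (snd z) - u_up z * f (snd z)))"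
    "integrable \<pi> (\<lambda>z. \<epsilon>' * ((?d - m_down * k) * u_mid z + k * (u_mid z * snd z) - u_mid z * f (snd z)))"
    using i j integrable_u integrable_u_mid by simp_all
  show "integrable \<pi> (\<lambda>z. w z * ((\<integral>y. f y \<partial>\<rho> z) - f (snd z)))"
    unfolding eq by (rule Bochner_Integration.integrable_add[OF int])
  have vals: "(\<integral>z. u_mid z * snd z \<partial>\<pi>) = m * t_mid" "(\<integral>z. u_mid z * f (snd z) \<partial>\<pi>) = ?b * t_mid"
    "(\<integral>z. u_down z * f (snd z) \<partial>\<pi>) = ?d * t_down" "(\<integral>z. u_up z * f (snd z) \<partial>\<pi>) = ?u * t_up"
    using integral_u_mid_pos integral_u_outer_pos f
    by (simp_all add: m_def integral_mid_law integral_down_law integral_up_law)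
  have "(\<integral>z. w z * ((\<integral>y. f y \<partial>\<rho> z) - f (snd z)) \<partial>\<pi>)
      = \<epsilon> * (?b * t_down + ?b * t_up - ?d * t_down - ?u * t_up)
        + \<epsilon>' * ((?d - m_down * k) * t_mid + k * (m * t_mid) - ?b * t_mid)"
    unfolding eq using int i j integrable_u integrable_u_mid by (simp add: vals)
  also have "\<epsilon>' * ((?d - m_down * k) * t_mid + k * (m * t_mid) - ?b * t_mid) = \<epsilon>' * t_mid * (?d + k * (m - m_down) - ?b)"
    by (simp add: algebra_simps)
  \<comment> \<open>Balance of mass: as much leaves the middle as leaves the outer pieces.\<close>
  also have "\<epsilon>' * t_mid = \<epsilon> * T"
    using integral_u_mid_pos by (simp add: \<epsilon>'_def)
  also have "\<epsilon> * T * (?d + k * (m - m_down) - ?b) = \<epsilon> * (T * ?d + k * (T * (m - m_down)) - T * ?b)"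
    by (simp add: algebra_simps)
  \<comment> \<open>The lever rule contained in \<open>outer_mean\<close>: the middle mass is sent
    upwards in exactly the share t_up / T in which the outer mass was taken from above.\<close>
  also have "T * (m - m_down) = t_up * (m_up - m_down)"
    using outer_mean by (simp add: T_def algebra_simps)
  also have "k * (t_up * (m_up - m_down)) = t_up * (?u - ?d)"
    using m_down_less_up by (simp add: k_def)
  also have "\<epsilon> * (?b * t_down + ?b * t_up - ?d * t_down - ?u * t_up) + \<epsilon> * (T * ?d + t_up * (?u - ?d) - T * ?b) = 0"
    by (simp add: T_def algebra_simps)
  finally show "(\<integral>z. w z * ((\<integral>y. f y \<partial>\<rho> z) - f (snd z)) \<partial>\<pi>) = 0" .
qed

end

lemma snd_marginal_reroute: "distr (semidirect \<mu> (reroute \<kappa> w \<rho>)) borel snd = \<nu>"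
proof (rule measure_eqI)
  interpret r: kernel \<mu> "reroute \<kappa> w \<rho>" by (rule rr.kernel_reroute)
  interpret r: prob_space "semidirect \<mu> (reroute \<kappa> w \<rho>)" by (rule r.prob_semidirect)
  show "sets (distr (semidirect \<mu> (reroute \<kappa> w \<rho>)) borel snd) = sets \<nu>"
    by (simp add: sets_nu)
  fix A assume "A \<in> sets (distr (semidirect \<mu> (reroute \<kappa> w \<rho>)) borel snd)"
  then have A [measurable]: "A \<in> sets borel" by simp
  let ?f = "indicator A :: real \<Rightarrow> real"
  have fm: "?f \<in> borel_measurable borel" by simp
  have fb: "\<bar>?f y\<bar> \<le> 1" for y
    by (auto split: split_indicator)
  have fs: "(\<lambda>z. ?f (snd z)) \<in> borel_measurable (borel :: (real \<times> real) measure)"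
    by simp
  have i: "integrable \<pi> (\<lambda>z. ?f (snd z))"
    using fb by (intro pi.integrable_const_bound[of _ 1]) (auto simp: measurable_cong_sets[OF sets_semidirect refl])
  have *: "integrable (\<rho> (x, y)) (\<lambda>y'. ?f (snd (x, y'))) \<and> (\<integral>y'. \<bar>?f (snd (x, y'))\<bar> \<partial>\<rho> (x, y)) \<le> 1" for x y
    using integrable_rho[OF fm fb] by simp
  have eqA: "measure (distr M borel snd) A = (\<integral>z. ?f (snd z) \<partial>M)" if "sets M = sets borel" for M :: "(real \<times> real) measure"
  proof -
    have "(\<integral>z. ?f (snd z) \<partial>M) = (\<integral>y. ?f y \<partial>distr M borel snd)"
      by (rule integral_distr[symmetric]) (simp_all add: measurable_cong_sets[OF that refl])
    then show ?thesis by simp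
  qed
  have "measure (distr (semidirect \<mu> (reroute \<kappa> w \<rho>)) borel snd) A = (\<integral>z. ?f (snd z) \<partial>semidirect \<mu> (reroute \<kappa> w \<rho>))"
    by (rule eqA) simp
  also have "\<dots> = (\<integral>z. ?f (snd z) \<partial>\<pi>) + (\<integral>(x, y). w (x, y) * ((\<integral>y'. ?f (snd (x, y')) \<partial>\<rho> (x, y)) - ?f (snd (x, y))) \<partial>\<pi>)"
    by (rule rr.integral_semidirect_reroute[OF i *])
  also have "(\<integral>(x, y). w (x, y) * ((\<integral>y'. ?f (snd (x, y')) \<partial>\<rho> (x, y)) - ?f (snd (x, y))) \<partial>\<pi>) = 0"
    using swap_balanced(2)[OF fm fb] by (simp add: case_prod_beta')
  also have "(\<integral>z. ?f (snd z) \<partial>\<pi>) + 0 = measure \<nu> A"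
    using eqA[of \<pi>] by (simp add: snd_marginal)
  finally show "emeasure (distr (semidirect \<mu> (reroute \<kappa> w \<rho>)) borel snd) A = emeasure \<nu> A"
    using real_distribution_nu r.prob_space_distr[of snd borel]
    by (simp add: finite_measure.emeasure_eq_measure prob_space_def real_distribution_def)
qed

lemma martingale_reroute:
  "AE x in \<mu>. integrable (reroute \<kappa> w \<rho> x) (\<lambda>y. y) \<and> (\<integral>y. y \<partial>reroute \<kappa> w \<rho> x) = x"
  using martingale
proof eventually_elim
  case (elim x)
  have b: "\<bar>y\<bar> \<le> R \<Longrightarrow> \<bar>y\<bar> \<le> R" for y :: real .
  have fm: "(\<lambda>y :: real. y) \<in> borel_measurable borel" by simp
  have *: "integrable (\<rho> (x, y)) (\<lambda>y. y) \<and> (\<integral>y. \<bar>y\<bar> \<partial>\<rho> (x, y)) \<le> R" for y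
    using integrable_rho[OF fm b] by simp
  \<comment> \<open>For the identity function the middle term is zero, since the spread law has mean
    y; only the outer term remains, and it integrates to zero over the fibre.\<close>
  have "w (x, y) * ((\<integral>y'. y' \<partial>\<rho> (x, y)) - y) = \<epsilon> * ((u_down (x, y) + u_up (x, y)) * (1 * (m - y)))" for y
    using swap_change[OF fm b, of "(x, y)"] m_down_less_up
    by (simp add: mid_law_mean m_down_def[symmetric] m_up_def[symmetric])
  then have "(\<integral>y. w (x, y) * ((\<integral>y'. y' \<partial>\<rho> (x, y)) - y) \<partial>\<kappa> x) = \<epsilon> * 0"
    by (simp only: integral_mult_right_zero outer_barycentre_fibre)
  then show ?case
    using rr.integrable_reroute[of x "\<lambda>y. y" R] rr.integral_reroute[of x "\<lambda>y. y" R] * elim by simp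
qed

lemma martingale_kernel_reroute: "martingale_kernel \<mu> \<nu> (reroute \<kappa> w \<rho>)"
  by (intro martingale_kernel.intro martingale_kernel_axioms.intro rr.kernel_reroute snd_marginal_reroute martingale_reroute)

end

section \<open>The change of cost under the exchange\<close>

lemma chord:
  fixes g :: "real \<Rightarrow> real"
  assumes g: "\<And>a b c. a < b \<Longrightarrow> b < c \<Longrightarrow> (g b - g a) * (c - b) < (g c - g b) * (b - a)" and pq: "p < q"
  shows chord_inside: "p < y \<Longrightarrow> y < q \<Longrightarrow> g y < g p + (g q - g p) / (q - p) * (y - p)"
    and chord_outside: "y < p \<or> q < y \<Longrightarrow> g p + (g q - g p) / (q - p) * (y - p) < g y"
proof -
  \<comment> \<open>With the chord over the common denominator q - p, each claim becomes the
    three-point convexity inequality for y, p, q in increasing order.\<close>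
  have e: "g p + (g q - g p) / (q - p) * (y - p) = (g p * (q - y) + g q * (y - p)) / (q - p)"
    using pq by (simp add: field_simps)
  show "g y < g p + (g q - g p) / (q - p) * (y - p)" if "p < y" "y < q"
    unfolding e using g[OF that] pq by (simp add: pos_less_divide_eq algebra_simps)
  show "g p + (g q - g p) / (q - p) * (y - p) < g y" if "y < p \<or> q < y"
    using that
  proof
    assume "y < p"
    from g[OF this pq] show ?thesis
      unfolding e using pq by (simp add: pos_divide_less_eq algebra_simps)
  next
    assume "q < y"
    from g[OF pq this] show ?thesis
      unfolding e using pq by (simp add: pos_divide_less_eq algebra_simps)
  qed
qed

text \<open>The condition \<open>c\<^sub>x\<^sub>y\<^sub>y < 0\<close> in difference form: \<open>c x - c x'\<close> is strictly convex for \<open>x < x'\<close>.\<close>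

locale spread_averse_cost =
  fixes c :: "real \<Rightarrow> real \<Rightarrow> real"
  assumes c_cont: "continuous_on UNIV (\<lambda>z. c (fst z) (snd z))"
    and convex_difference: "\<And>x x' y1 y2 y3. x < x' \<Longrightarrow> y1 < y2 \<Longrightarrow> y2 < y3 \<Longrightarrow>
      ((c x y2 - c x' y2) - (c x y1 - c x' y1)) * (y3 - y2) < ((c x y3 - c x' y3) - (c x y2 - c x' y2)) * (y2 - y1)"

locale swap_cost = swap + spread_averse_cost +
  assumes integrable_c: "integrable (semidirect \<mu> \<kappa>) (\<lambda>(x, y). c x y)"
begin

lemma c_measurable: "(\<lambda>z. c (fst z) (snd z)) \<in> borel_measurable borel"
  using c_cont by (rule borel_measurable_continuous_onI)

lemma c_fibre_measurable: "c x \<in> borel_measurable borel"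
proof -
  have "(\<lambda>y. c (fst (x, y)) (snd (x, y))) \<in> borel_measurable borel"
    by (rule measurable_compose[OF _ c_measurable]) (simp flip: borel_prod)
  then show ?thesis by simp
qed

definition K :: real where
  "K = (SOME K. \<forall>x y. \<bar>x\<bar> \<le> R \<longrightarrow> \<bar>y\<bar> \<le> R \<longrightarrow> \<bar>c x y\<bar> \<le> K)"

lemma c_bound: "\<bar>x\<bar> \<le> R \<Longrightarrow> \<bar>y\<bar> \<le> R \<Longrightarrow> \<bar>c x y\<bar> \<le> K"
proof -
  have "compact ({- R..R} \<times> {- R..R})"
    by (intro compact_Times) auto
  then have "compact ((\<lambda>z. c (fst z) (snd z)) ` ({- R..R} \<times> {- R..R}))"
    by (intro compact_continuous_image continuous_on_subset[OF c_cont]) auto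
  then obtain B where B: "\<And>v. v \<in> (\<lambda>z. c (fst z) (snd z)) ` ({- R..R} \<times> {- R..R}) \<Longrightarrow> norm v \<le> B"
    using compact_imp_bounded bounded_iff by metis
  have "\<bar>c x y\<bar> \<le> B" if "\<bar>x\<bar> \<le> R" "\<bar>y\<bar> \<le> R" for x y
    using B[of "c x y"] that by force
  then have "\<exists>K. \<forall>x y. \<bar>x\<bar> \<le> R \<longrightarrow> \<bar>y\<bar> \<le> R \<longrightarrow> \<bar>c x y\<bar> \<le> K" by blast
  from someI_ex[OF this, folded K_def] show "\<bar>x\<bar> \<le> R \<Longrightarrow> \<bar>y\<bar> \<le> R \<Longrightarrow> \<bar>c x y\<bar> \<le> K"
    by blast
qed

text \<open>The term c s y depends on y alone, so by \<open>swap_balanced\<close> its total does not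
  change in the exchange. Subtracting it leaves a function with opposite curvature on the two sides
  of s.\<close>

definition \<phi> :: "real \<Rightarrow> real \<Rightarrow> real" where
  "\<phi> x y = c x y - c s y"

definition \<sigma> :: "real \<Rightarrow> real" where
  "\<sigma> x = (\<phi> x q - \<phi> x p) / (q - p)"

lemma sigma_measurable: "\<sigma> \<in> borel_measurable borel"
proof -
  have "(\<lambda>x. c x y) \<in> borel_measurable borel" for y
  proof -
    have "(\<lambda>x. c (fst (x, y)) (snd (x, y))) \<in> borel_measurable borel"
      by (rule measurable_compose[OF _ c_measurable]) (simp flip: borel_prod)
    then show ?thesis by simp
  qed
  then show ?thesis
    unfolding \<sigma>_def[abs_def] \<phi>_def by measurable
qed

lemma phi_bound: "\<bar>x\<bar> \<le> R \<Longrightarrow> \<bar>y\<bar> \<le> R \<Longrightarrow> \<bar>\<phi> x y\<bar> \<le> 2 * K"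
  using c_bound[of x y] c_bound[of s y] R(3) by (simp add: \<phi>_def)

lemma sigma_bound: "\<bar>x\<bar> \<le> R \<Longrightarrow> \<bar>\<sigma> x\<bar> \<le> 4 * K / (q - p)"
proof -
  assume "\<bar>x\<bar> \<le> R"
  then have "\<bar>\<phi> x q - \<phi> x p\<bar> \<le> 4 * K"
    using phi_bound[of x q] phi_bound[of x p] R by simp
  then show ?thesis
    using pq by (simp add: \<sigma>_def divide_right_mono)
qed

text \<open>The inequalities are weak because \<phi> s vanishes identically. Strict improvement has
  to come from the mass over x > s.\<close>

lemma phi_low:
  assumes "x \<le> s"
  shows "p < y \<Longrightarrow> y < q \<Longrightarrow> \<phi> x y \<le> \<phi> x p + \<sigma> x * (y - p)"
    and "y < p \<or> q < y \<Longrightarrow> \<phi> x p + \<sigma> x * (y - p) \<le> \<phi> x y"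
proof -
  have "(p < y \<longrightarrow> y < q \<longrightarrow> \<phi> x y \<le> \<phi> x p + \<sigma> x * (y - p)) \<and> (y < p \<or> q < y \<longrightarrow> \<phi> x p + \<sigma> x * (y - p) \<le> \<phi> x y)"
  proof (cases "x = s")
    case True
    then show ?thesis by (simp add: \<phi>_def \<sigma>_def)
  next
    case False
    with assms have "x < s" by simp
    from chord_inside[of "\<phi> x", OF convex_difference[OF this, folded \<phi>_def] pq]
      chord_outside[of "\<phi> x", OF convex_difference[OF this, folded \<phi>_def] pq]
    show ?thesis
      unfolding \<sigma>_def by (auto intro: less_imp_le)
  qed
  then show "p < y \<Longrightarrow> y < q \<Longrightarrow> \<phi> x y \<le> \<phi> x p + \<sigma> x * (y - p)"
    "y < p \<or> q < y \<Longrightarrow> \<phi> x p + \<sigma> x * (y - p) \<le> \<phi> x y" by auto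
qed

lemma phi_high:
  assumes "s < x"
  shows "p < y \<Longrightarrow> y < q \<Longrightarrow> \<phi> x p + \<sigma> x * (y - p) < \<phi> x y"
    and "y < p \<or> q < y \<Longrightarrow> \<phi> x y \<le> \<phi> x p + \<sigma> x * (y - p)"
proof -
  have n: "c s y - c x y = - \<phi> x y" for y
    by (simp add: \<phi>_def)
  have e: "- \<phi> x p + (- \<phi> x q - - \<phi> x p) / (q - p) * (y - p) = - (\<phi> x p + \<sigma> x * (y - p))" for y
  proof -
    have "- \<phi> x q - - \<phi> x p = - (\<phi> x q - \<phi> x p)" by simp
    then have "(- \<phi> x q - - \<phi> x p) / (q - p) = - \<sigma> x"
      by (simp only: \<sigma>_def minus_divide_left)
    then show ?thesis
      by simp
  qed
  note * = convex_difference[OF assms, unfolded n]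
  show "\<phi> x p + \<sigma> x * (y - p) < \<phi> x y" if "p < y" "y < q"
    using chord_inside[of "\<lambda>y. - \<phi> x y", OF * pq that] unfolding e by simp
  show "\<phi> x y \<le> \<phi> x p + \<sigma> x * (y - p)" if "y < p \<or> q < y"
    using chord_outside[of "\<lambda>y. - \<phi> x y", OF * pq that] unfolding e by simp
qed

lemma phi_fibre_measurable: "\<phi> x \<in> borel_measurable borel"
  unfolding \<phi>_def[abs_def] using c_fibre_measurable[of x] c_fibre_measurable[of s] by measurable

lemma integral_line:
  fixes M :: "real measure" and a b :: real
  assumes "M \<in> space (prob_algebra borel)" "integrable M (\<lambda>y. y)"
  shows "integrable M (\<lambda>y. a + b * (y - p))" "(\<integral>y. a + b * (y - p) \<partial>M) = a + b * ((\<integral>y. y \<partial>M) - p)"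
proof -
  interpret prob_space M using assms(1) by (simp add: space_prob_algebra)
  show "integrable M (\<lambda>y. a + b * (y - p))" "(\<integral>y. a + b * (y - p) \<partial>M) = a + b * ((\<integral>y. y \<partial>M) - p)"
    using assms(2) by (simp_all add: prob_space)
qed

text \<open>Both terms are compared with the chord of \<phi> x over [p, q]: \<open>mid_law\<close>
  lives inside, where \<phi> x is below the chord, and y lies outside, where it is above. Replacing
  y by a law of mean m changes the chord's value by its slope times m - y.\<close>

lemma fibre_low:
  assumes x: "\<bar>x\<bar> \<le> R" "x \<le> s" and y: "y < p \<or> q < y"
  shows "(\<integral>y. \<phi> x y \<partial>mid_law) - \<phi> x y \<le> \<sigma> x * (m - y)"
proof -
  note L = integral_line[OF mid_law_in mid_law_mean(1), of "\<phi> x p" "\<sigma> x"]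
  have "(\<integral>y. \<phi> x y \<partial>mid_law) \<le> (\<integral>y. \<phi> x p + \<sigma> x * (y - p) \<partial>mid_law)"
  proof (rule integral_mono_AE)
    show "integrable mid_law (\<phi> x)"
      by (rule integrable_laws(1)[OF phi_fibre_measurable phi_bound[OF x(1)]])
    show "AE y in mid_law. \<phi> x y \<le> \<phi> x p + \<sigma> x * (y - p)"
      using AE_mid by eventually_elim (use phi_low(1)[OF x(2)] in auto)
  qed (rule L(1))
  also have "\<dots> = \<phi> x p + \<sigma> x * (m - p)"
    using L(2) by (simp add: mid_law_mean)
  finally show ?thesis
    using phi_low(2)[OF x(2) y] by (simp add: algebra_simps)
qed

text \<open>The mirror image of the low case: the spread law lives outside [p, q], where \<phi> x is
  below its chord, and has mean y, so the chord's value is kept; at y itself \<phi> x is strictly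
  above.\<close>

lemma fibre_high:
  assumes x: "\<bar>x\<bar> \<le> R" "s < x" and y: "p < y" "y < q"
  shows "(\<integral>y. \<phi> x y \<partial>spread_law y) < \<phi> x y"
proof -
  note i = integrable_laws[OF phi_fibre_measurable phi_bound[OF x(1)]]
  note L1 = integral_line[OF down_law_in integrable_id_laws(1), of "\<phi> x p" "\<sigma> x"]
  note L2 = integral_line[OF up_law_in integrable_id_laws(2), of "\<phi> x p" "\<sigma> x"]
  have "(\<integral>y. \<phi> x y \<partial>down_law) \<le> (\<integral>y. \<phi> x p + \<sigma> x * (y - p) \<partial>down_law)"
  proof (rule integral_mono_AE[OF i(2) L1(1)])
    show "AE y in down_law. \<phi> x y \<le> \<phi> x p + \<sigma> x * (y - p)"
      using AE_down by eventually_elim (use phi_high(2)[OF x(2)] in auto)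
  qed
  then have d: "(\<integral>y. \<phi> x y \<partial>down_law) \<le> \<phi> x p + \<sigma> x * (m_down - p)"
    using L1(2) by (simp add: m_down_def)
  have "(\<integral>y. \<phi> x y \<partial>up_law) \<le> (\<integral>y. \<phi> x p + \<sigma> x * (y - p) \<partial>up_law)"
  proof (rule integral_mono_AE[OF i(3) L2(1)])
    show "AE y in up_law. \<phi> x y \<le> \<phi> x p + \<sigma> x * (y - p)"
      using AE_up by eventually_elim (use phi_high(2)[OF x(2)] in auto)
  qed
  then have u: "(\<integral>y. \<phi> x y \<partial>up_law) \<le> \<phi> x p + \<sigma> x * (m_up - p)"
    using L2(2) by (simp add: m_up_def)
  have "(\<integral>y. \<phi> x y \<partial>spread_law y) = (1 - tau y) * (\<integral>y. \<phi> x y \<partial>down_law) + tau y * (\<integral>y. \<phi> x y \<partial>up_law)"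
    by (rule integral_spread[OF phi_fibre_measurable phi_bound[OF x(1)]])
  also have "\<dots> \<le> (1 - tau y) * (\<phi> x p + \<sigma> x * (m_down - p)) + tau y * (\<phi> x p + \<sigma> x * (m_up - p))"
    using d u tau_bounds[of y] by (intro add_mono mult_left_mono) auto
  also have "\<dots> = \<phi> x p + \<sigma> x * (m_down - p) + \<sigma> x * (tau y * (m_up - m_down))"
    by (simp add: algebra_simps)
  also have "tau y * (m_up - m_down) = y - m_down"
    using m_down_less_up by (simp add: tau_mid[OF y])
  also have "\<phi> x p + \<sigma> x * (m_down - p) + \<sigma> x * (y - m_down) = \<phi> x p + \<sigma> x * (y - p)"
    by (simp add: algebra_simps)
  also have "\<dots> < \<phi> x y"
    by (rule phi_high(1)[OF x(2) y])
  finally show ?thesis .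
qed

definition \<Delta> :: "real \<times> real \<Rightarrow> real" where
  "\<Delta> z = w z * ((\<integral>y'. c (fst z) y' \<partial>\<rho> z) - c (fst z) (snd z))"

text \<open>A majorant of \<Delta> with integral zero: the first term vanishes by
  \<open>swap_balanced\<close> for c s, the second by \<open>outer_barycentre\<close> for the slopes
  \<sigma>.\<close>

definition \<Delta>\<^sub>0 :: "real \<times> real \<Rightarrow> real" where
  "\<Delta>\<^sub>0 z = w z * ((\<integral>y'. c s y' \<partial>\<rho> z) - c s (snd z)) + \<epsilon> * ((u_down z + u_up z) * (\<sigma> (fst z) * (m - snd z)))"

lemma w_nonzero: "w z \<noteq> 0 \<Longrightarrow> \<bar>fst z\<bar> \<le> R \<and> \<bar>snd z\<bar> \<le> R"
proof -
  assume "w z \<noteq> 0"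
  then have "u_mid z \<noteq> 0 \<or> u_down z \<noteq> 0 \<or> u_up z \<noteq> 0"
    by (auto simp: w_def)
  then show ?thesis
    using u_nonzero[of z] R by (auto simp: u_mid_nonzero)
qed

lemma rho_c: "\<bar>x\<bar> \<le> R \<Longrightarrow> integrable (\<rho> z) (c x) \<and> (\<integral>y'. \<bar>c x y'\<bar> \<partial>\<rho> z) \<le> K"
  using integrable_rho[OF c_fibre_measurable c_bound] by blast

lemma Delta_le: "\<Delta> z \<le> \<Delta>\<^sub>0 z" and Delta_less: "u_mid z \<noteq> 0 \<Longrightarrow> \<Delta> z < \<Delta>\<^sub>0 z"
proof -
  have split: "\<Delta> z = w z * ((\<integral>y'. c s y' \<partial>\<rho> z) - c s (snd z)) + w z * ((\<integral>y'. \<phi> (fst z) y' \<partial>\<rho> z) - \<phi> (fst z) (snd z))"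
  proof (cases "w z = 0")
    case False
    have "integrable (\<rho> z) (c (fst z))" "integrable (\<rho> z) (c s)"
      using rho_c w_nonzero[OF False] R(3) by (auto simp: less_imp_le)
    then show ?thesis
      by (simp add: \<Delta>_def \<phi>_def algebra_simps)
  qed (simp add: \<Delta>_def)
  have mid: "\<Delta> z < \<Delta>\<^sub>0 z" if "u_mid z \<noteq> 0"
  proof -
    have z: "\<bar>fst z\<bar> \<le> R" "s < fst z" "p < snd z" "snd z < q"
      using that R by (auto simp: u_mid_nonzero)
    have r: "\<rho> z = spread_law (snd z)"
      using z by (simp add: \<rho>_def)
    have u0: "u_down z + u_up z = 0"
      using u_disjoint[OF that] by simp
    have "0 < w z"
      using that u0 eps u_mid_bounds[of z] by (simp add: w_def less_le)
    then have "w z * ((\<integral>y'. \<phi> (fst z) y' \<partial>\<rho> z) - \<phi> (fst z) (snd z)) < 0"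
      using fibre_high[OF z] by (simp add: r mult_pos_neg)
    then show ?thesis
      unfolding split \<Delta>\<^sub>0_def u0 by simp
  qed
  then show "u_mid z \<noteq> 0 \<Longrightarrow> \<Delta> z < \<Delta>\<^sub>0 z" .
  show "\<Delta> z \<le> \<Delta>\<^sub>0 z"
  proof (cases "u_mid z = 0")
    case True
    show ?thesis
    proof (cases "u_down z + u_up z = 0")
      case z: True
      then have "w z = 0"
        unfolding w_def True z by simp
      then show ?thesis
        unfolding split \<Delta>\<^sub>0_def z by simp
    next
      case False
      then have "u_down z \<noteq> 0 \<or> u_up z \<noteq> 0" by auto
      then have z: "\<bar>fst z\<bar> \<le> R" "fst z \<le> s" "snd z < p \<or> q < snd z"
        using u_nonzero[of z] R by auto
      have r: "\<rho> z = mid_law"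
        using z by (simp add: \<rho>_def)
      have w: "w z = \<epsilon> * (u_down z + u_up z)"
        by (simp add: w_def True)
      have "w z * ((\<integral>y'. \<phi> (fst z) y' \<partial>\<rho> z) - \<phi> (fst z) (snd z)) \<le> w z * (\<sigma> (fst z) * (m - snd z))"
        unfolding r by (rule mult_left_mono[OF fibre_low[OF z] w_bounds(1)])
      then show ?thesis
        unfolding split \<Delta>\<^sub>0_def by (simp add: w mult.assoc)
    qed
  qed (use mid in \<open>simp add: less_imp_le\<close>)
qed

text \<open>The change of cost is the integral of \<Delta>, which lies below a function of integral
  zero. Equality would force u_mid = 0 almost everywhere, contradicting the positive mass assumed in
  the middle.\<close>

lemma improvement:
  "martingale_kernel \<mu> \<nu> (reroute \<kappa> w \<rho>)"
  "integrable (semidirect \<mu> (reroute \<kappa> w \<rho>)) (\<lambda>(x, y). c x y)"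
  "(\<integral>(x, y). c x y \<partial>semidirect \<mu> (reroute \<kappa> w \<rho>)) < (\<integral>(x, y). c x y \<partial>semidirect \<mu> \<kappa>)"
proof -
  show "martingale_kernel \<mu> \<nu> (reroute \<kappa> w \<rho>)"
    by (rule martingale_kernel_reroute)
  have *: "integrable (\<rho> (x, y)) (\<lambda>y'. (\<lambda>(x, y). c x y) (x, y')) \<and> (\<integral>y'. \<bar>(\<lambda>(x, y). c x y) (x, y')\<bar> \<partial>\<rho> (x, y)) \<le> K"
    if "w (x, y) \<noteq> 0" for x y
    using rho_c[of x "(x, y)"] w_nonzero[OF that] by simp
  show "integrable (semidirect \<mu> (reroute \<kappa> w \<rho>)) (\<lambda>(x, y). c x y)"
    by (rule rr.integrable_semidirect_reroute[OF integrable_c *])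
  have iD: "integrable \<pi> \<Delta>"
    using rr.integrable_semidirect_change[OF integrable_c *] by (simp add: \<Delta>_def[abs_def] case_prod_beta')
  have cost: "(\<integral>(x, y). c x y \<partial>semidirect \<mu> (reroute \<kappa> w \<rho>)) = (\<integral>(x, y). c x y \<partial>\<pi>) + (\<integral>z. \<Delta> z \<partial>\<pi>)"
    using rr.integral_semidirect_reroute[OF integrable_c *] by (simp add: \<Delta>_def[abs_def] case_prod_beta')
  have s: "\<bar>s\<bar> \<le> R"
    using R(3) by simp
  note b = swap_balanced[OF c_fibre_measurable c_bound[OF s]]
  note o = outer_barycentre[OF sigma_measurable sigma_bound]
  have i0: "integrable \<pi> \<Delta>\<^sub>0" and e0: "(\<integral>z. \<Delta>\<^sub>0 z \<partial>\<pi>) = 0"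
    unfolding \<Delta>\<^sub>0_def using b o by simp_all
  have "(\<integral>z. \<Delta> z \<partial>\<pi>) \<le> (\<integral>z. \<Delta>\<^sub>0 z \<partial>\<pi>)"
    by (rule integral_mono[OF iD i0 Delta_le])
  moreover have "(\<integral>z. \<Delta> z \<partial>\<pi>) \<noteq> (\<integral>z. \<Delta>\<^sub>0 z \<partial>\<pi>)"
  proof
    assume "(\<integral>z. \<Delta> z \<partial>\<pi>) = (\<integral>z. \<Delta>\<^sub>0 z \<partial>\<pi>)"
    then have "(\<integral>z. \<Delta>\<^sub>0 z - \<Delta> z \<partial>\<pi>) = 0"
      using iD i0 by simp
    then have "AE z in \<pi>. \<Delta>\<^sub>0 z - \<Delta> z = 0"
      using iD i0 Delta_le by (subst (asm) integral_nonneg_eq_0_iff_AE) auto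
    then have "AE z in \<pi>. u_mid z = 0"
      by eventually_elim (use Delta_less in force)
    then have "t_mid = (\<integral>z. 0 \<partial>\<pi>)"
      by (intro integral_cong_AE) (auto simp: measurable_cong_sets[OF sets_semidirect refl])
    then show False
      using integral_u_mid_pos by simp
  qed
  ultimately show "(\<integral>(x, y). c x y \<partial>semidirect \<mu> (reroute \<kappa> w \<rho>)) < (\<integral>(x, y). c x y \<partial>\<pi>)"
    using cost e0 by simp
qed

end

section \<open>Left-monotonicity of minimizers\<close>

lemma eventually_measure_pos:
  assumes M: "finite_measure M" and A: "range A \<subseteq> sets M" "incseq A" and pos: "measure M (\<Union>i. A i) \<noteq> 0"
  shows "\<forall>\<^sub>F n in sequentially. measure M (A n) \<noteq> 0"
proof -
  have "(\<lambda>n. measure M (A n)) \<longlonglongrightarrow> measure M (\<Union>i. A i)"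
    using M A by (rule finite_measure.finite_Lim_measure_incseq)
  then have "\<forall>\<^sub>F n in sequentially. 0 < measure M (A n)"
    using pos by (intro order_tendstoD) (auto simp: less_le)
  then show ?thesis
    by eventually_elim simp
qed

lemma Un_bounded_intervals:
  "(\<Union>n. {- real n<..<p}) = {..<p}" "(\<Union>n. {q<..<real n}) = {q<..}"
proof -
  have "\<exists>n. - real n < y" for y
    using reals_Archimedean2[of "- y"] by (auto simp: minus_less_iff)
  then show "(\<Union>n. {- real n<..<p}) = {..<p}" by auto
  show "(\<Union>n. {q<..<real n}) = {q<..}"
    using reals_Archimedean2 by auto
qed

locale cost_minimizer = martingale_kernel \<mu> \<nu> \<kappa> + spread_averse_cost c for \<mu> \<nu> \<kappa> c +
  assumes integrable_c: "integrable (semidirect \<mu> \<kappa>) (\<lambda>(x, y). c x y)"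
    and minimal: "\<And>\<kappa>'. martingale_kernel \<mu> \<nu> \<kappa>' \<Longrightarrow> integrable (semidirect \<mu> \<kappa>') (\<lambda>(x, y). c x y) \<Longrightarrow>
      (\<integral>(x, y). c x y \<partial>semidirect \<mu> \<kappa>) \<le> (\<integral>(x, y). c x y \<partial>semidirect \<mu> \<kappa>')"
begin

text \<open>Were both alternatives to fail, continuity of measures from below would make the failure
  visible already inside a bounded square, and the exchange there would lower the minimal
  cost.\<close>

lemma no_swap:
  assumes pq: "p < q"
  shows "(AE x in \<mu>. x \<le> s \<longrightarrow> measure (\<kappa> x) {..<p} = 0 \<or> measure (\<kappa> x) {q<..} = 0) \<or>
    measure (semidirect \<mu> \<kappa>) ({s<..} \<times> {p<..<q}) = 0"
proof (rule ccontr)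
  interpret S: prob_space "semidirect \<mu> \<kappa>" by (rule prob_semidirect)
  assume "\<not> ?thesis"
  then have low: "\<not> (AE x in \<mu>. x \<le> s \<longrightarrow> measure (\<kappa> x) {..<p} = 0 \<or> measure (\<kappa> x) {q<..} = 0)"
    and high: "measure (semidirect \<mu> \<kappa>) ({s<..} \<times> {p<..<q}) \<noteq> 0"
    by auto
  have "(\<Union>n. {s<..<real n} \<times> {p<..<q}) = {s<..} \<times> {p<..<q}"
    using Un_bounded_intervals(2)[of s] by auto
  then have "\<forall>\<^sub>F n in sequentially. measure (semidirect \<mu> \<kappa>) ({s<..<real n} \<times> {p<..<q}) \<noteq> 0"
    using high by (intro eventually_measure_pos S.finite_measure_axioms) (auto simp: incseq_def borel_Times)
  moreover have "\<forall>\<^sub>F n in sequentially. \<bar>p\<bar> < real n" "\<forall>\<^sub>F n in sequentially. \<bar>q\<bar> < real n" "\<forall>\<^sub>F n in sequentially. \<bar>s\<bar> < real n"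
    using filterlim_real_sequentially by (simp_all add: filterlim_at_top_dense)
  ultimately have "\<forall>\<^sub>F n in sequentially. measure (semidirect \<mu> \<kappa>) ({s<..<real n} \<times> {p<..<q}) \<noteq> 0 \<and>
      \<bar>p\<bar> < real n \<and> \<bar>q\<bar> < real n \<and> \<bar>s\<bar> < real n"
    by eventually_elim auto
  then obtain N where N: "\<And>n. N \<le> n \<Longrightarrow> measure (semidirect \<mu> \<kappa>) ({s<..<real n} \<times> {p<..<q}) \<noteq> 0 \<and>
      \<bar>p\<bar> < real n \<and> \<bar>q\<bar> < real n \<and> \<bar>s\<bar> < real n"
    by (auto simp: eventually_sequentially)
  \<comment> \<open>The cut-off that works in a fibre depends on x. If no single n worked, the
    countably many null sets could be united, and in each remaining fibre a large enough n would
    give the contradiction.\<close>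
  have "\<exists>n\<ge>N. \<not> (AE x in \<mu>. - real n < x \<and> x \<le> s \<longrightarrow> measure (\<kappa> x) {- real n<..<p} = 0 \<or> measure (\<kappa> x) {q<..<real n} = 0)"
  proof (rule ccontr)
    assume "\<not> ?thesis"
    then have "AE x in \<mu>. \<forall>n. N \<le> n \<longrightarrow> - real n < x \<and> x \<le> s \<longrightarrow> measure (\<kappa> x) {- real n<..<p} = 0 \<or> measure (\<kappa> x) {q<..<real n} = 0"
      by (subst AE_all_countable) auto
    then have "AE x in \<mu>. x \<le> s \<longrightarrow> measure (\<kappa> x) {..<p} = 0 \<or> measure (\<kappa> x) {q<..} = 0"
    proof eventually_elim
      case (elim x)
      interpret kx: prob_space "\<kappa> x" by (rule prob_kernel)
      show ?case
      proof (rule impI, rule ccontr)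
        assume x: "x \<le> s" and *: "\<not> (measure (\<kappa> x) {..<p} = 0 \<or> measure (\<kappa> x) {q<..} = 0)"
        have "\<forall>\<^sub>F n in sequentially. measure (\<kappa> x) {- real n<..<p} \<noteq> 0"
          using * by (intro eventually_measure_pos kx.finite_measure_axioms) (auto simp: incseq_def Un_bounded_intervals)
        moreover have "\<forall>\<^sub>F n in sequentially. measure (\<kappa> x) {q<..<real n} \<noteq> 0"
          using * by (intro eventually_measure_pos kx.finite_measure_axioms) (auto simp: incseq_def Un_bounded_intervals)
        moreover have "\<forall>\<^sub>F n in sequentially. - x < real n"
          using filterlim_real_sequentially by (simp add: filterlim_at_top_dense)
        moreover have "\<forall>\<^sub>F n in sequentially. N \<le> n"
          by (rule eventually_ge_at_top)
        ultimately have "\<forall>\<^sub>F n in sequentially. False"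
        proof eventually_elim
          case (elim n)
          then have "- real n < x" by simp
          with elim x \<open>\<forall>n. N \<le> n \<longrightarrow> _ n\<close> show False by blast
        qed
        then show False by simp
      qed
    qed
    with low show False ..
  qed
  then obtain n where n: "N \<le> n" "\<not> (AE x in \<mu>. - real n < x \<and> x \<le> s \<longrightarrow> measure (\<kappa> x) {- real n<..<p} = 0 \<or> measure (\<kappa> x) {q<..<real n} = 0)"
    by blast
  interpret sw: swap_cost \<mu> \<nu> \<kappa> "real n" s p q c
    using n N[OF n(1)] pq integrable_c
    by unfold_locales (auto simp: less_le)
  show False
    using minimal[OF sw.improvement(1,2)] sw.improvement(3) by simp
qed

text \<open>The set \<Gamma> is cut out by rational conditions, each almost sure. A and B turn
  points of a fibre into positive mass on half-lines, D discards null rectangles, and E records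
  \<open>no_swap\<close>. In a forbidden configuration, rationals s, p, q between its points make
  the rectangle non-null by D, while A and B contradict E.\<close>

lemma left_monotone: "left_monotone (semidirect \<mu> \<kappa>)"
proof -
  interpret S: prob_space "semidirect \<mu> \<kappa>" by (rule prob_semidirect)
  define null where "null s p q \<longleftrightarrow> measure (semidirect \<mu> \<kappa>) ({s<..} \<times> {p<..<q}) = 0" for s p q :: real
  define A where "A z p \<longleftrightarrow> snd z < p \<longrightarrow> measure (\<kappa> (fst z)) {..<p} \<noteq> 0" for z :: "real \<times> real" and p
  define B where "B z q \<longleftrightarrow> q < snd z \<longrightarrow> measure (\<kappa> (fst z)) {q<..} \<noteq> 0" for z :: "real \<times> real" and q
  define D where "D z s p q \<longleftrightarrow> p < q \<and> null s p q \<longrightarrow> \<not> (s < fst z \<and> p < snd z \<and> snd z < q)" for z :: "real \<times> real" and s p q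
  define E where "E z s p q \<longleftrightarrow> p < q \<and> \<not> null s p q \<longrightarrow> fst z \<le> s \<longrightarrow> measure (\<kappa> (fst z)) {..<p} = 0 \<or> measure (\<kappa> (fst z)) {q<..} = 0"
    for z :: "real \<times> real" and s p q
  let ?r = real_of_rat
  \<comment> \<open>Real parameters would give uncountably many exceptional null sets. Rationals
    suffice since the forbidden inequalities are strict.\<close>
  define \<Gamma> where "\<Gamma> = {z. (\<forall>p. A z (?r p)) \<and> (\<forall>q. B z (?r q)) \<and> (\<forall>s p q. D z (?r s) (?r p) (?r q)) \<and> (\<forall>s p q. E z (?r s) (?r p) (?r q))}"
  have [measurable]: "(\<lambda>z. measure (\<kappa> (fst z)) X) \<in> borel_measurable (borel :: (real \<times> real) measure)" if "X \<in> sets borel" for X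
    using measurable_compose[OF borel_measurable_fst_borel measurable_compose[OF kernel measurable_measure_prob_algebra[OF that]]]
    by simp
  have mA: "Measurable.pred borel (\<lambda>z. A z p)" for p
    unfolding A_def by measurable
  have mB: "Measurable.pred borel (\<lambda>z. B z q)" for q
    unfolding B_def by measurable
  have mD: "Measurable.pred borel (\<lambda>z. D z s p q)" for s p q
    unfolding D_def by measurable
  have mE: "Measurable.pred borel (\<lambda>z. E z s p q)" for s p q
    unfolding E_def by measurable
  note [measurable] = mA mB mD mE
  have \<Gamma> [measurable]: "\<Gamma> \<in> sets borel"
  proof -
    have "Measurable.pred borel (\<lambda>z. z \<in> \<Gamma>)"
      unfolding \<Gamma>_def mem_Collect_eq by measurable
    then show ?thesis
      by (simp add: pred_def)
  qed
  have aA: "AE z in semidirect \<mu> \<kappa>. A z p" for p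
    unfolding AE_semidirect[OF mA]
  proof (rule AE_I2)
    fix x
    interpret kx: prob_space "\<kappa> x" by (rule prob_kernel)
    show "AE y in \<kappa> x. A (x, y) p"
    proof (cases "measure (\<kappa> x) {..<p} = 0")
      case True
      then have "AE y in \<kappa> x. y \<notin> {..<p}"
        by (subst (asm) kx.prob_eq_0) auto
      then show ?thesis
        by eventually_elim (simp add: A_def)
    qed (simp add: A_def)
  qed
  have aB: "AE z in semidirect \<mu> \<kappa>. B z q" for q
    unfolding AE_semidirect[OF mB]
  proof (rule AE_I2)
    fix x
    interpret kx: prob_space "\<kappa> x" by (rule prob_kernel)
    show "AE y in \<kappa> x. B (x, y) q"
    proof (cases "measure (\<kappa> x) {q<..} = 0")
      case True
      then have "AE y in \<kappa> x. y \<notin> {q<..}"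
        by (subst (asm) kx.prob_eq_0) auto
      then show ?thesis
        by eventually_elim (simp add: B_def)
    qed (simp add: B_def)
  qed
  have aD: "AE z in semidirect \<mu> \<kappa>. D z s p q" for s p q
  proof (cases "null s p q")
    case True
    then have "AE z in semidirect \<mu> \<kappa>. z \<notin> {s<..} \<times> {p<..<q}"
      unfolding null_def by (subst (asm) S.prob_eq_0) (auto simp: borel_Times)
    then show ?thesis
      by eventually_elim (auto simp: D_def)
  qed (simp add: D_def)
  have aE: "AE z in semidirect \<mu> \<kappa>. E z s p q" for s p q
    unfolding AE_semidirect[OF mE]
  proof (cases "p < q \<and> \<not> null s p q")
    case True
    then have "AE x in \<mu>. x \<le> s \<longrightarrow> measure (\<kappa> x) {..<p} = 0 \<or> measure (\<kappa> x) {q<..} = 0"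
      using no_swap[of p q s] by (auto simp: null_def)
    then show "AE x in \<mu>. AE y in \<kappa> x. E (x, y) s p q"
      by eventually_elim (auto simp: E_def)
  next
    case False
    then show "AE x in \<mu>. AE y in \<kappa> x. E (x, y) s p q"
      by (auto simp: E_def)
  qed
  have "AE z in semidirect \<mu> \<kappa>. z \<in> \<Gamma>"
    unfolding \<Gamma>_def mem_Collect_eq
    by (intro AE_conjI AE_all_countable[THEN iffD2] allI aA aB aD aE)
  then have full: "emeasure (semidirect \<mu> \<kappa>) \<Gamma> = 1"
    using S.AE_in_set_eq_1[of \<Gamma>] by (simp add: S.emeasure_eq_measure)
  have mono: "\<not> (x < x' \<and> ym < y' \<and> y' < yp)" if z: "(x, ym) \<in> \<Gamma>" "(x, yp) \<in> \<Gamma>" "(x', y') \<in> \<Gamma>" for x ym yp x' y'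
  proof
    assume "x < x' \<and> ym < y' \<and> y' < yp"
    then obtain s p q where s: "x < ?r s" "?r s < x'" and p: "ym < ?r p" "?r p < y'" and q: "y' < ?r q" "?r q < yp"
      using of_rat_dense by metis
    have "A (x, ym) (?r p)" "B (x, yp) (?r q)" "E (x, ym) (?r s) (?r p) (?r q)" "D (x', y') (?r s) (?r p) (?r q)"
      using z by (auto simp: \<Gamma>_def)
    then show False
      using s p q by (auto simp: A_def B_def D_def E_def simp del: of_rat_less)
  qed
  show ?thesis
    unfolding left_monotone_def using \<Gamma> full mono by blast
qed

end

section \<open>Difference costs with strictly convex derivative\<close>

lemma strictly_convex_increment_less:
  assumes f: "strictly_convex f" and "a < b" "0 < d"
  shows "f (a + d) - f a < f (b + d) - f b"
proof -
  \<comment> \<open>Both a + d and b lie strictly between a and b + d, with complementary weights t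
    and 1 - t. Adding the two convexity inequalities leaves f (a + d) + f b < f a + f (b +
    d).\<close>
  define t where "t = d / (b + d - a)"
  have t: "0 < t" "t < 1"
    using assms by (auto simp: t_def)
  have td: "t * (b + d - a) = d"
    using assms by (simp add: t_def)
  have 1: "(1 - t) * a + t * (b + d) = a + d" "(1 - (1 - t)) * a + (1 - t) * (b + d) = b"
    using td by (simp_all add: algebra_simps)
  have "f ((1 - t) * a + t * (b + d)) < (1 - t) * f a + t * f (b + d)"
    using f t assms unfolding strictly_convex_def by simp
  moreover have "f ((1 - (1 - t)) * a + (1 - t) * (b + d)) < (1 - (1 - t)) * f a + (1 - t) * f (b + d)"
  proof -
    have "a \<noteq> b + d" "0 < 1 - t" "1 - t < 1"
      using t assms by auto
    then show ?thesis
      using f unfolding strictly_convex_def by blast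
  qed
  ultimately show ?thesis
    unfolding 1 by (simp add: algebra_simps)
qed

text \<open>Higher derivatives of h are not assumed, so the sign of a third derivative is replaced
  by increments: the derivative of y \<mapsto> h (y - x) - h (y - x') is an increment of h' over the
  fixed length x' - x, which grows strictly with y. The mean value theorem on both subintervals then
  compares the slopes.\<close>

lemma spread_averse_difference_cost:
  assumes h: "h differentiable_on UNIV" and conv: "strictly_convex (deriv h)"
  shows "spread_averse_cost (\<lambda>x y. h (y - x))"
proof
  have d: "(h has_field_derivative deriv h y) (at y)" for y
    using h by (simp add: differentiable_on_def DERIV_deriv_iff_real_differentiable)
  have "continuous_on UNIV h"
    using h by (rule differentiable_imp_continuous_on)
  then show "continuous_on UNIV (\<lambda>z. h (snd z - fst z))"
    by (rule continuous_on_compose2) (auto intro!: continuous_intros)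
  fix x x' a b c :: real
  assume x: "x < x'" and ab: "a < b" and bc: "b < c"
  define g where "g y = h (y - x) - h (y - x')" for y
  define g' where "g' y = deriv h (y - x) - deriv h (y - x')" for y
  have dg: "(g has_field_derivative g' y) (at y)" for y
    unfolding g_def g'_def by (auto intro!: derivative_eq_intros DERIV_chain2[OF d])
  have g'_less: "g' y < g' z" if "y < z" for y z
    using strictly_convex_increment_less[OF conv, of "y - x'" "z - x'" "x' - x"] that x by (simp add: g'_def)
  obtain u where u: "a < u" "u < b" "g b - g a = (b - a) * g' u"
    using MVT2[OF ab, of g g'] dg by auto
  obtain v where v: "b < v" "v < c" "g c - g b = (c - b) * g' v"
    using MVT2[OF bc, of g g'] dg by auto
  have "g' u < g' v"
    using u v by (intro g'_less) simp
  then have "(b - a) * (c - b) * g' u < (b - a) * (c - b) * g' v"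
    using ab bc by (intro mult_strict_left_mono) auto
  then show "(h (b - x) - h (b - x') - (h (a - x) - h (a - x'))) * (c - b) < (h (c - x) - h (c - x') - (h (b - x) - h (b - x'))) * (b - a)"
    using u(3) v(3) unfolding g_def by (simp add: mult_ac)
qed

text \<open>The lower bound a + b makes the negative part of the cost integrable under every
  martingale plan. \<open>ext_integral\<close> therefore never subtracts infinity from infinity, and
  finite cost is the same as integrability.\<close>

lemma (in cost_bound) transport_cost_eq:
  assumes k: "martingale_kernel \<mu> \<nu> \<kappa>"
  shows "transport_cost c (semidirect \<mu> \<kappa>) =
    (if integrable (semidirect \<mu> \<kappa>) (\<lambda>(x, y). c x y) then ereal (\<integral>(x, y). c x y \<partial>semidirect \<mu> \<kappa>) else \<infinity>)"
proof -
  interpret martingale_kernel \<mu> \<nu> \<kappa> by (rule k)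
  let ?f = "\<lambda>(x, y). c x y"
  let ?P = "\<integral>\<^sup>+ z. ennreal (?f z) \<partial>semidirect \<mu> \<kappa>" and ?N = "\<integral>\<^sup>+ z. ennreal (- ?f z) \<partial>semidirect \<mu> \<kappa>"
  have fm: "?f \<in> borel_measurable (semidirect \<mu> \<kappa>)"
    using c_measurable by (simp add: measurable_cong_sets[OF sets_semidirect refl])
  have "?N \<le> (\<integral>\<^sup>+ z. ennreal (norm (a (fst z) + b (snd z))) \<partial>semidirect \<mu> \<kappa>)"
  proof (intro nn_integral_mono ennreal_leI)
    fix z
    show "- ?f z \<le> norm (a (fst z) + b (snd z))"
      using c_ge[of "fst z" "snd z"] by (auto simp: case_prod_beta')
  qed
  also have "\<dots> < \<infinity>"
    using integrable_ab[OF k] by (simp add: integrable_iff_bounded)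
  finally have N: "?N < top" by simp
  show ?thesis
  proof (cases "integrable (semidirect \<mu> \<kappa>) ?f")
    case True
    have "?P \<le> (\<integral>\<^sup>+ z. ennreal (norm (?f z)) \<partial>semidirect \<mu> \<kappa>)"
      by (intro nn_integral_mono ennreal_leI) simp
    also have "\<dots> < \<infinity>"
      using True by (simp add: integrable_iff_bounded)
    finally have P: "?P < top" by simp
    obtain p where p: "?P = ennreal p" "0 \<le> p"
      using P by (cases "?P") auto
    obtain n where n: "?N = ennreal n" "0 \<le> n"
      using N by (cases "?N") auto
    show ?thesis
      using True p n real_lebesgue_integral_def[OF True]
      by (simp add: transport_cost_def ext_integral_def enn2ereal_ennreal)
  next
    case False
    moreover have "?N \<noteq> \<infinity>"
      using N by auto
    ultimately have P: "?P = top"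
      using fm unfolding real_integrable_def by auto
    obtain n where n: "?N = ennreal n" "0 \<le> n"
      using N by (cases "?N") auto
    show ?thesis
      using False P n by (simp add: transport_cost_def ext_integral_def enn2ereal_ennreal)
  qed
qed

theorem theorem1p7:
  fixes \<mu> \<nu> :: "real measure"
    and c :: "real \<Rightarrow> real \<Rightarrow> real"
    and h :: "real \<Rightarrow> real"
  assumes "prob_space \<mu>" and "prob_space \<nu>"
    and "\<mu> \<preceq>\<^sub>C \<nu>"
    and "\<And>x y. c x y = h (y - x)"
    and "h differentiable_on UNIV"
    and "strictly_convex (deriv h)"
    and "sufficient_integrability c \<mu> \<nu>"
    and "optimal_cost c \<mu> \<nu> < \<infinity>"
  shows "minimizers c \<mu> \<nu> = {left_curtain \<mu> \<nu>}"
proof -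
  have sets: "sets \<mu> = sets borel" and int: "integrable \<mu> (\<lambda>x. x)" "integrable \<nu> (\<lambda>x. x)"
    using assms(3) by (auto simp: convex_order_def finite_first_moment_def)
  have c: "c = (\<lambda>x y. h (y - x))"
    using assms(4) by (intro ext)
  interpret spread_averse_cost c
    unfolding c by (rule spread_averse_difference_cost[OF assms(5,6)])
  obtain a b where ab: "integrable \<mu> a" "integrable \<nu> b" "\<And>x y. a x + b y \<le> c x y"
    using assms(7) by (auto simp: sufficient_integrability_def)
  interpret transport_problem \<mu> \<nu> c a b
  proof (intro transport_problem.intro transport_problem_axioms.intro cost_bound.intro)
    show "(\<lambda>(x, y). c x y) \<in> borel_measurable borel"
      using borel_measurable_continuous_onI[OF c_cont] by (simp add: case_prod_beta')
    have "continuous_on UNIV (\<lambda>y. c (fst (x, y)) (snd (x, y)))" for x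
      by (rule continuous_on_compose2[OF c_cont]) (auto intro!: continuous_intros)
    then show "isCont (c x) y" for x y
      by (simp add: continuous_on_eq_continuous_at)
  qed (fact assms(1) sets int ab)+
  note plans = martingale_plans_eq[OF assms(1) sets, of \<nu>]
  note cost = transport_cost_eq
  obtain \<pi>0 where "\<pi>0 \<in> martingale_plans \<mu> \<nu>" "transport_cost c \<pi>0 < \<infinity>"
    using assms(8) unfolding optimal_cost_def INF_less_iff by blast
  then have ne: "\<exists>\<kappa>\<in>martingale_kernels \<mu> \<nu>. integrable (semidirect \<mu> \<kappa>) (\<lambda>(x, y). c x y)"
  proof -
    obtain \<kappa> where "martingale_kernel \<mu> \<nu> \<kappa>" "\<pi>0 = semidirect \<mu> \<kappa>"
      using \<open>\<pi>0 \<in> martingale_plans \<mu> \<nu>\<close> unfolding plans by (auto simp: martingale_kernels_iff)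
    then show ?thesis
      using \<open>transport_cost c \<pi>0 < \<infinity>\<close> cost[of \<kappa>] by (auto simp: martingale_kernels_iff split: if_splits)
  qed
  obtain \<kappa> where \<kappa>: "\<kappa> \<in> martingale_kernels \<mu> \<nu>" "integrable (semidirect \<mu> \<kappa>) (\<lambda>(x, y). c x y)"
    "\<And>\<kappa>'. \<kappa>' \<in> martingale_kernels \<mu> \<nu> \<Longrightarrow> integrable (semidirect \<mu> \<kappa>') (\<lambda>(x, y). c x y) \<Longrightarrow>
      (\<integral>(x, y). c x y \<partial>semidirect \<mu> \<kappa>) \<le> (\<integral>(x, y). c x y \<partial>semidirect \<mu> \<kappa>')"
    by (rule exists_minimizer[OF ne]) (rule that)
  have \<kappa>_min: "semidirect \<mu> \<kappa> \<in> minimizers c \<mu> \<nu>"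
    using \<kappa> cost by (auto simp: minimizers_def plans martingale_kernels_iff)
  have lm: "left_monotone \<pi>" if \<pi>: "\<pi> \<in> minimizers c \<mu> \<nu>" for \<pi>
  proof -
    obtain \<kappa>' where \<kappa>': "martingale_kernel \<mu> \<nu> \<kappa>'" "\<pi> = semidirect \<mu> \<kappa>'"
      using \<pi> by (auto simp: minimizers_def plans martingale_kernels_iff)
    have le: "transport_cost c \<pi> \<le> transport_cost c (semidirect \<mu> \<kappa>'')" if "martingale_kernel \<mu> \<nu> \<kappa>''" for \<kappa>''
      using \<pi> that by (auto simp: minimizers_def plans martingale_kernels_iff)
    \<comment> \<open>Comparison with the minimizer already found shows that any other minimizer has
      finite, hence integrable, cost, as the exchange argument requires.\<close>
    have "transport_cost c \<pi> \<noteq> \<infinity>"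
      using le[of \<kappa>] \<kappa> cost by (auto simp: martingale_kernels_iff)
    then have i: "integrable (semidirect \<mu> \<kappa>') (\<lambda>(x, y). c x y)"
      using cost[OF \<kappa>'(1)] \<kappa>'(2) by (auto split: if_splits)
    interpret martingale_kernel \<mu> \<nu> \<kappa>' by (rule \<kappa>'(1))
    interpret cost_minimizer \<mu> \<nu> \<kappa>' c
    proof
      show "integrable (semidirect \<mu> \<kappa>') (\<lambda>(x, y). c x y)" by (rule i)
      show "(\<integral>(x, y). c x y \<partial>semidirect \<mu> \<kappa>') \<le> (\<integral>(x, y). c x y \<partial>semidirect \<mu> \<kappa>'')"
        if "martingale_kernel \<mu> \<nu> \<kappa>''" "integrable (semidirect \<mu> \<kappa>'') (\<lambda>(x, y). c x y)" for \<kappa>''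
        using le[OF that(1)] that i cost[OF \<kappa>'(1)] cost[OF that(1)] \<kappa>'(2) by simp
    qed
    show ?thesis
      unfolding \<kappa>'(2) by (rule left_monotone)
  qed
  \<comment> \<open>The reference plan is the minimizer found above; it is left-monotone itself, so
    uniqueness among left-monotone plans applies to it.\<close>
  have unique: "\<pi> = semidirect \<mu> \<kappa>" if \<pi>: "\<pi> \<in> martingale_plans \<mu> \<nu>" "left_monotone \<pi>" for \<pi>
  proof -
    obtain \<kappa>' where \<kappa>': "martingale_kernel \<mu> \<nu> \<kappa>'" "\<pi> = semidirect \<mu> \<kappa>'"
      using \<pi>(1) by (auto simp: plans martingale_kernels_iff)
    have "martingale_coupling \<mu> \<nu> \<kappa>'" "martingale_coupling \<mu> \<nu> \<kappa>"
      using \<kappa>' \<kappa> int by (auto simp: martingale_kernels_iff martingale_coupling_def martingale_coupling_axioms_def)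
    from left_monotone_unique[OF this \<pi>(2)[unfolded \<kappa>'(2)] lm[OF \<kappa>_min]] show ?thesis
      unfolding \<kappa>'(2) .
  qed
  have sub: "\<pi> \<in> martingale_plans \<mu> \<nu>" if "\<pi> \<in> minimizers c \<mu> \<nu>" for \<pi>
    using that by (simp add: minimizers_def)
  \<comment> \<open>The definite description needs both existence, supplied by the left-monotone
    minimizer, and uniqueness.\<close>
  have "left_curtain \<mu> \<nu> = semidirect \<mu> \<kappa>"
    unfolding left_curtain_def
    by (rule the_equality, intro conjI sub lm \<kappa>_min, elim conjE, rule unique)
  moreover have "minimizers c \<mu> \<nu> = {semidirect \<mu> \<kappa>}"
    using \<kappa>_min unique[OF sub lm] by blast
  ultimately show ?thesis
    by simp
qed

end
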